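(* Let $\mathcal G$ be an ultragraph satisfying the graph-theoretic RFD conditions (B1)--(B4). Then the ultragraph $C^*$-algebra $C^*(\mathcal G)$ is residually finite-dimensional.
   Context: Ultragraphs. An ultragraph is a quadruple $\mathcal G=(G^0,\mathcal G^1,r,s)$ with $G^0$ a set of vertices, $\mathcal G^1$ a set of edges, $s:\mathcal G^1\to G^0$ and $r:\mathcal G^1\to\mathcal P(G^0)\setminus\{\emptyset\}$. $\mathcal G^0$ is the smallest collection of subsets of $G^0$ containing all singletons $\{v\}$ and all ranges $r(e)$ and closed under finite unions and finite intersections (with $\emptyset\in\mathcal G^0$). A path of length $n\ge1$ is a word $\alpha=e_1\cdots e_n$ of edges with $s(e_{i+1})\in r(e_i)$ for $1\le i<n$; $s(\alpha)=s(e_1)$, $r(\alpha)=r(e_n)$. A vertex $v$ is a sink if $s^{-1}(v)=\emptyset$, and regular if $0<|s^{-1}(v)|<\infty$. For $A\in\mathcal G^0$ let $\varepsilon(A)=\{e\in\mathcal G^1:s(e)\in A\}$; $A$ is an infinite emitter if $|\varepsilon(A)|=\infty$. $A\in\mathcal G^0$ is a minimal infinite emitter if $|\varepsilon(A)|=\infty$ and no proper subset $B\subsetneq A$ with $B\in\mathcal G^0$ is either an infinite emitter or an infinite set with $|\varepsilon(B)|<\infty$. $A\in\mathcal G^0$ is a minimal sink if $|A|=\infty$, $|\varepsilon(A)|<\infty$ and no proper subset $B\subsetneq A$ with $B\in\mathcal G^0$ is infinite. Terminal boundary sets. $\mathcal A\subseteq\mathcal G^0$ is the collection of all minimal infinite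 emitters, all minimal sinks, and all $\{v\}$ with $v$ a sink; its elements are terminal boundary sets. Cycles. A cycle is a path $c=e_1\cdots e_n$, $n\ge1$, with $s(e_1)\in r(e_n)$ and $s(e_1),\dots,s(e_n)$ distinct; the vertices on $c$ are the $s(e_i)$. An exit for $c$ is either an edge $f$ with $s(f)\in r(e_i)$ and $f\ne e_{i+1}$ for some $i$ (indices cyclic), or a sink $w\in r(e_i)$ for some $i$. Graph-theoretic RFD conditions. (B1) No infinite receivers: for every $v\in G^0$ the set $\{e\in\mathcal G^1:v\in r(e)\}$ is finite. (B2) No cycle has an exit. (B3) No infinite backward chains: there is no infinite sequence of distinct edges $e_1,e_2,e_3,\dots$ with $s(e_i)\in r(e_{i+1})$ for all $i\ge1$. (B4) Every $v\in G^0$ reaches a terminal boundary set (i.e. $\{v\}\in\mathcal A$, or there are a path $\alpha$ with $|\alpha|\ge1$, $s(\alpha)=v$, and $A\in\mathcal A$ with $A\subseteq r(\alpha)$) or reaches a cycle (i.e. $v$ lies on a cycle, or there is a path $\alpha$ with $|\alpha|\ge1$, $s(\alpha)=v$, such that $r(\alpha)$ contains a vertex lying on a cycle). Algebra. $C^*(\mathcal G)$ is the universal $C^*$-algebra generated by projections $p_A$ ($A\in\mathcal G^0$) and partial isometries $s_e$ ($e\in\mathcal G^1$) with mutually orthogonal ranges such that $p_\emptyset=0$, $p_Ap_B=p_{A\cap B}$, $p_{A\cup B}=p_A+p_B-p_{A\cap B}$, $s_e^*s_e=p_{r(e)}$, $s_es_e^*\le p_{s(e)}$, and $p_{\{v\}}=\sum_{s(e)=v}s_es_e^*$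 for every regular vertex $v$. RFD. A $C^*$-algebra is residually finite-dimensional (RFD) if its finite-dimensional $*$-representations separate points. *)

theory Defs
  imports
    Complex_Main
    "HOL-Algebra.Module"
    "Jordan_Normal_Form.Schur_Decomposition"
begin

section \<open>Ultragraphs\<close>

record ('v, 'e) ultragraph =
  verts :: "'v set"
  edges :: "'e set"
  rng :: "'e \<Rightarrow> 'v set"
  src :: "'e \<Rightarrow> 'v"

definition is_ultragraph :: "('v, 'e) ultragraph \<Rightarrow> bool" where
  "is_ultragraph G \<longleftrightarrow>
     (\<forall>e\<in>edges G. src G e \<in> verts G \<and> rng G e \<subseteq> verts G \<and> rng G e \<noteq> {})"

text \<open>The collection written \<open>\<G>\<^sup>0\<close> in the literature. It is not closed under relative complements.\<close>

inductive_set gen_verts :: "('v, 'e) ultragraph \<Rightarrow> 'v set set"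
  for G :: "('v, 'e) ultragraph" where
  empty: "{} \<in> gen_verts G"
| vertex: "v \<in> verts G \<Longrightarrow> {v} \<in> gen_verts G"
| range: "e \<in> edges G \<Longrightarrow> rng G e \<in> gen_verts G"
| union: "X \<in> gen_verts G \<Longrightarrow> Y \<in> gen_verts G \<Longrightarrow> X \<union> Y \<in> gen_verts G"
| inter: "X \<in> gen_verts G \<Longrightarrow> Y \<in> gen_verts G \<Longrightarrow> X \<inter> Y \<in> gen_verts G"

definition emitted :: "('v, 'e) ultragraph \<Rightarrow> 'v set \<Rightarrow> 'e set" where
  "emitted G X = {e \<in> edges G. src G e \<in> X}"

definition is_sink :: "('v, 'e) ultragraph \<Rightarrow> 'v \<Rightarrow> bool" where
  "is_sink G v \<longleftrightarrow> v \<in> verts G \<and> emitted G {v} = {}"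

definition is_regular :: "('v, 'e) ultragraph \<Rightarrow> 'v \<Rightarrow> bool" where
  "is_regular G v \<longleftrightarrow> v \<in> verts G \<and> emitted G {v} \<noteq> {} \<and> finite (emitted G {v})"

definition is_path :: "('v, 'e) ultragraph \<Rightarrow> 'e list \<Rightarrow> bool" where
  "is_path G es \<longleftrightarrow> es \<noteq> [] \<and> set es \<subseteq> edges G \<and>
     (\<forall>i. Suc i < length es \<longrightarrow> src G (es ! Suc i) \<in> rng G (es ! i))"

definition path_src :: "('v, 'e) ultragraph \<Rightarrow> 'e list \<Rightarrow> 'v" where
  "path_src G es = src G (hd es)"

definition path_rng :: "('v, 'e) ultragraph \<Rightarrow> 'e list \<Rightarrow> 'v set" where
  "path_rng G es = rng G (last es)"

definition minimal_infinite_emitter :: "('v, 'e) ultragraph \<Rightarrow> 'v set \<Rightarrow> bool" where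
  "minimal_infinite_emitter G X \<longleftrightarrow>
     X \<in> gen_verts G \<and> infinite (emitted G X) \<and>
     \<not> (\<exists>Y\<in>gen_verts G. Y \<subset> X \<and>
          (infinite (emitted G Y) \<or> (infinite Y \<and> finite (emitted G Y))))"

definition minimal_sink :: "('v, 'e) ultragraph \<Rightarrow> 'v set \<Rightarrow> bool" where
  "minimal_sink G X \<longleftrightarrow>
     X \<in> gen_verts G \<and> infinite X \<and> finite (emitted G X) \<and>
     \<not> (\<exists>Y\<in>gen_verts G. Y \<subset> X \<and> infinite Y)"

definition terminal_sets :: "('v, 'e) ultragraph \<Rightarrow> 'v set set" where
  "terminal_sets G =
     {X. minimal_infinite_emitter G X} \<union> {X. minimal_sink G X} \<union> {{v} | v. is_sink G v}"

definition is_cycle :: "('v, 'e) ultragraph \<Rightarrow> 'e list \<Rightarrow> bool" where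
  "is_cycle G c \<longleftrightarrow> is_path G c \<and> path_src G c \<in> path_rng G c \<and> distinct (map (src G) c)"

definition on_cycle :: "('v, 'e) ultragraph \<Rightarrow> 'v \<Rightarrow> bool" where
  "on_cycle G v \<longleftrightarrow> (\<exists>c. is_cycle G c \<and> v \<in> src G ` set c)"

definition has_exit :: "('v, 'e) ultragraph \<Rightarrow> 'e list \<Rightarrow> bool" where
  "has_exit G c \<longleftrightarrow> (\<exists>i<length c.
     (\<exists>f\<in>edges G. src G f \<in> rng G (c ! i) \<and> f \<noteq> c ! (Suc i mod length c)) \<or>
     (\<exists>w\<in>rng G (c ! i). is_sink G w))"

definition no_infinite_receivers :: "('v, 'e) ultragraph \<Rightarrow> bool" where
  "no_infinite_receivers G \<longleftrightarrow> (\<forall>v\<in>verts G. finite {e \<in> edges G. v \<in> rng G e})"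

definition no_cycle_has_exit :: "('v, 'e) ultragraph \<Rightarrow> bool" where
  "no_cycle_has_exit G \<longleftrightarrow> (\<forall>c. is_cycle G c \<longrightarrow> \<not> has_exit G c)"

definition no_infinite_backward_chains :: "('v, 'e) ultragraph \<Rightarrow> bool" where
  "no_infinite_backward_chains G \<longleftrightarrow>
     \<not> (\<exists>f :: nat \<Rightarrow> 'e. inj f \<and> range f \<subseteq> edges G \<and>
          (\<forall>i. src G (f i) \<in> rng G (f (Suc i))))"

definition reaches_terminal_set :: "('v, 'e) ultragraph \<Rightarrow> 'v \<Rightarrow> bool" where
  "reaches_terminal_set G v \<longleftrightarrow> {v} \<in> terminal_sets G \<or>
     (\<exists>\<alpha>. is_path G \<alpha> \<and> path_src G \<alpha> = v \<and> (\<exists>X\<in>terminal_sets G. X \<subseteq> path_rng G \<alpha>))"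

definition reaches_cycle :: "('v, 'e) ultragraph \<Rightarrow> 'v \<Rightarrow> bool" where
  "reaches_cycle G v \<longleftrightarrow> on_cycle G v \<or>
     (\<exists>\<alpha>. is_path G \<alpha> \<and> path_src G \<alpha> = v \<and> (\<exists>w\<in>path_rng G \<alpha>. on_cycle G w))"

definition every_vertex_terminates :: "('v, 'e) ultragraph \<Rightarrow> bool" where
  "every_vertex_terminates G \<longleftrightarrow>
     (\<forall>v\<in>verts G. reaches_terminal_set G v \<or> reaches_cycle G v)"


section \<open>C*-algebras\<close>

text \<open>C*-algebras are carrier-based, because the universal property below quantifies over them.
  They need not be unital: the field \<open>one\<close> inherited from HOL-Algebra's \<open>ring\<close> record
  is never used.\<close>

record 'a cstar = "(complex, 'a) module" +
  star :: "'a \<Rightarrow> 'a"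
  nrm :: "'a \<Rightarrow> real"

locale cstar_algebra = abelian_group A for A :: "'a cstar" (structure) +
  assumes mult_closed: "\<lbrakk>x \<in> carrier A; y \<in> carrier A\<rbrakk> \<Longrightarrow> x \<otimes> y \<in> carrier A"
    and mult_assoc: "\<lbrakk>x \<in> carrier A; y \<in> carrier A; z \<in> carrier A\<rbrakk>
          \<Longrightarrow> (x \<otimes> y) \<otimes> z = x \<otimes> (y \<otimes> z)"
    and distr_right: "\<lbrakk>x \<in> carrier A; y \<in> carrier A; z \<in> carrier A\<rbrakk>
          \<Longrightarrow> (x \<oplus> y) \<otimes> z = x \<otimes> z \<oplus> y \<otimes> z"
    and distr_left: "\<lbrakk>x \<in> carrier A; y \<in> carrier A; z \<in> carrier A\<rbrakk>
          \<Longrightarrow> z \<otimes> (x \<oplus> y) = z \<otimes> x \<oplus> z \<otimes> y"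
    and scale_closed: "x \<in> carrier A \<Longrightarrow> a \<odot> x \<in> carrier A"
    and scale_add_left: "x \<in> carrier A \<Longrightarrow> (a + b) \<odot> x = a \<odot> x \<oplus> b \<odot> x"
    and scale_add_right: "\<lbrakk>x \<in> carrier A; y \<in> carrier A\<rbrakk>
          \<Longrightarrow> a \<odot> (x \<oplus> y) = a \<odot> x \<oplus> a \<odot> y"
    and scale_scale: "x \<in> carrier A \<Longrightarrow> (a * b) \<odot> x = a \<odot> (b \<odot> x)"
    and scale_one: "x \<in> carrier A \<Longrightarrow> 1 \<odot> x = x"
    and scale_mult_left: "\<lbrakk>x \<in> carrier A; y \<in> carrier A\<rbrakk>
          \<Longrightarrow> (a \<odot> x) \<otimes> y = a \<odot> (x \<otimes> y)"
    and scale_mult_right: "\<lbrakk>x \<in> carrier A; y \<in> carrier A\<rbrakk>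
          \<Longrightarrow> x \<otimes> (a \<odot> y) = a \<odot> (x \<otimes> y)"
    and star_closed: "x \<in> carrier A \<Longrightarrow> star A x \<in> carrier A"
    and star_add: "\<lbrakk>x \<in> carrier A; y \<in> carrier A\<rbrakk>
          \<Longrightarrow> star A (x \<oplus> y) = star A x \<oplus> star A y"
    and star_scale: "x \<in> carrier A \<Longrightarrow> star A (a \<odot> x) = cnj a \<odot> star A x"
    and star_mult: "\<lbrakk>x \<in> carrier A; y \<in> carrier A\<rbrakk>
          \<Longrightarrow> star A (x \<otimes> y) = star A y \<otimes> star A x"
    and star_star: "x \<in> carrier A \<Longrightarrow> star A (star A x) = x"
    and nrm_nonneg: "x \<in> carrier A \<Longrightarrow> 0 \<le> nrm A x"
    and nrm_eq_0: "x \<in> carrier A \<Longrightarrow> nrm A x = 0 \<longleftrightarrow> x = \<zero>"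
    and nrm_scale: "x \<in> carrier A \<Longrightarrow> nrm A (a \<odot> x) = cmod a * nrm A x"
    and nrm_triangle: "\<lbrakk>x \<in> carrier A; y \<in> carrier A\<rbrakk>
          \<Longrightarrow> nrm A (x \<oplus> y) \<le> nrm A x + nrm A y"
    and nrm_mult: "\<lbrakk>x \<in> carrier A; y \<in> carrier A\<rbrakk>
          \<Longrightarrow> nrm A (x \<otimes> y) \<le> nrm A x * nrm A y"
    and cstar_identity: "x \<in> carrier A \<Longrightarrow> nrm A (star A x \<otimes> x) = (nrm A x)\<^sup>2"
    and complete: "\<lbrakk>range X \<subseteq> carrier A;
            \<forall>\<epsilon>>0. \<exists>N::nat. \<forall>m\<ge>N. \<forall>n\<ge>N. nrm A (X m \<ominus> X n) < \<epsilon>\<rbrakk>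
          \<Longrightarrow> \<exists>x\<in>carrier A. (\<lambda>n. nrm A (X n \<ominus> x)) \<longlonglongrightarrow> 0"

definition closed_star_subalgebra :: "'a cstar \<Rightarrow> 'a set \<Rightarrow> bool" where
  "closed_star_subalgebra A S \<longleftrightarrow>
     S \<subseteq> carrier A \<and> \<zero>\<^bsub>A\<^esub> \<in> S \<and>
     (\<forall>x\<in>S. \<forall>y\<in>S. x \<oplus>\<^bsub>A\<^esub> y \<in> S \<and> x \<otimes>\<^bsub>A\<^esub> y \<in> S) \<and>
     (\<forall>x\<in>S. star A x \<in> S \<and> (\<forall>a. a \<odot>\<^bsub>A\<^esub> x \<in> S)) \<and>
     (\<forall>X x. range X \<subseteq> S \<and> x \<in> carrier A \<and> (\<lambda>n::nat. nrm A (X n \<ominus>\<^bsub>A\<^esub> x)) \<longlonglongrightarrow> 0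
        \<longrightarrow> x \<in> S)"

definition generates :: "'a cstar \<Rightarrow> 'a set \<Rightarrow> bool" where
  "generates A T \<longleftrightarrow> T \<subseteq> carrier A \<and>
     (\<forall>S. closed_star_subalgebra A S \<and> T \<subseteq> S \<longrightarrow> S = carrier A)"

definition star_hom :: "'a cstar \<Rightarrow> 'b cstar \<Rightarrow> ('a \<Rightarrow> 'b) \<Rightarrow> bool" where
  "star_hom A B h \<longleftrightarrow>
     (\<forall>x\<in>carrier A. h x \<in> carrier B) \<and>
     (\<forall>x\<in>carrier A. \<forall>y\<in>carrier A.
        h (x \<oplus>\<^bsub>A\<^esub> y) = h x \<oplus>\<^bsub>B\<^esub> h y \<and> h (x \<otimes>\<^bsub>A\<^esub> y) = h x \<otimes>\<^bsub>B\<^esub> h y) \<and>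
     (\<forall>x\<in>carrier A. h (star A x) = star B (h x) \<and> (\<forall>a. h (a \<odot>\<^bsub>A\<^esub> x) = a \<odot>\<^bsub>B\<^esub> h x))"

definition projection :: "'a cstar \<Rightarrow> 'a \<Rightarrow> bool" where
  "projection A x \<longleftrightarrow> x \<in> carrier A \<and> star A x = x \<and> x \<otimes>\<^bsub>A\<^esub> x = x"

definition partial_isometry :: "'a cstar \<Rightarrow> 'a \<Rightarrow> bool" where
  "partial_isometry A x \<longleftrightarrow> x \<in> carrier A \<and> x \<otimes>\<^bsub>A\<^esub> star A x \<otimes>\<^bsub>A\<^esub> x = x"

text \<open>The usual partial order of projections; it is applied to projections only.\<close>

definition proj_le :: "'a cstar \<Rightarrow> 'a \<Rightarrow> 'a \<Rightarrow> bool" where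
  "proj_le A x y \<longleftrightarrow> x = y \<otimes>\<^bsub>A\<^esub> x"

text \<open>A finite-dimensional *-representation: a *-homomorphism into the bounded operators on
  the Hilbert space of \<open>n\<close>-tuples of complex numbers, i.e. into the complex
  \<open>n\<close> by \<open>n\<close> matrices with the conjugate transpose as involution.
  No nondegeneracy is required.\<close>

definition fin_dim_rep :: "'a cstar \<Rightarrow> nat \<Rightarrow> ('a \<Rightarrow> complex mat) \<Rightarrow> bool" where
  "fin_dim_rep A n \<pi> \<longleftrightarrow>
     (\<forall>x\<in>carrier A. \<pi> x \<in> carrier_mat n n) \<and>
     (\<forall>x\<in>carrier A. \<forall>y\<in>carrier A. \<pi> (x \<oplus>\<^bsub>A\<^esub> y) = \<pi> x + \<pi> y \<and> \<pi> (x \<otimes>\<^bsub>A\<^esub> y) = \<pi> x * \<pi> y) \<and>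
     (\<forall>x\<in>carrier A. \<pi> (star A x) = mat_adjoint (\<pi> x) \<and>
        (\<forall>a. \<pi> (a \<odot>\<^bsub>A\<^esub> x) = a \<cdot>\<^sub>m \<pi> x))"

definition residually_finite_dimensional :: "'a cstar \<Rightarrow> bool" where
  "residually_finite_dimensional A \<longleftrightarrow>
     (\<forall>x\<in>carrier A. \<forall>y\<in>carrier A. x \<noteq> y \<longrightarrow> (\<exists>n \<pi>. fin_dim_rep A n \<pi> \<and> \<pi> x \<noteq> \<pi> y))"


section \<open>The C*-algebra of an ultragraph\<close>

text \<open>The defining relations. Outside \<open>gen_verts G\<close> and \<open>edges G\<close> the families
  \<open>p\<close> and \<open>s\<close> are unconstrained.\<close>

definition ultragraph_family ::
    "('v, 'e) ultragraph \<Rightarrow> 'a cstar \<Rightarrow> ('v set \<Rightarrow> 'a) \<Rightarrow> ('e \<Rightarrow> 'a) \<Rightarrow> bool" where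
  "ultragraph_family G A p s \<longleftrightarrow>
     (\<forall>X\<in>gen_verts G. projection A (p X)) \<and>
     (\<forall>e\<in>edges G. partial_isometry A (s e)) \<and>
     (\<forall>e\<in>edges G. \<forall>f\<in>edges G. e \<noteq> f \<longrightarrow>
        (s e \<otimes>\<^bsub>A\<^esub> star A (s e)) \<otimes>\<^bsub>A\<^esub> (s f \<otimes>\<^bsub>A\<^esub> star A (s f)) = \<zero>\<^bsub>A\<^esub>) \<and>
     p {} = \<zero>\<^bsub>A\<^esub> \<and>
     (\<forall>X\<in>gen_verts G. \<forall>Y\<in>gen_verts G.
        p X \<otimes>\<^bsub>A\<^esub> p Y = p (X \<inter> Y) \<and>
        p (X \<union> Y) = p X \<oplus>\<^bsub>A\<^esub> p Y \<ominus>\<^bsub>A\<^esub> p (X \<inter> Y)) \<and>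
     (\<forall>e\<in>edges G. star A (s e) \<otimes>\<^bsub>A\<^esub> s e = p (rng G e)) \<and>
     (\<forall>e\<in>edges G. proj_le A (s e \<otimes>\<^bsub>A\<^esub> star A (s e)) (p {src G e})) \<and>
     (\<forall>v. is_regular G v \<longrightarrow>
        p {v} = finsum A (\<lambda>e. s e \<otimes>\<^bsub>A\<^esub> star A (s e)) (emitted G {v}))"

text \<open>HOL cannot quantify over all types inside a formula, so the universal property is stated for
  all C*-algebras carried by subsets of the following type. This loses nothing:
  put \<open>\<kappa> = |('v set + 'e + nat) list|\<close>, an infinite cardinal. A C*-algebra generated by
  a family indexed by \<open>gen_verts G\<close> and \<open>edges G\<close> has a dense subset of at most
  \<open>\<kappa>\<close> elements, hence at most \<open>\<kappa>\<^sup>\<omega> \<le> 2\<^sup>\<kappa>\<close> elements, and thus has an isomorphic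
  copy carried by this type. Since a family in any C*-algebra lies in the C*-subalgebra it
  generates, the property below implies universality among all C*-algebras, and a universal
  C*-algebra exists on this type.\<close>

type_synonym ('v, 'e) test_carrier = "('v set + 'e + nat) list \<Rightarrow> complex"

text \<open>\<open>A\<close> with the generators \<open>p\<close>, \<open>s\<close> is the universal C*-algebra of \<open>G\<close>.
  Uniqueness of the homomorphism \<open>h\<close> on \<open>A\<close> is automatic, as \<open>p\<close> and \<open>s\<close>
  generate \<open>A\<close>.\<close>

definition is_ultragraph_algebra ::
    "('v, 'e) ultragraph \<Rightarrow> 'a cstar \<Rightarrow> ('v set \<Rightarrow> 'a) \<Rightarrow> ('e \<Rightarrow> 'a) \<Rightarrow> bool" where
  "is_ultragraph_algebra G A p s \<longleftrightarrow>
     cstar_algebra A \<and> ultragraph_family G A p s \<and>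
     generates A (p ` gen_verts G \<union> s ` edges G) \<and>
     (\<forall>(B :: ('v, 'e) test_carrier cstar) q t.
        cstar_algebra B \<and> ultragraph_family G B q t \<longrightarrow>
        (\<exists>h. star_hom A B h \<and> (\<forall>X\<in>gen_verts G. h (p X) = q X) \<and> (\<forall>e\<in>edges G. h (s e) = t e)))"

end

theory Submission
  imports Defs "HOL-Analysis.L2_Norm"
begin

text \<open>Call elements \<open>y\<close>, \<open>b\<close> of \<open>A\<close> equivalent if no finite-dimensional
  representation separates them. The point is that an element \<open>y\<close> of the *-algebra generated by
  the \<open>p\<close> and \<open>s\<close> satisfies \<open>nrm A y \<le> nrm A b\<close> for every equivalent \<open>b\<close>;
  if \<open>x\<close> is killed by all finite-dimensional representations and \<open>y\<close> approximates \<open>x\<close>,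
  this is applied to \<open>b = y - x\<close>. No gauge-invariant uniqueness theorem is used.

  Finitely many generators lie in the span of explicit matrix units: cutting the vertices into finitely
  many atoms, one subtracts from the projection of each atom the ranges of the chosen edges that start
  there, and transports the remaining gap projections along the finitely many cycle-free paths; a
  cycle contributes Laurent monomials in one unitary, since it has no exit. By the first and third
  graph conditions only finitely many paths end in a given vertex and avoid the cycles, so paths to a
  terminal boundary set or into a cycle span a finite-dimensional representation. The fourth
  condition makes enough of them available to bound the coefficients of
  matrix units. This gives \<open>nrm A y \<le> C * (n + 1) * nrm A b\<close> for \<open>y\<close> of degree \<open>n\<close> in the
  cycle unitaries, and the polynomial factor disappears when the inequality is applied to high
  powers of \<open>star A y \<otimes> y\<close>.\<close>

section \<open>Elementary C*-algebra\<close>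

text \<open>Injectivity on the dense star-algebra would not suffice: a representation faithful there
  may still kill elements of the completion. Hence the inequality for every equivalent
  \<open>b\<close>, which in the application is an arbitrary element of \<open>A\<close>. The
  coefficients of \<open>y\<close> are read off \<open>b\<close> by functionals that are bounded on
  all of \<open>A\<close> and constant on equivalence classes: entries of finite-dimensional
  representations, compressed and averaged. The constant \<open>C\<close> is independent of the
  degree because all edges may be multiplied by a scalar \<open>z\<close> of modulus one without
  changing the dimension: a Fourier coefficient in \<open>z\<close> is an average over roots of
  unity of functionals with one common bound. A second obstacle is that the lattice of vertex sets
  has no complements, so atoms lie outside it. Projections are first extended to differences of its
  members, and a finite path has to end in a set that behaves like a point of the lattice, which is
  the primeness of terminal boundary sets.\<close>

inductive_set lspan :: "'a cstar \<Rightarrow> 'a set \<Rightarrow> 'a set" for A :: "'a cstar" and B :: "'a set" where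
  zero: "\<zero>\<^bsub>A\<^esub> \<in> lspan A B"
| step: "b \<in> B \<Longrightarrow> x \<in> lspan A B \<Longrightarrow> a \<odot>\<^bsub>A\<^esub> b \<oplus>\<^bsub>A\<^esub> x \<in> lspan A B"

text \<open>Purely algebraic, without closure, so that each element involves only finitely many
  generators.\<close>

inductive_set star_alg :: "'a cstar \<Rightarrow> 'a set \<Rightarrow> 'a set" for A :: "'a cstar" and T :: "'a set" where
  zero: "\<zero>\<^bsub>A\<^esub> \<in> star_alg A T"
| gen: "x \<in> T \<Longrightarrow> x \<in> star_alg A T"
| add: "x \<in> star_alg A T \<Longrightarrow> y \<in> star_alg A T \<Longrightarrow> x \<oplus>\<^bsub>A\<^esub> y \<in> star_alg A T"
| mult: "x \<in> star_alg A T \<Longrightarrow> y \<in> star_alg A T \<Longrightarrow> x \<otimes>\<^bsub>A\<^esub> y \<in> star_alg A T"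
| star: "x \<in> star_alg A T \<Longrightarrow> star A x \<in> star_alg A T"
| scale: "x \<in> star_alg A T \<Longrightarrow> a \<odot>\<^bsub>A\<^esub> x \<in> star_alg A T"

definition lin_fun :: "'a cstar \<Rightarrow> ('a \<Rightarrow> complex) \<Rightarrow> bool" where
  "lin_fun A \<phi> \<longleftrightarrow> (\<forall>x\<in>carrier A. \<forall>y\<in>carrier A. \<phi> (x \<oplus>\<^bsub>A\<^esub> y) = \<phi> x + \<phi> y) \<and>
     (\<forall>x\<in>carrier A. \<forall>a. \<phi> (a \<odot>\<^bsub>A\<^esub> x) = a * \<phi> x)"

context cstar_algebra
begin

lemma add_self_eq: assumes "x \<in> carrier A" "x \<oplus> x = x" shows "x = \<zero>"
  using assms by (simp add: add.l_cancel_one')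

lemma mult_zero_left [simp]: assumes "x \<in> carrier A" shows "\<zero> \<otimes> x = \<zero>"
proof -
  have "\<zero> \<otimes> x \<oplus> \<zero> \<otimes> x = \<zero> \<otimes> x \<oplus> \<zero>"
    using assms distr_right[of \<zero> \<zero> x] mult_closed by simp
  then show ?thesis using assms mult_closed by (metis add_self_eq zero_closed r_zero mult_closed scale_closed)
qed

lemma mult_zero_right [simp]: assumes "x \<in> carrier A" shows "x \<otimes> \<zero> = \<zero>"
proof -
  have "x \<otimes> \<zero> \<oplus> x \<otimes> \<zero> = x \<otimes> \<zero> \<oplus> \<zero>"
    using assms distr_left[of \<zero> \<zero> x] mult_closed by simp
  then show ?thesis using assms mult_closed by (metis add_self_eq zero_closed r_zero mult_closed scale_closed)
qed

lemma scale_zero_left [simp]: assumes "x \<in> carrier A" shows "0 \<odot> x = \<zero>"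
proof -
  have "0 \<odot> x \<oplus> 0 \<odot> x = 0 \<odot> x \<oplus> \<zero>"
    using assms scale_add_left[of x 0 0] scale_closed by simp
  then show ?thesis using assms scale_closed by (metis add_self_eq zero_closed r_zero mult_closed scale_closed)
qed

lemma scale_zero_right [simp]: "a \<odot> \<zero> = \<zero>"
proof -
  have "a \<odot> \<zero> \<oplus> a \<odot> \<zero> = a \<odot> \<zero> \<oplus> \<zero>"
    using scale_add_right[of \<zero> \<zero> a] scale_closed by simp
  then show ?thesis using scale_closed by (metis add_self_eq zero_closed r_zero mult_closed scale_closed)
qed

lemma star_zero [simp]: "star A \<zero> = \<zero>"
  using star_scale[of \<zero> 0] star_closed[of \<zero>] by simp

lemma uminus_eq_scale: assumes "x \<in> carrier A" shows "\<ominus> x = (-1) \<odot> x"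
proof -
  have "(-1) \<odot> x \<oplus> x = \<zero>"
    using assms scale_add_left[of x "-1" 1] scale_one by simp
  then show ?thesis using assms scale_closed by (metis minus_equality)
qed

lemma minus_eq_scale: assumes "x \<in> carrier A" "y \<in> carrier A" shows "x \<ominus> y = x \<oplus> (-1) \<odot> y"
  using assms by (simp add: minus_eq uminus_eq_scale)

lemma add_minus_cancel: assumes "x \<in> carrier A" "y \<in> carrier A" shows "x \<oplus> (y \<ominus> x) = y" "(y \<ominus> x) \<oplus> x = y"
   using assms by (auto simp: minus_eq a_ac r_neg r_neg1 r_neg2 a_lcomm[of x y])

lemma nrm_zero [simp]: "nrm A \<zero> = 0"
  using nrm_eq_0[of \<zero>] by simp

lemma nrm_minus_commute: assumes "x \<in> carrier A" "y \<in> carrier A" shows "nrm A (x \<ominus> y) = nrm A (y \<ominus> x)"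
proof -
  have "y \<ominus> x = (-1) \<odot> (x \<ominus> y)"
    using assms by (simp add: uminus_eq_scale[symmetric] minus_eq a_ac minus_add minus_minus)
  then show ?thesis using assms nrm_scale[of "x \<ominus> y" "-1"] by simp
qed

text \<open>Isometry of the involution is not among the axioms; it follows from the C*-identity by
  cancelling one factor \<open>nrm A y\<close> and applying the result to the adjoint as
  well.\<close>

lemma nrm_star: assumes "x \<in> carrier A" shows "nrm A (star A x) = nrm A x"
proof -
  have le: "nrm A y \<le> nrm A (star A y)" if y: "y \<in> carrier A" for y
  proof (cases "nrm A y = 0")
    case True then show ?thesis using y nrm_nonneg star_closed by simp
  next
    case False
    then have pos: "nrm A y > 0" using nrm_nonneg[OF y] by simp
    have "(nrm A y)\<^sup>2 \<le> nrm A (star A y) * nrm A y"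
      using cstar_identity[OF y] nrm_mult[OF star_closed[OF y] y] by simp
    then show ?thesis using pos by (simp add: power2_eq_square)
  qed
  show ?thesis using le[OF assms] le[OF star_closed[OF assms]] star_star[OF assms] by simp
qed

lemma star_minus: assumes "x \<in> carrier A" "y \<in> carrier A" shows "star A (x \<ominus> y) = star A x \<ominus> star A y"
  using assms by (simp add: minus_eq_scale star_add star_scale scale_closed star_closed)

lemma mult_minus_right: assumes "x \<in> carrier A" "y \<in> carrier A" "z \<in> carrier A"
  shows "z \<otimes> (x \<ominus> y) = z \<otimes> x \<ominus> z \<otimes> y"
  using assms by (simp add: minus_eq_scale distr_left scale_mult_right scale_closed mult_closed)

lemma mult_minus_left: assumes "x \<in> carrier A" "y \<in> carrier A" "z \<in> carrier A"
  shows "(x \<ominus> y) \<otimes> z = x \<otimes> z \<ominus> y \<otimes> z"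
  using assms by (simp add: minus_eq_scale distr_right scale_mult_left scale_closed mult_closed)

text \<open>The single equation \<open>star A x \<otimes> x = x\<close> already makes
  \<open>x\<close> self-adjoint and idempotent.\<close>

lemma nrm_projection_le: assumes "x \<in> carrier A" "star A x \<otimes> x = x" shows "nrm A x \<le> 1"
proof -
  have "(nrm A x)\<^sup>2 = nrm A x" using cstar_identity[OF assms(1)] assms(2) by simp
  then show ?thesis by (auto simp: power2_eq_square)
qed

text \<open>Bounds a partial isometry through its source projection \<open>y\<close>.\<close>

lemma nrm_le_one: assumes "x \<in> carrier A" "star A x \<otimes> x = y" "star A y \<otimes> y = y" shows "nrm A x \<le> 1"
proof -
  have y: "y \<in> carrier A" using assms mult_closed star_closed by blast
  have "(nrm A x)\<^sup>2 \<le> 1" using cstar_identity[OF assms(1)] assms(2) nrm_projection_le[OF y assms(3)] by simp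
  then show ?thesis using power2_le_imp_le[of "nrm A x" 1] by simp
qed

section \<open>Finite sums under additive maps\<close>

text \<open>The target is an arbitrary abelian group \<open>B\<close>: the lemma serves
  multiplications and the involution of \<open>A\<close> as well as the passage to a transported
  copy.\<close>

lemma finsum_additive:
  assumes "finite I" "f ` I \<subseteq> carrier A" and "abelian_group B"
    and "\<And>x y. x \<in> carrier A \<Longrightarrow> y \<in> carrier A \<Longrightarrow> h (x \<oplus> y) = h x \<oplus>\<^bsub>B\<^esub> h y"
    and closed: "\<And>x. x \<in> carrier A \<Longrightarrow> h x \<in> carrier B"
  shows "h (finsum A f I) = finsum B (\<lambda>i. h (f i)) I"
proof -
  interpret B: abelian_group B by fact
  have "h \<zero> \<oplus>\<^bsub>B\<^esub> h \<zero> = h \<zero>" using assms(4)[of \<zero> \<zero>] by simp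
  then have z: "h \<zero> = \<zero>\<^bsub>B\<^esub>" using closed[of \<zero>] by (simp add: B.add.l_cancel_one')
  show ?thesis using assms(1,2)
  proof (induction I rule: finite_induct)
    case (insert i I)
    then have "f \<in> I \<rightarrow> carrier A" "f i \<in> carrier A" by auto
    then show ?case using insert assms(4)[of "f i" "finsum A f I"] closed
      by (simp add: finsum_insert B.finsum_insert Pi_def)
  qed (use z in simp)
qed

lemma finsum_mult_left: assumes "finite I" "f ` I \<subseteq> carrier A" "x \<in> carrier A"
  shows "x \<otimes> finsum A f I = finsum A (\<lambda>i. x \<otimes> f i) I"
  using assms by (intro finsum_additive) (auto simp: distr_left mult_closed abelian_group_axioms)

lemma finsum_mult_right: assumes "finite I" "f ` I \<subseteq> carrier A" "x \<in> carrier A"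
  shows "finsum A f I \<otimes> x = finsum A (\<lambda>i. f i \<otimes> x) I"
  using assms by (intro finsum_additive[where h="\<lambda>y. y \<otimes> x"]) (auto simp: distr_right mult_closed abelian_group_axioms)

lemma finsum_star: assumes "finite I" "f ` I \<subseteq> carrier A"
  shows "star A (finsum A f I) = finsum A (\<lambda>i. star A (f i)) I"
  using assms by (intro finsum_additive) (auto simp: star_add star_closed abelian_group_axioms)

lemma finsum_delta: assumes "finite I" "i \<in> I" "f i \<in> carrier A"
  "\<And>j. j \<in> I \<Longrightarrow> j \<noteq> i \<Longrightarrow> f j = \<zero>"
  shows "finsum A f I = f i"
proof -
  have "finsum A f (insert i (I - {i})) = f i \<oplus> finsum A f (I - {i})"
    using assms by (intro finsum_insert) (auto simp: Pi_def)
  also have "finsum A f (I - {i}) = finsum A (\<lambda>_. \<zero>) (I - {i})"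
    using assms by (intro finsum_cong') auto
  finally show ?thesis using assms by (simp add: insert_absorb)
qed

section \<open>Linear spans and coordinates\<close>

lemma lspan_closed: assumes "B \<subseteq> carrier A" "x \<in> lspan A B" shows "x \<in> carrier A"
  using assms(2) by induction (use assms(1) scale_closed in auto)

lemma lspan_mono: assumes "x \<in> lspan A B" "B \<subseteq> C" shows "x \<in> lspan A C"
  using assms(1) by induction (use assms(2) in \<open>auto intro: lspan.intros\<close>)

lemma lspan_base: assumes "B \<subseteq> carrier A" "b \<in> B" shows "b \<in> lspan A B"
proof -
  have "1 \<odot> b \<oplus> \<zero> \<in> lspan A B" using assms(2) by (intro lspan.intros)
  then show ?thesis using assms scale_one by auto
qed

lemma lspan_add: assumes "B \<subseteq> carrier A" "x \<in> lspan A B" "y \<in> lspan A B" shows "x \<oplus> y \<in> lspan A B"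
  using assms(2)
proof induction
  case zero then show ?case using assms lspan_closed by simp
next
  case (step b x a)
  have "a \<odot> b \<oplus> x \<oplus> y = a \<odot> b \<oplus> (x \<oplus> y)"
    using step assms lspan_closed scale_closed by (meson a_assoc subsetD)
  then show ?case using step lspan.step by metis
qed

lemma lspan_scale: assumes "B \<subseteq> carrier A" "x \<in> lspan A B" shows "a \<odot> x \<in> lspan A B"
  using assms(2)
proof induction
  case zero then show ?case by (simp add: lspan.zero)
next
  case (step b x a')
  have "b \<in> carrier A" "x \<in> carrier A" using step assms(1) lspan_closed by auto
  then have "a \<odot> (a' \<odot> b \<oplus> x) = (a * a') \<odot> b \<oplus> a \<odot> x"
    by (simp add: scale_closed scale_add_right scale_scale)
  then show ?case using step lspan.step by metis
qed

text \<open>The scalar map \<open>k\<close> is left free to cover conjugate-linear maps: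
  \<open>k = cnj\<close> yields \<open>lspan_star\<close>.\<close>

lemma lspan_linear_image:
  assumes "B \<subseteq> carrier A" "C \<subseteq> carrier A" "x \<in> lspan A B"
    and add: "\<And>x y. x \<in> carrier A \<Longrightarrow> y \<in> carrier A \<Longrightarrow> h (x \<oplus> y) = h x \<oplus> h y"
    and scale: "\<And>a x. x \<in> carrier A \<Longrightarrow> h (a \<odot> x) = k a \<odot> h x"
    and base: "\<And>b. b \<in> B \<Longrightarrow> h b \<in> lspan A C"
    and closed: "\<And>x. x \<in> carrier A \<Longrightarrow> h x \<in> carrier A"
  shows "h x \<in> lspan A C"
proof -
  have z: "h \<zero> = \<zero>"
    using add[of \<zero> \<zero>] closed[of \<zero>] add_self_eq[of "h \<zero>"] by (metis r_zero zero_closed)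
  show ?thesis using assms(3)
  proof induction
    case zero then show ?case using z by (simp add: lspan.zero)
  next
    case (step b x a)
    have "b \<in> carrier A" "x \<in> carrier A" using step assms(1) lspan_closed by auto
    then have "h (a \<odot> b \<oplus> x) = k a \<odot> h b \<oplus> h x"
      by (simp add: add scale scale_closed)
    then show ?case using step base lspan_scale[OF assms(2)] lspan_add[OF assms(2)] by simp
  qed
qed

lemma lspan_trans: assumes "B \<subseteq> carrier A" "C \<subseteq> carrier A" "x \<in> lspan A B" "\<And>b. b \<in> B \<Longrightarrow> b \<in> lspan A C"
  shows "x \<in> lspan A C"
  by (rule lspan_linear_image[OF assms(1-3), where h="\<lambda>x. x" and k="\<lambda>a. a"]) (use assms in auto)

lemma lspan_finsum: assumes "B \<subseteq> carrier A" "finite I" "\<And>i. i \<in> I \<Longrightarrow> f i \<in> lspan A B"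
  shows "finsum A f I \<in> lspan A B"
  using assms(2,3)
proof (induction I rule: finite_induct)
  case (insert i I)
  then have "f ` insert i I \<subseteq> carrier A" using lspan_closed[OF assms(1)] by auto
  then show ?case using insert lspan_add[OF assms(1)] by (subst finsum_insert) (auto simp: Pi_def)
qed (simp add: lspan.zero)

lemma lspan_mult: assumes "B \<subseteq> carrier A" "C \<subseteq> carrier A" "D \<subseteq> carrier A" "x \<in> lspan A B" "y \<in> lspan A C"
    and prod: "\<And>b c. b \<in> B \<Longrightarrow> c \<in> C \<Longrightarrow> b \<otimes> c \<in> lspan A D"
  shows "x \<otimes> y \<in> lspan A D"
proof (rule lspan_linear_image[OF assms(1,3,4), where h="\<lambda>x. x \<otimes> y" and k="\<lambda>a. a"])
  have y: "y \<in> carrier A" using assms lspan_closed by blast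
  fix b assume b: "b \<in> B"
  show "b \<otimes> y \<in> lspan A D"
    by (rule lspan_linear_image[OF assms(2,3,5), where h="\<lambda>y. b \<otimes> y" and k="\<lambda>a. a"])
      (use b assms(1) prod in \<open>auto simp: distr_left scale_mult_right mult_closed subsetD\<close>)
qed (use assms lspan_closed[OF assms(2,5)] in \<open>auto simp: distr_right scale_mult_left mult_closed\<close>)

lemma lspan_star: assumes "B \<subseteq> carrier A" "C \<subseteq> carrier A" "x \<in> lspan A B"
    and st: "\<And>b. b \<in> B \<Longrightarrow> star A b \<in> lspan A C"
  shows "star A x \<in> lspan A C"
  by (rule lspan_linear_image[OF assms(1-3), where h="star A" and k=cnj])
    (use st in \<open>auto simp: star_add star_scale star_closed\<close>)

text \<open>Coordinates are attached to the indices \<open>i\<close>, not to the elements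
  \<open>u i\<close>, and no independence is assumed; uniqueness comes later from dual
  functionals.\<close>

lemma lspan_coords:
  assumes "finite I" "u ` I \<subseteq> carrier A" "y \<in> lspan A (u ` I)"
  shows "\<exists>f. y = finsum A (\<lambda>i. f i \<odot> u i) I"
  using assms(3)
proof induction
  case zero
  have "finsum A (\<lambda>i. 0 \<odot> u i) I = finsum A (\<lambda>i. \<zero>) I"
    using assms(2) by (intro finsum_cong') auto
  then show ?case by (intro exI[of _ "\<lambda>_. 0"]) simp
next
  case (step b x a)
  then obtain f where f: "x = finsum A (\<lambda>i. f i \<odot> u i) I" by blast
  obtain j where j: "j \<in> I" "b = u j" using step by auto
  have c: "f i \<odot> u i \<in> carrier A" "u i \<in> carrier A" if "i \<in> I" for i f
    using that assms(2) scale_closed by auto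
  \<comment> \<open>The new generator is absorbed into the coordinate of an index \<open>j\<close>
    that names it.\<close>
  define g where "g = f(j := f j + a)"
  define r where "r = finsum A (\<lambda>i. f i \<odot> u i) (I - {j})"
  have I: "I = insert j (I - {j})" using j by auto
  have r: "r \<in> carrier A" unfolding r_def using c by (intro finsum_closed) auto
  have x: "x = f j \<odot> u j \<oplus> r"
    unfolding f r_def using assms(1) c j by (subst I, subst finsum_insert) auto
  have "finsum A (\<lambda>i. g i \<odot> u i) (I - {j}) = r"
    unfolding r_def using c by (intro finsum_cong') (auto simp: g_def)
  then have "finsum A (\<lambda>i. g i \<odot> u i) I = g j \<odot> u j \<oplus> r"
    using assms(1) c j by (subst I, subst finsum_insert) auto
  also have "\<dots> = a \<odot> b \<oplus> x"
    using r c(2)[OF j(1)] x j by (simp add: g_def scale_add_left a_ac scale_closed)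
  finally show ?case by metis
qed

lemma nrm_finsum: assumes "finite I" "f ` I \<subseteq> carrier A"
  shows "nrm A (finsum A f I) \<le> (\<Sum>i\<in>I. nrm A (f i))"
  using assms
proof (induction I rule: finite_induct)
  case (insert i I)
  then have "f i \<in> carrier A" "f \<in> I \<rightarrow> carrier A" by auto
  then show ?case using insert nrm_triangle[of "f i" "finsum A f I"] by (simp add: finsum_insert)
qed simp

lemma lin_fun_finsum: assumes "lin_fun A \<phi>" "finite I" "f ` I \<subseteq> carrier A"
  shows "\<phi> (finsum A f I) = (\<Sum>i\<in>I. \<phi> (f i))"
  using assms(2,3)
proof (induction I rule: finite_induct)
  case empty
  have "\<phi> (0 \<odot> \<zero>) = 0" using assms(1) zero_closed unfolding lin_fun_def by fastforce
  then show ?case by simp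
next
  case (insert i I)
  then have "f i \<in> carrier A" "f \<in> I \<rightarrow> carrier A" by auto
  then show ?case using insert assms(1) by (simp add: finsum_insert lin_fun_def)
qed

end

section \<open>Finite-dimensional representations are continuous\<close>

definition fd_eq :: "'a cstar \<Rightarrow> 'a \<Rightarrow> 'a \<Rightarrow> bool" where
  "fd_eq A x y \<longleftrightarrow> (\<forall>n \<pi>. fin_dim_rep A n \<pi> \<longrightarrow> \<pi> x = \<pi> y)"

text \<open>The admissible ways to compare \<open>y\<close> with an equivalent \<open>b\<close>: the
  last clause transfers the value from one to the other, the middle one bounds it by
  \<open>nrm A b\<close>.\<close>

definition fd_functional :: "'a cstar \<Rightarrow> real \<Rightarrow> ('a \<Rightarrow> complex) \<Rightarrow> bool" where
  "fd_functional A C \<phi> \<longleftrightarrow> lin_fun A \<phi> \<and> (\<forall>x\<in>carrier A. cmod (\<phi> x) \<le> C * nrm A x) \<and>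
     (\<forall>x\<in>carrier A. \<forall>y\<in>carrier A. fd_eq A x y \<longrightarrow> \<phi> x = \<phi> y)"

context cstar_algebra
begin

section \<open>Neumann series\<close>

lemma nrm_minus_triangle: assumes "x \<in> carrier A" "y \<in> carrier A" "z \<in> carrier A"
  shows "nrm A (x \<ominus> z) \<le> nrm A (x \<ominus> y) + nrm A (y \<ominus> z)"
proof -
  have "x \<ominus> z = (x \<ominus> y) \<oplus> (y \<ominus> z)"
    using assms by (simp add: minus_eq a_assoc r_neg1)
  then show ?thesis using nrm_triangle[of "x \<ominus> y" "y \<ominus> z"] assms by simp
qed

lemma add_minus_add_left: assumes "b \<in> carrier A" "x \<in> carrier A" "y \<in> carrier A"
  shows "(b \<oplus> x) \<ominus> (b \<oplus> y) = x \<ominus> y"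
proof -
  have "x \<oplus> (\<ominus> b \<oplus> \<ominus> y) = \<ominus> b \<oplus> (x \<oplus> \<ominus> y)" using assms by (simp add: a_lcomm)
  then show ?thesis using assms by (simp add: minus_eq minus_add a_assoc r_neg2)
qed

text \<open>The solution is \<open>b + b^2 + b^3 + ...\<close>. The equation
  \<open>c = b + c b\<close> replaces the inversion of \<open>1 - b\<close>, as \<open>A\<close> may
  lack a unit.\<close>

lemma geometric_fixpoint:
  assumes b: "b \<in> carrier A" and lt: "nrm A b < 1"
  shows "\<exists>c\<in>carrier A. c = b \<oplus> c \<otimes> b"
proof -
  \<comment> \<open>Horner form of the partial sums: \<open>S m\<close> has the \<open>m\<close>
    terms from \<open>b\<close> to \<open>b^m\<close>.\<close>
  define S where "S = rec_nat \<zero> (\<lambda>_ x. b \<oplus> x \<otimes> b)"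
  have S0: "S 0 = \<zero>" and S1: "S (Suc m) = b \<oplus> S m \<otimes> b" for m by (simp_all add: S_def)
  have Sc: "S m \<in> carrier A" for m by (induction m) (use b in \<open>auto simp: S0 S1 mult_closed\<close>)
  let ?r = "nrm A b"
  have r0: "?r \<ge> 0" using nrm_nonneg b by simp
  have diff: "S (Suc (Suc m)) \<ominus> S (Suc m) = (S (Suc m) \<ominus> S m) \<otimes> b" for m
  proof -
    have "S (Suc (Suc m)) \<ominus> S (Suc m) = (b \<oplus> S (Suc m) \<otimes> b) \<ominus> (b \<oplus> S m \<otimes> b)" by (simp only: S1)
    also have "\<dots> = S (Suc m) \<otimes> b \<ominus> S m \<otimes> b" using b Sc mult_closed by (intro add_minus_add_left) auto
    finally show ?thesis using mult_minus_left[OF Sc Sc b] by simp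
  qed
  have step: "nrm A (S (Suc m) \<ominus> S m) \<le> ?r ^ m" for m
  proof (induction m)
    case 0
    have "b \<ominus> \<zero> = b" using b by (simp add: minus_eq_scale)
    then show ?case using b lt by (simp add: S0 S1)
  next
    case (Suc m)
    have "nrm A (S (Suc (Suc m)) \<ominus> S (Suc m)) \<le> nrm A (S (Suc m) \<ominus> S m) * ?r"
      unfolding diff using Sc b by (intro nrm_mult) auto
    also have "\<dots> \<le> ?r ^ m * ?r" using Suc r0 by (intro mult_right_mono)
    finally show ?case by (simp add: mult.commute)
  qed
  \<comment> \<open>The right-hand side is the sum \<open>r^m + ... + r^(m+d-1)\<close> in closed
    form, which lets the induction on \<open>d\<close> close.\<close>
  have tail: "nrm A (S (m + d) \<ominus> S m) \<le> (?r ^ m - ?r ^ (m + d)) / (1 - ?r)" for m d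
  proof (induction d)
    case 0 show ?case using Sc by (simp add: r_neg minus_eq)
  next
    case (Suc d)
    have "nrm A (S (m + Suc d) \<ominus> S m) \<le> ?r ^ (m + d) + (?r ^ m - ?r ^ (m + d)) / (1 - ?r)"
      using nrm_minus_triangle[of "S (Suc (m + d))" "S (m + d)" "S m"] Sc step[of "m + d"] Suc by simp
    also have "\<dots> = (?r ^ m - ?r ^ (m + Suc d)) / (1 - ?r)" using lt by (simp add: field_simps)
    finally show ?case .
  qed
  have tail': "nrm A (S m \<ominus> S k) \<le> ?r ^ N / (1 - ?r)" if "m \<ge> N" "k \<ge> N" "k \<le> m" for m k N
  proof -
    have "nrm A (S m \<ominus> S k) \<le> (?r ^ k - ?r ^ m) / (1 - ?r)" using tail[of k "m - k"] that by simp
    also have "\<dots> \<le> ?r ^ N / (1 - ?r)"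
      using lt r0 that power_decreasing[of N k ?r] by (intro divide_right_mono) (auto intro: order_trans[of _ "?r ^ k"])
    finally show ?thesis .
  qed
  have "\<exists>c\<in>carrier A. (\<lambda>n. nrm A (S n \<ominus> c)) \<longlonglongrightarrow> 0"
  proof (rule complete)
    show "range S \<subseteq> carrier A" using Sc by auto
    show "\<forall>\<epsilon>>0. \<exists>N::nat. \<forall>m\<ge>N. \<forall>n\<ge>N. nrm A (S m \<ominus> S n) < \<epsilon>"
    proof (intro allI impI)
      fix e :: real assume "e > 0"
      have "(\<lambda>N. ?r ^ N / (1 - ?r)) \<longlonglongrightarrow> 0 / (1 - ?r)"
        using lt r0 by (intro tendsto_intros LIMSEQ_power_zero) auto
      then have "\<forall>\<^sub>F N in sequentially. ?r ^ N / (1 - ?r) < e"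
        using \<open>e > 0\<close> by (intro order_tendstoD(2)) auto
      then obtain N where N: "?r ^ N / (1 - ?r) < e" by (auto simp: eventually_sequentially)
      have "nrm A (S m \<ominus> S n) < e" if "m \<ge> N" "n \<ge> N" for m n
        using tail'[of N m n] tail'[of N n m] that N nrm_minus_commute[OF Sc[of m] Sc[of n]]
        by (cases "n \<le> m") auto
      then show "\<exists>N::nat. \<forall>m\<ge>N. \<forall>n\<ge>N. nrm A (S m \<ominus> S n) < e" by blast
    qed
  qed
  then obtain c where c: "c \<in> carrier A" and lim: "(\<lambda>n. nrm A (S n \<ominus> c)) \<longlonglongrightarrow> 0" by blast
  let ?d = "b \<oplus> c \<otimes> b"
  have d: "?d \<in> carrier A" using b c mult_closed by simp
  \<comment> \<open>Both terms tend to \<open>0\<close> along the iteration, so the limit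
    \<open>c\<close> satisfies the recursion exactly.\<close>
  have bound: "nrm A (c \<ominus> ?d) \<le> nrm A (S (Suc n) \<ominus> c) + nrm A (S n \<ominus> c) * ?r" for n
  proof -
    have "S (Suc n) \<ominus> ?d = (S n \<ominus> c) \<otimes> b"
      unfolding S1 mult_minus_left[OF Sc c b] using b c Sc mult_closed by (intro add_minus_add_left) auto
    then have "nrm A (S (Suc n) \<ominus> ?d) \<le> nrm A (S n \<ominus> c) * ?r" using nrm_mult[of "S n \<ominus> c" b] b c Sc by simp
    then show ?thesis using nrm_minus_triangle[OF c Sc d, of "Suc n"] nrm_minus_commute[OF c Sc, of "Suc n"] by simp
  qed
  have "(\<lambda>n. nrm A (S (Suc n) \<ominus> c) + nrm A (S n \<ominus> c) * ?r) \<longlonglongrightarrow> 0 + 0 * ?r"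
    by (intro tendsto_intros lim LIMSEQ_Suc)
  then have "nrm A (c \<ominus> ?d) \<le> 0 + 0 * ?r" by (rule LIMSEQ_le_const) (use bound in auto)
  then have "c \<ominus> ?d = \<zero>" using nrm_eq_0[of "c \<ominus> ?d"] nrm_nonneg[of "c \<ominus> ?d"] c d by simp
  then have "?d \<oplus> (c \<ominus> ?d) = ?d" using d by simp
  then have "c = ?d" using add_minus_cancel(1)[OF d c(1)] by simp
  then show ?thesis using c by blast
qed

text \<open>No spectral theory in \<open>A\<close> is needed: if \<open>\<pi> b v = v\<close> and \<open>nrm A b < 1\<close>, apply
  \<open>\<pi>\<close> to \<open>c = b + c b\<close> and evaluate at \<open>v\<close>.\<close>

lemma eigenvalue_fin_dim_rep_le:
  assumes rep: "fin_dim_rep A n \<pi>" and x: "x \<in> carrier A" and ev: "eigenvalue (\<pi> x) k"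
  shows "cmod k \<le> nrm A x"
proof (rule ccontr)
  assume "\<not> cmod k \<le> nrm A x"
  then have gt: "cmod k > nrm A x" by simp
  then have k0: "k \<noteq> 0" using nrm_nonneg[OF x] by auto
  define b where "b = (1 / k) \<odot> x"
  have b: "b \<in> carrier A" unfolding b_def using x scale_closed by simp
  have "nrm A b < 1" unfolding b_def using nrm_scale[OF x] gt k0 by (simp add: norm_divide)
  from geometric_fixpoint[OF b this] obtain c where c: "c \<in> carrier A" "c = b \<oplus> c \<otimes> b" by blast
  have carr: "\<pi> x \<in> carrier_mat n n" "\<pi> b \<in> carrier_mat n n" "\<pi> c \<in> carrier_mat n n"
    using rep x b c unfolding fin_dim_rep_def by auto
  obtain v where v: "v \<in> carrier_vec n" "v \<noteq> 0\<^sub>v n" "\<pi> x *\<^sub>v v = k \<cdot>\<^sub>v v"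
    using ev carr unfolding eigenvalue_def eigenvector_def by auto
  have "\<pi> b = (1 / k) \<cdot>\<^sub>m \<pi> x"
    using rep x unfolding b_def fin_dim_rep_def by simp
  then have bv: "\<pi> b *\<^sub>v v = v"
  proof (intro eq_vecI)
    fix i assume "i < dim_vec v"
    then have i: "i < n" using v by simp
    have "(\<pi> b *\<^sub>v v) $ i = (1 / k) * (\<pi> x *\<^sub>v v) $ i"
      using \<open>\<pi> b = _\<close> carr v(1) i smult_scalar_prod_distrib[of "row (\<pi> x) i" n v "1 / k"] by simp
    also have "(\<pi> x *\<^sub>v v) $ i = k * v $ i" unfolding v(3) using v(1) i by simp
    finally show "(\<pi> b *\<^sub>v v) $ i = v $ i" using k0 by simp
  qed (use carr v in simp)
  have "\<pi> c = \<pi> b + \<pi> c * \<pi> b"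
  proof -
    have "\<pi> (b \<oplus> c \<otimes> b) = \<pi> b + \<pi> c * \<pi> b"
      using rep b c(1) mult_closed[OF c(1) b] unfolding fin_dim_rep_def by simp
    then show ?thesis using c(2) by simp
  qed
  then have "\<pi> c *\<^sub>v v = \<pi> b *\<^sub>v v + \<pi> c *\<^sub>v (\<pi> b *\<^sub>v v)"
    using carr v add_mult_distrib_mat_vec[of "\<pi> b" n n "\<pi> c * \<pi> b" v] assoc_mult_mat_vec[of "\<pi> c" n n "\<pi> b" n v] by simp
  then have eq: "\<pi> c *\<^sub>v v = v + \<pi> c *\<^sub>v v" by (simp add: bv)
  have "v = 0\<^sub>v n"
  proof (intro eq_vecI)
    fix i assume i: "i < dim_vec (0\<^sub>v n :: complex vec)"
    have "(\<pi> c *\<^sub>v v) $ i = (v + \<pi> c *\<^sub>v v) $ i" using eq by simp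
    then show "v $ i = 0\<^sub>v n $ i" using i v carr by (auto simp del: index_mult_mat_vec)
  qed (use v in auto)
  then show False using v by simp
qed

end

section \<open>Traces and the size of matrix entries\<close>

lemma trace_mult_commute: fixes M N :: "complex mat"
  assumes "M \<in> carrier_mat n n" "N \<in> carrier_mat n n"
  shows "(\<Sum>i<n. (M * N) $$ (i,i)) = (\<Sum>i<n. (N * M) $$ (i,i))"
proof -
  have "(\<Sum>i<n. (M * N) $$ (i,i)) = (\<Sum>i<n. \<Sum>j<n. M $$ (i,j) * N $$ (j,i))"
    using assms by (intro sum.cong) (auto simp: scalar_prod_def lessThan_atLeast0)
  also have "\<dots> = (\<Sum>i<n. \<Sum>j<n. N $$ (i,j) * M $$ (j,i))"
    by (subst sum.swap) (simp add: mult.commute)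
  also have "\<dots> = (\<Sum>i<n. (N * M) $$ (i,i))"
    using assms by (intro sum.cong) (auto simp: scalar_prod_def lessThan_atLeast0)
  finally show ?thesis .
qed

text \<open>The trace survives similarity to an upper triangular matrix, whose diagonal entries are
  eigenvalues of \<open>M\<close>.\<close>

lemma trace_bound_eigenvalues: fixes M :: "complex mat"
  assumes M: "M \<in> carrier_mat n n" and le: "\<And>k. eigenvalue M k \<Longrightarrow> cmod k \<le> r"
  shows "cmod (\<Sum>i<n. M $$ (i,i)) \<le> n * r"
proof -
  obtain es where "char_poly M = (\<Prod>a\<leftarrow>es. [:- a, 1:])" using char_poly_factorized[OF M] by blast
  from schur_decomposition_exists[OF M this] obtain B where
    B: "B \<in> carrier_mat n n" "upper_triangular B" "similar_mat M B" by blast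
  obtain P Q where w: "similar_mat_wit M B P Q" using B(3) unfolding similar_mat_def by blast
  note D = similar_mat_witD2[OF M w]
  have "(\<Sum>i<n. M $$ (i,i)) = (\<Sum>i<n. (P * (B * Q)) $$ (i,i))"
    using D by (simp add: assoc_mult_mat[of P n n B n Q n])
  also have "\<dots> = (\<Sum>i<n. ((B * Q) * P) $$ (i,i))"
    using D by (intro trace_mult_commute) auto
  also have "(B * Q) * P = B" using D by (simp add: assoc_mult_mat[of B n n Q n P n])
  finally have tr: "(\<Sum>i<n. M $$ (i,i)) = (\<Sum>i<n. B $$ (i,i))" .
  have "cmod (B $$ (i,i)) \<le> r" if i: "i < n" for i
  proof (rule le)
    have "char_poly M = (\<Prod>a\<leftarrow>diag_mat B. [:- a, 1:])"
      using char_poly_similar[OF B(3)] char_poly_upper_triangular[OF B(1,2)] by simp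
    moreover have "B $$ (i,i) \<in> set (diag_mat B)" using i B(1) by (auto simp: diag_mat_def)
    ultimately have "poly (char_poly M) (B $$ (i,i)) = 0"
      by (auto simp: poly_prod_list prod_list_zero_iff image_iff)
    then show "eigenvalue M (B $$ (i,i))" using eigenvalue_root_char_poly[OF M] by simp
  qed
  then have "(\<Sum>i<n. cmod (B $$ (i,i))) \<le> (\<Sum>i<n. r)" by (intro sum_mono) auto
  then show ?thesis unfolding tr using norm_sum[of "\<lambda>i. B $$ (i,i)" "{..<n}"] by simp
qed

lemma mat_adjoint_index [simp]: "i < dim_col M \<Longrightarrow> j < dim_row M \<Longrightarrow> mat_adjoint M $$ (i,j) = cnj (M $$ (j,i))"
  by (simp add: mat_adjoint_def mat_of_rows_def)

lemma mat_adjoint_dim [simp]: "dim_row (mat_adjoint M) = dim_col M" "dim_col (mat_adjoint M) = dim_row M"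
  by (simp_all add: mat_adjoint_def mat_of_rows_def)

text \<open>An entry is dominated by the Hilbert-Schmidt norm, whose square is the trace of the
  image of \<open>star A x \<otimes> x\<close>; bounding that trace by eigenvalues costs the factor
  \<open>n\<close>. The resulting \<open>sqrt n\<close> depends on the dimension only.\<close>

lemma (in cstar_algebra) fin_dim_rep_entry_bound:
  assumes rep: "fin_dim_rep A n \<pi>" and x: "x \<in> carrier A" and ij: "i < n" "j < n"
  shows "cmod (\<pi> x $$ (i,j)) \<le> sqrt n * nrm A x"
proof -
  let ?y = "star A x \<otimes> x"
  have y: "?y \<in> carrier A" using x mult_closed star_closed by simp
  have M: "\<pi> x \<in> carrier_mat n n" "\<pi> ?y \<in> carrier_mat n n" using rep x y unfolding fin_dim_rep_def by auto
  have eq: "\<pi> ?y = mat_adjoint (\<pi> x) * \<pi> x" using rep x star_closed unfolding fin_dim_rep_def by simp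
  have tr: "(\<Sum>k<n. \<pi> ?y $$ (k,k)) = of_real (\<Sum>k<n. \<Sum>l<n. (cmod (\<pi> x $$ (l,k)))\<^sup>2)"
    unfolding eq using M
    by (auto simp: scalar_prod_def lessThan_atLeast0 complex_norm_square[unfolded of_real_power] mult.commute intro!: sum.cong)
  have "(cmod (\<pi> x $$ (i,j)))\<^sup>2 \<le> (\<Sum>l<n. (cmod (\<pi> x $$ (l,j)))\<^sup>2)"
    using ij by (intro member_le_sum[of i "{..<n}" "\<lambda>l. (cmod (\<pi> x $$ (l,j)))\<^sup>2"]) auto
  also have "\<dots> \<le> (\<Sum>k<n. \<Sum>l<n. (cmod (\<pi> x $$ (l,k)))\<^sup>2)"
    using ij by (intro member_le_sum[of j "{..<n}" "\<lambda>k. \<Sum>l<n. (cmod (\<pi> x $$ (l,k)))\<^sup>2"]) (auto intro: sum_nonneg)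
  also have "\<dots> = cmod (\<Sum>k<n. \<pi> ?y $$ (k,k))"
    unfolding tr by (simp del: of_real_sum add: sum_nonneg)
  also have "\<dots> \<le> n * nrm A ?y"
    by (rule trace_bound_eigenvalues[OF M(2)]) (rule eigenvalue_fin_dim_rep_le[OF rep y])
  also have "\<dots> = (sqrt n * nrm A x)\<^sup>2" by (simp add: cstar_identity[OF x] power_mult_distrib)
  finally show ?thesis by (rule power2_le_imp_le) (use nrm_nonneg[OF x] in simp)
qed

section \<open>Norm estimates from powers\<close>

text \<open>The exponents are restricted to \<open>2 ^ Suc k\<close>, the powers of the norm that
  repeated squaring of \<open>star A y \<otimes> y\<close> produces.\<close>

lemma exp_beats_linear:
  fixes r c n :: real assumes "r > 1"
  shows "\<exists>k. c * (2 ^ Suc k * n + 1) < r ^ (2 ^ Suc k)"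
proof -
  have a: "(\<lambda>m. real m / r ^ m) \<longlonglongrightarrow> 0" using lim_n_over_pown[of r] assms by simp
  have b: "(\<lambda>m. (1 / r) ^ m) \<longlonglongrightarrow> 0" using assms by (intro LIMSEQ_power_zero) auto
  have "(\<lambda>m. c * n * (real m / r ^ m) + c * (1 / r) ^ m) \<longlonglongrightarrow> c * n * 0 + c * 0"
    by (intro tendsto_intros a b)
  then have "\<forall>\<^sub>F m in sequentially. c * n * (real m / r ^ m) + c * (1 / r) ^ m < 1"
    by (intro order_tendstoD(2)) auto
  then obtain M where M: "\<And>m. m \<ge> M \<Longrightarrow> c * n * (real m / r ^ m) + c * (1 / r) ^ m < 1"
    by (auto simp: eventually_sequentially)
  \<comment> \<open>The witness is \<open>k = M\<close>, because \<open>2 ^ Suc M\<close> is already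
    past the threshold \<open>M\<close>.\<close>
  have "M \<le> 2 ^ Suc M" by (metis less_exp less_imp_le order_trans power_increasing one_le_numeral le_SucI order_refl)
  from M[OF this] have "(c * n * real (2 ^ Suc M) + c) / r ^ (2 ^ Suc M) < 1"
    by (simp add: add_divide_distrib power_divide)
  then have "c * n * real (2 ^ Suc M) + c < r ^ (2 ^ Suc M)" using assms by (simp add: divide_less_eq)
  then show ?thesis by (intro exI[of _ M]) (simp add: algebra_simps)
qed

context cstar_algebra
begin

section \<open>Equivalence and repeated squaring\<close>

lemma fin_dim_repD:
  assumes "fin_dim_rep A n \<pi>" "x \<in> carrier A"
  shows "\<pi> x \<in> carrier_mat n n" "\<pi> (star A x) = mat_adjoint (\<pi> x)" "\<pi> (a \<odot> x) = a \<cdot>\<^sub>m \<pi> x"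
    "y \<in> carrier A \<Longrightarrow> \<pi> (x \<oplus> y) = \<pi> x + \<pi> y" "y \<in> carrier A \<Longrightarrow> \<pi> (x \<otimes> y) = \<pi> x * \<pi> y"
  using assms unfolding fin_dim_rep_def by auto

lemma fd_eq_star: "x \<in> carrier A \<Longrightarrow> y \<in> carrier A \<Longrightarrow> fd_eq A x y \<Longrightarrow> fd_eq A (star A x) (star A y)"
  unfolding fd_eq_def by (metis fin_dim_repD(2))

lemma fd_eq_mult:
  assumes "x \<in> carrier A" "y \<in> carrier A" "x' \<in> carrier A" "y' \<in> carrier A" "fd_eq A x y" "fd_eq A x' y'"
  shows "fd_eq A (x \<otimes> x') (y \<otimes> y')"
  using assms unfolding fd_eq_def by (metis fin_dim_repD(5))

lemma fd_eq_refl: "fd_eq A x x"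
  unfolding fd_eq_def by simp

text \<open>The \<open>2^k\<close>-th power of \<open>star A x \<otimes> x\<close>. Squaring keeps
  it self-adjoint, so the C*-identity computes each norm exactly.\<close>

primrec abs_sq_pow :: "'a \<Rightarrow> nat \<Rightarrow> 'a" where
  "abs_sq_pow x 0 = star A x \<otimes> x"
| "abs_sq_pow x (Suc k) = abs_sq_pow x k \<otimes> abs_sq_pow x k"

lemma abs_sq_pow_closed: "x \<in> carrier A \<Longrightarrow> abs_sq_pow x k \<in> carrier A"
  by (induction k) (auto simp: mult_closed star_closed)

lemma abs_sq_pow_star: "x \<in> carrier A \<Longrightarrow> star A (abs_sq_pow x k) = abs_sq_pow x k"
  by (induction k) (auto simp: star_mult star_closed star_star abs_sq_pow_closed)

lemma nrm_abs_sq_pow: assumes "x \<in> carrier A" shows "nrm A (abs_sq_pow x k) = nrm A x ^ (2 ^ Suc k)"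
proof (induction k)
  case 0 then show ?case using cstar_identity[OF assms] by simp
next
  case (Suc k)
  have "nrm A (abs_sq_pow x (Suc k)) = (nrm A (abs_sq_pow x k))\<^sup>2"
    using cstar_identity[OF abs_sq_pow_closed[OF assms], of k] abs_sq_pow_star[OF assms] by simp
  then show ?case using Suc by (simp add: power_mult[symmetric] mult.commute)
qed

lemma fd_eq_abs_sq_pow: assumes "x \<in> carrier A" "y \<in> carrier A" "fd_eq A x y"
  shows "fd_eq A (abs_sq_pow x k) (abs_sq_pow y k)"
proof (induction k)
  case 0 then show ?case using assms star_closed by (simp add: fd_eq_mult fd_eq_star)
next
  case (Suc k) then show ?case
    using abs_sq_pow_closed[OF assms(1), of k] abs_sq_pow_closed[OF assms(2), of k]
    by (simp add: fd_eq_mult)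
qed

text \<open>A lower bound for the norm that loses only a factor polynomial in the degree is lossless:
  apply it to high powers of \<open>star A y \<otimes> y\<close> and take roots.\<close>

lemma nrm_le_of_filtration:
  assumes V: "\<And>n. V n \<subseteq> carrier A"
    and st: "\<And>n x. x \<in> V n \<Longrightarrow> star A x \<in> V n"
    and mu: "\<And>m n x y. x \<in> V m \<Longrightarrow> y \<in> V n \<Longrightarrow> x \<otimes> y \<in> V (m + n)"
    and est: "\<And>n y b. y \<in> V n \<Longrightarrow> b \<in> carrier A \<Longrightarrow> fd_eq A y b \<Longrightarrow> nrm A y \<le> C * (real n + 1) * nrm A b"
    and y: "y \<in> V n" and b: "b \<in> carrier A" and eq: "fd_eq A y b"
  shows "nrm A y \<le> nrm A b"
proof (rule ccontr)
  assume "\<not> nrm A y \<le> nrm A b"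
  then have gt: "nrm A b < nrm A y" by simp
  have yc: "y \<in> carrier A" using V y by auto
  have mem: "abs_sq_pow y k \<in> V (2 ^ Suc k * n)" for k
  proof (induction k)
    case 0 then show ?case using mu[OF st[OF y] y] by (simp add: mult_2)
  next
    case (Suc k) show ?case using mu[OF Suc Suc] by (simp add: mult_2 distrib_right)
  qed
  have ineq: "nrm A y ^ (2 ^ Suc k) \<le> C * (2 ^ Suc k * n + 1) * nrm A b ^ (2 ^ Suc k)" for k
    using est[OF mem abs_sq_pow_closed[OF b] fd_eq_abs_sq_pow[OF yc b eq], of k]
    by (simp add: nrm_abs_sq_pow[OF b] nrm_abs_sq_pow[OF yc] add.commute)
  \<comment> \<open>The case \<open>k = 0\<close> excludes a zero right-hand side, so the quotient
    \<open>nrm A y / nrm A b\<close> can serve as the base of the exponential.\<close>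
  have "nrm A b \<noteq> 0"
  proof
    assume "nrm A b = 0"
    then have "nrm A y ^ 2 ^ Suc 0 \<le> 0" using ineq[of 0] by simp
    then show False using gt nrm_nonneg[OF b] by simp
  qed
  then have b0: "nrm A b > 0" using nrm_nonneg[OF b] by simp
  obtain k where k: "C * (2 ^ Suc k * real n + 1) < (nrm A y / nrm A b) ^ (2 ^ Suc k)"
    using exp_beats_linear[of "nrm A y / nrm A b" C n] b0 gt by auto
  have "C * (2 ^ Suc k * real n + 1) * nrm A b ^ (2 ^ Suc k) < nrm A y ^ (2 ^ Suc k)"
    using k b0 by (simp only: power_divide less_divide_eq) simp
  then show False using ineq[of k] by (simp add: add.commute)
qed

section \<open>Functionals constant on equivalence classes\<close>

text \<open>Compression by two contractions isolates one corner and keeps the bound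
  \<open>C\<close>; equivalence survives because it is a congruence for products.\<close>

lemma fd_functional_compress:
  assumes "fd_functional A C \<phi>" "a \<in> carrier A" "b \<in> carrier A" "nrm A a \<le> 1" "nrm A b \<le> 1" "C \<ge> 0"
  shows "fd_functional A C (\<lambda>x. \<phi> (a \<otimes> x \<otimes> b))"
proof -
  have 1: "lin_fun A (\<lambda>x. \<phi> (a \<otimes> x \<otimes> b))"
    using assms(1-3) unfolding fd_functional_def lin_fun_def
    by (simp add: distr_left distr_right mult_closed scale_mult_left scale_mult_right scale_closed)
  have 2: "cmod (\<phi> (a \<otimes> x \<otimes> b)) \<le> C * nrm A x" if x: "x \<in> carrier A" for x
  proof -
    have "nrm A (a \<otimes> x \<otimes> b) \<le> nrm A (a \<otimes> x) * nrm A b" using x assms by (intro nrm_mult mult_closed) auto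
    also have "\<dots> \<le> nrm A (a \<otimes> x) * 1" using x assms mult_closed nrm_nonneg by (intro mult_left_mono) auto
    also have "\<dots> \<le> nrm A a * nrm A x" using x assms nrm_mult by simp
    also have "\<dots> \<le> 1 * nrm A x" using x assms nrm_nonneg by (intro mult_right_mono) auto
    finally have "C * nrm A (a \<otimes> x \<otimes> b) \<le> C * nrm A x" using assms by (intro mult_left_mono) auto
    moreover have "cmod (\<phi> (a \<otimes> x \<otimes> b)) \<le> C * nrm A (a \<otimes> x \<otimes> b)"
      using assms(1) x assms(2,3) mult_closed unfolding fd_functional_def by simp
    ultimately show ?thesis by simp
  qed
  have 3: "\<phi> (a \<otimes> x \<otimes> b) = \<phi> (a \<otimes> y \<otimes> b)" if xy: "x \<in> carrier A" "y \<in> carrier A" "fd_eq A x y" for x y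
  proof -
    have "fd_eq A (a \<otimes> x \<otimes> b) (a \<otimes> y \<otimes> b)"
      using xy assms(2,3) mult_closed by (intro fd_eq_mult fd_eq_refl) auto
    then show ?thesis using assms(1-3) xy mult_closed unfolding fd_functional_def by simp
  qed
  show ?thesis unfolding fd_functional_def using 1 2 3 by blast
qed

text \<open>With powers of roots of unity as weights this becomes a discrete Fourier coefficient;
  averaging instead of summing keeps the bound \<open>C\<close>.\<close>

lemma fd_functional_average:
  assumes "finite Z" "Z \<noteq> {}" "\<And>z. z \<in> Z \<Longrightarrow> fd_functional A C (\<phi> z)" "\<And>z. z \<in> Z \<Longrightarrow> cmod (w z) \<le> 1"
  shows "fd_functional A C (\<lambda>x. (\<Sum>z\<in>Z. w z * \<phi> z x) / card Z)"
proof -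
  have 1: "lin_fun A (\<lambda>x. (\<Sum>z\<in>Z. w z * \<phi> z x) / card Z)"
    using assms(3) unfolding fd_functional_def lin_fun_def
    by (simp add: algebra_simps sum.distrib sum_distrib_left add_divide_distrib)
  have card: "real (card Z) > 0" using assms(1,2) by (simp add: card_gt_0_iff)
  have 2: "cmod ((\<Sum>z\<in>Z. w z * \<phi> z x) / card Z) \<le> C * nrm A x" if x: "x \<in> carrier A" for x
  proof -
    have "cmod (w z * \<phi> z x) \<le> 1 * (C * nrm A x)" if "z \<in> Z" for z
      unfolding norm_mult using that assms(3)[OF that] assms(4)[OF that] x
      by (intro mult_mono) (auto simp: fd_functional_def)
    then have "(\<Sum>z\<in>Z. cmod (w z * \<phi> z x)) \<le> (\<Sum>z\<in>Z. C * nrm A x)" by (intro sum_mono) simp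
    then have "cmod (\<Sum>z\<in>Z. w z * \<phi> z x) \<le> card Z * (C * nrm A x)"
      using norm_sum[of "\<lambda>z. w z * \<phi> z x" Z] by simp
    then show ?thesis using card by (simp add: norm_divide divide_le_eq mult.commute)
  qed
  have 3: "(\<Sum>z\<in>Z. w z * \<phi> z x) / card Z = (\<Sum>z\<in>Z. w z * \<phi> z y) / card Z"
    if "x \<in> carrier A" "y \<in> carrier A" "fd_eq A x y" for x y
  proof -
    have "(\<Sum>z\<in>Z. w z * \<phi> z x) = (\<Sum>z\<in>Z. w z * \<phi> z y)"
      by (intro sum.cong refl) (use assms(3) that in \<open>auto simp: fd_functional_def\<close>)
    then show ?thesis by simp
  qed
  show ?thesis unfolding fd_functional_def using 1 2 3 by blast
qed

lemma fd_functional_entry: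
  assumes rep: "fin_dim_rep A n \<pi>" and "i < n" "j < n"
  shows "fd_functional A (sqrt n) (\<lambda>x. \<pi> x $$ (i,j))"
proof -
  note D = fin_dim_repD[OF rep]
  have "dim_row (\<pi> x) = n" "dim_col (\<pi> x) = n" if "x \<in> carrier A" for x using D(1)[OF that] by auto
  then have "lin_fun A (\<lambda>x. \<pi> x $$ (i,j))"
    unfolding lin_fun_def using assms(2,3) by (simp add: D)
  moreover have "fd_eq A x y \<Longrightarrow> \<pi> x $$ (i,j) = \<pi> y $$ (i,j)" for x y
    using rep unfolding fd_eq_def by metis
  ultimately show ?thesis
    using fin_dim_rep_entry_bound[OF rep _ assms(2,3)] unfolding fd_functional_def by blast
qed

lemma fd_functional_mono: "fd_functional A C \<phi> \<Longrightarrow> C \<le> D \<Longrightarrow> fd_functional A D \<phi>"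
  unfolding fd_functional_def by (meson nrm_nonneg mult_right_mono order_trans)

text \<open>The coefficient \<open>f i = \<phi> i y\<close> equals \<open>\<phi> i b\<close> by
  equivalence, so it is bounded through \<open>b\<close> although \<open>b\<close> need not lie in
  the span.\<close>

lemma nrm_le_of_coordinates:
  fixes C :: real
  assumes I: "finite I" and u: "\<And>i. i \<in> I \<Longrightarrow> u i \<in> carrier A" "\<And>i. i \<in> I \<Longrightarrow> nrm A (u i) \<le> 1"
    and \<phi>: "\<And>i. i \<in> I \<Longrightarrow> fd_functional A C (\<phi> i)"
    and dual: "\<And>i j. i \<in> I \<Longrightarrow> j \<in> I \<Longrightarrow> \<phi> i (u j) = (if i = j then 1 else 0)"
    and y: "y \<in> lspan A (u ` I)" and b: "b \<in> carrier A" and eq: "fd_eq A y b"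
  shows "nrm A y \<le> real (card I) * C * nrm A b"
proof -
  have uI: "u ` I \<subseteq> carrier A" using u by auto
  have yc: "y \<in> carrier A" using lspan_closed[OF uI y] .
  obtain f where f: "y = finsum A (\<lambda>i. f i \<odot> u i) I" using lspan_coords[OF I uI y] by blast
  have img: "(\<lambda>i. f i \<odot> u i) ` I \<subseteq> carrier A" using u scale_closed by auto
  have fi: "cmod (f i) \<le> C * nrm A b" if i: "i \<in> I" for i
  proof -
    have l: "lin_fun A (\<phi> i)" using \<phi>[OF i] unfolding fd_functional_def by simp
    have "\<phi> i y = (\<Sum>j\<in>I. \<phi> i (f j \<odot> u j))" unfolding f by (rule lin_fun_finsum[OF l I img])
    also have "\<dots> = (\<Sum>j\<in>I. if i = j then f j else 0)"
      using l u dual[OF i] by (intro sum.cong) (auto simp: lin_fun_def)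
    also have "\<dots> = f i" using I i by simp
    finally have "f i = \<phi> i b" using \<phi>[OF i] yc b eq unfolding fd_functional_def by metis
    then show ?thesis using \<phi>[OF i] b unfolding fd_functional_def by simp
  qed
  have "nrm A y \<le> (\<Sum>i\<in>I. nrm A (f i \<odot> u i))" unfolding f by (rule nrm_finsum[OF I img])
  also have "\<dots> \<le> (\<Sum>i\<in>I. C * nrm A b)"
  proof (rule sum_mono)
    fix i assume i: "i \<in> I"
    have "nrm A (f i \<odot> u i) \<le> cmod (f i) * 1"
      unfolding nrm_scale[OF u(1)[OF i]] using u(2)[OF i] by (intro mult_left_mono) auto
    then show "nrm A (f i \<odot> u i) \<le> C * nrm A b" using fi[OF i] by simp
  qed
  finally show ?thesis by simp
qed

section \<open>Density of the generated star-algebra\<close>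

lemma star_alg_closed: assumes "T \<subseteq> carrier A" "x \<in> star_alg A T" shows "x \<in> carrier A"
  using assms(2) by induction (use assms(1) in \<open>auto simp: mult_closed star_closed scale_closed\<close>)

lemma star_alg_mono: assumes "x \<in> star_alg A T" "T \<subseteq> T'" shows "x \<in> star_alg A T'"
  using assms(1) by induction (use assms(2) in \<open>auto intro: star_alg.intros\<close>)

lemma star_alg_finite_support: assumes "x \<in> star_alg A T"
  shows "\<exists>T'. finite T' \<and> T' \<subseteq> T \<and> x \<in> star_alg A T'"
  using assms
proof induction
  case zero show ?case by (intro exI[of _ "{}"]) (auto intro: star_alg.intros)
next
  case (gen x) then show ?case by (intro exI[of _ "{x}"]) (auto intro: star_alg.intros)
next
  case (add x y)
  then obtain T1 T2 where "finite T1" "T1 \<subseteq> T" "x \<in> star_alg A T1" "finite T2" "T2 \<subseteq> T" "y \<in> star_alg A T2" by blast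
  then show ?case by (intro exI[of _ "T1 \<union> T2"]) (auto intro!: star_alg.add intro: star_alg_mono)
next
  case (mult x y)
  then obtain T1 T2 where "finite T1" "T1 \<subseteq> T" "x \<in> star_alg A T1" "finite T2" "T2 \<subseteq> T" "y \<in> star_alg A T2" by blast
  then show ?case by (intro exI[of _ "T1 \<union> T2"]) (auto intro!: star_alg.mult intro: star_alg_mono)
qed (blast intro: star_alg.intros)+

lemma nrm_add_minus_add: assumes "x \<in> carrier A" "y \<in> carrier A" "x' \<in> carrier A" "y' \<in> carrier A"
  shows "nrm A ((x \<oplus> y) \<ominus> (x' \<oplus> y')) \<le> nrm A (x \<ominus> x') + nrm A (y \<ominus> y')"
proof -
  have "(x \<oplus> y) \<ominus> (x' \<oplus> y') = (x \<ominus> x') \<oplus> (y \<ominus> y')" using assms by (simp add: minus_eq minus_add a_ac)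
  then show ?thesis using nrm_triangle assms by simp
qed

lemma nrm_mult_minus_mult: assumes "x \<in> carrier A" "y \<in> carrier A" "x' \<in> carrier A" "y' \<in> carrier A"
  shows "nrm A ((x \<otimes> y) \<ominus> (x' \<otimes> y')) \<le> nrm A (x \<ominus> x') * nrm A y + nrm A x' * nrm A (y \<ominus> y')"
proof -
  have "nrm A ((x \<otimes> y) \<ominus> (x' \<otimes> y')) \<le> nrm A ((x \<otimes> y) \<ominus> (x' \<otimes> y)) + nrm A ((x' \<otimes> y) \<ominus> (x' \<otimes> y'))"
    using assms by (intro nrm_minus_triangle mult_closed)
  also have "(x \<otimes> y) \<ominus> (x' \<otimes> y) = (x \<ominus> x') \<otimes> y" using assms by (simp add: mult_minus_left)
  also have "(x' \<otimes> y) \<ominus> (x' \<otimes> y') = x' \<otimes> (y \<ominus> y')" using assms by (simp add: mult_minus_right)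
  finally show ?thesis
    using nrm_mult[of "x \<ominus> x'" y] nrm_mult[of x' "y \<ominus> y'"] assms by simp
qed

definition approx :: "'a set \<Rightarrow> 'a set" where
  "approx V = {x \<in> carrier A. \<forall>\<epsilon>>0. \<exists>y\<in>V. nrm A (x \<ominus> y) < \<epsilon>}"

lemma subset_approx: assumes "V \<subseteq> carrier A" shows "V \<subseteq> approx V"
proof
  fix x assume "x \<in> V"
  moreover from this have "nrm A (x \<ominus> x) = 0" using assms by (auto simp: minus_eq r_neg)
  ultimately show "x \<in> approx V" using assms unfolding approx_def by (auto intro!: bexI[of _ x])
qed

text \<open>The operations are norm continuous, so the closure of a star-subalgebra is again one;
  minimality in \<open>generates\<close> will then force this closure to be everything.\<close>

lemma closed_star_subalgebra_approx:
  assumes T: "T \<subseteq> carrier A"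
  shows "closed_star_subalgebra A (approx (star_alg A T))"
proof -
  let ?V = "star_alg A T"
  note Vc = star_alg_closed[OF T]
  have zero: "\<zero> \<in> approx ?V" using star_alg.zero[of A T] subset_approx[of ?V] Vc by blast
  have add: "x \<oplus> y \<in> approx ?V" if xy: "x \<in> approx ?V" "y \<in> approx ?V" for x y
  proof -
    have "\<exists>z\<in>?V. nrm A ((x \<oplus> y) \<ominus> z) < \<epsilon>" if e: "\<epsilon> > 0" for \<epsilon>
    proof -
      obtain x' y' where x': "x' \<in> ?V" "nrm A (x \<ominus> x') < \<epsilon> / 2" and y': "y' \<in> ?V" "nrm A (y \<ominus> y') < \<epsilon> / 2"
      proof -
        have "\<epsilon> / 2 > 0" using e by simp
        then show ?thesis using xy that unfolding approx_def by blast
      qed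
      have "nrm A ((x \<oplus> y) \<ominus> (x' \<oplus> y')) < \<epsilon>"
        using nrm_add_minus_add[of x y x' y'] x' y' xy Vc unfolding approx_def by simp
      then show ?thesis using star_alg.add[OF x'(1) y'(1)] by blast
    qed
    then show ?thesis using xy unfolding approx_def by simp
  qed
  have mult: "x \<otimes> y \<in> approx ?V" if xy: "x \<in> approx ?V" "y \<in> approx ?V" for x y
  proof -
    have c: "x \<in> carrier A" "y \<in> carrier A" using xy unfolding approx_def by auto
    have "\<exists>z\<in>?V. nrm A ((x \<otimes> y) \<ominus> z) < \<epsilon>" if e: "\<epsilon> > 0" for \<epsilon>
    proof -
      \<comment> \<open>The bound \<open>1\<close> gives \<open>nrm A x' \<le> nrm A x + 1\<close>;
        the other bound makes the error of the product at most
        \<open>\<epsilon> / 2\<close>.\<close>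
      define d where "d = min 1 (\<epsilon> / (2 * (nrm A x + nrm A y + 1)))"
      have pos: "nrm A x \<ge> 0" "nrm A y \<ge> 0" using c nrm_nonneg by auto
      then have d: "d > 0" unfolding d_def using e by simp
      obtain x' where x': "x' \<in> ?V" "nrm A (x \<ominus> x') < d" using xy(1) d unfolding approx_def by blast
      obtain y' where y': "y' \<in> ?V" "nrm A (y \<ominus> y') < d" using xy(2) d unfolding approx_def by blast
      have c': "x' \<in> carrier A" "y' \<in> carrier A" using x' y' Vc by auto
      have "x' = x \<oplus> (x' \<ominus> x)" using c c' add_minus_cancel by simp
      then have nx: "nrm A x' \<le> nrm A x + 1"
        using nrm_triangle[of x "x' \<ominus> x"] c c' x'(2) nrm_minus_commute[of x x'] unfolding d_def by simp
      have "nrm A ((x \<otimes> y) \<ominus> (x' \<otimes> y')) \<le> nrm A (x \<ominus> x') * nrm A y + nrm A x' * nrm A (y \<ominus> y')"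
        by (rule nrm_mult_minus_mult) (use c c' in auto)
      also have "\<dots> \<le> d * nrm A y + (nrm A x + 1) * d"
        using x' y' nx pos d nrm_nonneg c c' by (intro add_mono mult_mono) auto
      also have "\<dots> = d * (nrm A x + nrm A y + 1)" by (simp add: algebra_simps)
      also have "\<dots> \<le> \<epsilon> / (2 * (nrm A x + nrm A y + 1)) * (nrm A x + nrm A y + 1)"
        unfolding d_def using pos by (intro mult_right_mono) auto
      also have "\<dots> = \<epsilon> / 2" using pos by (simp add: field_simps)
      also have "\<dots> < \<epsilon>" using e by simp
      finally show ?thesis using star_alg.mult[OF x'(1) y'(1)] by blast
    qed
    then show ?thesis using c mult_closed unfolding approx_def by simp
  qed
  have star: "star A x \<in> approx ?V" if x: "x \<in> approx ?V" for x
  proof -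
    have c: "x \<in> carrier A" using x unfolding approx_def by auto
    have "\<exists>z\<in>?V. nrm A (star A x \<ominus> z) < \<epsilon>" if "\<epsilon> > 0" for \<epsilon>
    proof -
      obtain x' where x': "x' \<in> ?V" "nrm A (x \<ominus> x') < \<epsilon>" using x \<open>\<epsilon> > 0\<close> unfolding approx_def by blast
      then have "nrm A (star A x \<ominus> star A x') < \<epsilon>"
        using c Vc[OF x'(1)] star_minus[of x x'] nrm_star[of "x \<ominus> x'"] by simp
      then show ?thesis using star_alg.star[OF x'(1)] by blast
    qed
    then show ?thesis using c star_closed unfolding approx_def by simp
  qed
  have scale: "a \<odot> x \<in> approx ?V" if x: "x \<in> approx ?V" for x a
  proof -
    have c: "x \<in> carrier A" using x unfolding approx_def by auto
    have "\<exists>z\<in>?V. nrm A (a \<odot> x \<ominus> z) < \<epsilon>" if "\<epsilon> > 0" for \<epsilon>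
    proof -
      \<comment> \<open>Adding \<open>1\<close> avoids a division by zero at
        \<open>a = 0\<close>.\<close>
      have "\<epsilon> / (cmod a + 1) > 0" using \<open>\<epsilon> > 0\<close> by (simp add: add_nonneg_pos)
      then obtain x' where x': "x' \<in> ?V" "nrm A (x \<ominus> x') < \<epsilon> / (cmod a + 1)" using x unfolding approx_def by blast
      have c': "x' \<in> carrier A" using Vc x' by auto
      have "a \<odot> x \<ominus> a \<odot> x' = a \<odot> (x \<ominus> x')"
        using c c' by (simp add: minus_eq_scale scale_add_right scale_closed scale_scale[symmetric] mult.commute)
      then have "nrm A (a \<odot> x \<ominus> a \<odot> x') = cmod a * nrm A (x \<ominus> x')" using nrm_scale c c' by simp
      also have "\<dots> \<le> (cmod a + 1) * nrm A (x \<ominus> x')" using c c' nrm_nonneg by (intro mult_right_mono) auto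
      also have "\<dots> < \<epsilon>" using x'(2) by (simp add: less_divide_eq add_nonneg_pos mult.commute)
      finally show ?thesis using star_alg.scale[OF x'(1)] by blast
    qed
    then show ?thesis using c scale_closed unfolding approx_def by simp
  qed
  have lim: "x \<in> approx ?V" if X: "range X \<subseteq> approx ?V" and x: "x \<in> carrier A"
    and l: "(\<lambda>n::nat. nrm A (X n \<ominus> x)) \<longlonglongrightarrow> 0" for X x
  proof -
    have "\<exists>z\<in>?V. nrm A (x \<ominus> z) < \<epsilon>" if e: "\<epsilon> > 0" for \<epsilon>
    proof -
      have "\<forall>\<^sub>F n in sequentially. nrm A (X n \<ominus> x) < \<epsilon> / 2" using l e by (intro order_tendstoD(2)) auto
      then obtain n where n: "nrm A (X n \<ominus> x) < \<epsilon> / 2" by (auto simp: eventually_sequentially)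
      have Xn: "X n \<in> carrier A" using X unfolding approx_def by auto
      obtain z where z: "z \<in> ?V" "nrm A (X n \<ominus> z) < \<epsilon> / 2"
      proof -
        have "X n \<in> approx ?V" using X by auto
        moreover have "\<epsilon> / 2 > 0" using e by simp
        ultimately show ?thesis using that unfolding approx_def by blast
      qed
      have "nrm A (x \<ominus> z) < \<epsilon>"
        using nrm_minus_triangle[OF x Xn Vc[OF z(1)]] n z nrm_minus_commute[OF x Xn] by simp
      then show ?thesis using z by blast
    qed
    then show ?thesis using x unfolding approx_def by simp
  qed
  have sub: "approx ?V \<subseteq> carrier A" unfolding approx_def by blast
  show ?thesis unfolding closed_star_subalgebra_def
    by (intro conjI ballI allI impI; (elim conjE)?) (rule sub zero add mult star scale lim; assumption)+
qed

lemma star_alg_dense: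
  assumes "generates A T" "x \<in> carrier A" "\<epsilon> > 0"
  shows "\<exists>y\<in>star_alg A T. nrm A (x \<ominus> y) < \<epsilon>"
proof -
  have T: "T \<subseteq> carrier A" using assms(1) unfolding generates_def by simp
  have "T \<subseteq> approx (star_alg A T)"
    using subset_approx[of "star_alg A T"] star_alg_closed[OF T] star_alg.gen[of _ T A] by blast
  then have "approx (star_alg A T) = carrier A"
    using assms(1) closed_star_subalgebra_approx[OF T] unfolding generates_def by blast
  then show ?thesis using assms(2,3) unfolding approx_def by blast
qed

lemma rfd_of_local_estimate:
  assumes gen: "generates A T"
    and est: "\<And>y b. y \<in> star_alg A T \<Longrightarrow> b \<in> carrier A \<Longrightarrow> fd_eq A y b \<Longrightarrow> nrm A y \<le> nrm A b"
  shows "residually_finite_dimensional A"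
  unfolding residually_finite_dimensional_def
proof (intro ballI impI)
  fix x y assume x: "x \<in> carrier A" and y: "y \<in> carrier A" and ne: "x \<noteq> y"
  show "\<exists>n \<pi>. fin_dim_rep A n \<pi> \<and> \<pi> x \<noteq> \<pi> y"
  proof (rule ccontr)
    assume "\<nexists>n \<pi>. fin_dim_rep A n \<pi> \<and> \<pi> x \<noteq> \<pi> y"
    then have eq: "fd_eq A x y" unfolding fd_eq_def by blast
    define d where "d = x \<ominus> y"
    have d: "d \<in> carrier A" unfolding d_def using x y by simp
    have "d \<noteq> \<zero>" using ne add_minus_cancel(1)[OF y x] y unfolding d_def by auto
    then have pos: "nrm A d > 0" using nrm_nonneg[OF d] nrm_eq_0[OF d] by simp
    have T: "T \<subseteq> carrier A" using gen unfolding generates_def by simp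
    \<comment> \<open>Half the norm of \<open>d\<close> is what makes this contradictory:
      \<open>v\<close> is equivalent to \<open>v \<ominus> d\<close>, so both \<open>v\<close> and
      \<open>d \<ominus> v\<close> would have norm below \<open>nrm A d / 2\<close>.\<close>
    obtain v where v: "v \<in> star_alg A T" "nrm A (d \<ominus> v) < nrm A d / 2"
      using star_alg_dense[OF gen d] pos by (metis half_gt_zero)
    have vc: "v \<in> carrier A" using star_alg_closed[OF T v(1)] .
    have "fd_eq A v (v \<ominus> d)"
      unfolding fd_eq_def
    proof (intro allI impI)
      fix n \<pi> assume r: "fin_dim_rep A n \<pi>"
      have c: "\<pi> x \<in> carrier_mat n n" "\<pi> y \<in> carrier_mat n n" "\<pi> v \<in> carrier_mat n n"
        by (simp_all add: fin_dim_repD(1)[OF r] x y vc)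
      have h: "\<pi> (a \<ominus> b) = \<pi> a + (-1) \<cdot>\<^sub>m \<pi> b" if "a \<in> carrier A" "b \<in> carrier A" for a b
        using that scale_closed by (simp add: minus_eq_scale fin_dim_repD[OF r])
      have xy: "\<pi> x = \<pi> y" using eq r unfolding fd_eq_def by simp
      show "\<pi> v = \<pi> (v \<ominus> d)"
        unfolding h[OF vc d, unfolded d_def h[OF x y] xy, folded d_def] using c by (intro eq_matI) auto
    qed
    then have "nrm A v \<le> nrm A (v \<ominus> d)" using est v vc d by simp
    moreover have "nrm A d \<le> nrm A v + nrm A (d \<ominus> v)"
      using nrm_triangle[of v "d \<ominus> v"] add_minus_cancel(1)[OF vc d] vc d by simp
    ultimately show False using v(2) nrm_minus_commute[OF vc d] by simp
  qed
qed

end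

section \<open>Matrix algebras\<close>

text \<open>Matrices have to satisfy \<open>cstar_algebra\<close> before universality can be applied
  to them. Vectors are functions on all naturals of which only the first \<open>n\<close> values
  count.\<close>

definition l2 :: "nat \<Rightarrow> (nat \<Rightarrow> complex) \<Rightarrow> real" where
  "l2 n v = L2_set (\<lambda>i. cmod (v i)) {..<n}"

definition mat_app :: "complex mat \<Rightarrow> (nat \<Rightarrow> complex) \<Rightarrow> nat \<Rightarrow> complex" where
  "mat_app M v i = (\<Sum>j<dim_col M. M $$ (i,j) * v j)"

definition opnorm :: "nat \<Rightarrow> complex mat \<Rightarrow> real" where
  "opnorm n M = Sup {l2 n (mat_app M v) | v. l2 n v \<le> 1}"

text \<open>An elementary upper bound for the operator norm: it makes the supremum finite and turns
  entrywise convergence into norm convergence.\<close>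

definition entry_sum :: "nat \<Rightarrow> complex mat \<Rightarrow> real" where
  "entry_sum n M = (\<Sum>i<n. \<Sum>j<n. cmod (M $$ (i,j)))"

lemma l2_nonneg [simp]: "0 \<le> l2 n v" by (simp add: l2_def)

lemma l2_cong: "(\<And>i. i < n \<Longrightarrow> v i = w i) \<Longrightarrow> l2 n v = l2 n w"
  unfolding l2_def by (rule L2_set_cong) auto

lemma l2_triangle: "l2 n (\<lambda>i. v i + w i) \<le> l2 n v + l2 n w"
proof -
  have "l2 n (\<lambda>i. v i + w i) \<le> L2_set (\<lambda>i. cmod (v i) + cmod (w i)) {..<n}"
    unfolding l2_def by (rule L2_set_mono) (auto intro: norm_triangle_ineq)
  also have "\<dots> \<le> l2 n v + l2 n w" unfolding l2_def by (rule L2_set_triangle_ineq)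
  finally show ?thesis .
qed

lemma l2_scale: "l2 n (\<lambda>i. a * v i) = cmod a * l2 n v"
  unfolding l2_def by (simp add: norm_mult L2_set_right_distrib)

lemma l2_entry: "i < n \<Longrightarrow> cmod (v i) \<le> l2 n v"
  unfolding l2_def using member_le_L2_set[of "{..<n}" i "\<lambda>i. cmod (v i)"] by simp

lemma l2_sq: "(l2 n v)\<^sup>2 = (\<Sum>i<n. (cmod (v i))\<^sup>2)"
  unfolding l2_def L2_set_def by (simp add: sum_nonneg)

lemma l2_mat_app_le_entry_sum:
  assumes "M \<in> carrier_mat n n"
  shows "l2 n (mat_app M v) \<le> entry_sum n M * l2 n v"
proof -
  have "l2 n (mat_app M v) \<le> (\<Sum>i<n. cmod (mat_app M v i))"
    unfolding l2_def by (rule L2_set_le_sum) auto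
  also have "\<dots> \<le> (\<Sum>i<n. \<Sum>j<n. cmod (M $$ (i,j)) * l2 n v)"
  proof (rule sum_mono)
    fix i
    have "cmod (mat_app M v i) \<le> (\<Sum>j<n. cmod (M $$ (i,j) * v j))"
      unfolding mat_app_def using assms by (auto intro: norm_sum)
    also have "\<dots> \<le> (\<Sum>j<n. cmod (M $$ (i,j)) * l2 n v)"
      unfolding norm_mult by (intro sum_mono mult_left_mono) (auto intro: l2_entry)
    finally show "cmod (mat_app M v i) \<le> (\<Sum>j<n. cmod (M $$ (i,j)) * l2 n v)" .
  qed
  also have "\<dots> = entry_sum n M * l2 n v" unfolding entry_sum_def by (simp add: sum_distrib_right)
  finally show ?thesis .
qed

lemma entry_sum_nonneg: "0 \<le> entry_sum n M" unfolding entry_sum_def by (intro sum_nonneg) auto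

lemma l2_zero: "l2 n (\<lambda>_. 0) = 0" by (simp add: l2_def L2_set_def)

lemma opnorm_bdd: assumes "M \<in> carrier_mat n n"
  shows "bdd_above {l2 n (mat_app M v) | v. l2 n v \<le> 1}"
proof (rule bdd_aboveI)
  fix x assume "x \<in> {l2 n (mat_app M v) | v. l2 n v \<le> 1}"
  then obtain v where v: "x = l2 n (mat_app M v)" "l2 n v \<le> 1" by blast
  have "entry_sum n M * l2 n v \<le> entry_sum n M * 1" using v entry_sum_nonneg by (intro mult_left_mono) auto
  then show "x \<le> entry_sum n M" using l2_mat_app_le_entry_sum[OF assms, of v] v by simp
qed

lemma opnorm_ge: "M \<in> carrier_mat n n \<Longrightarrow> l2 n v \<le> 1 \<Longrightarrow> l2 n (mat_app M v) \<le> opnorm n M"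
  unfolding opnorm_def by (rule cSup_upper[OF _ opnorm_bdd]) auto

lemma opnorm_leI: "(\<And>v. l2 n v \<le> 1 \<Longrightarrow> l2 n (mat_app M v) \<le> c) \<Longrightarrow> opnorm n M \<le> c"
  unfolding opnorm_def by (rule cSup_least) (auto intro!: exI[of _ "\<lambda>_. 0"] simp: l2_zero)

lemma opnorm_nonneg: "M \<in> carrier_mat n n \<Longrightarrow> 0 \<le> opnorm n M"
  by (rule order_trans[OF l2_nonneg opnorm_ge[of M n "\<lambda>_. 0"]]) (simp_all add: l2_zero)

lemma mat_app_scale: "mat_app M (\<lambda>i. a * v i) = (\<lambda>i. a * mat_app M v i)"
  unfolding mat_app_def by (auto simp: sum_distrib_left algebra_simps)

lemma l2_mat_app_le: assumes M: "M \<in> carrier_mat n n"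
  shows "l2 n (mat_app M v) \<le> opnorm n M * l2 n v"
proof (cases "l2 n v = 0")
  \<comment> \<open>A null vector cannot be normalised; here the entry sum bound gives the value
    \<open>0\<close>.\<close>
  case True
  then show ?thesis using l2_mat_app_le_entry_sum[OF M, of v] by simp
next
  case False
  then have pos: "l2 n v > 0" by (simp add: less_le)
  let ?a = "complex_of_real (1 / l2 n v)"
  have c: "cmod ?a = 1 / l2 n v" using pos by (simp only: norm_of_real) simp
  have "l2 n (mat_app M (\<lambda>i. ?a * v i)) \<le> opnorm n M"
    by (rule opnorm_ge[OF M]) (use pos in \<open>simp only: l2_scale c, simp\<close>)
  then have "l2 n (mat_app M v) / l2 n v \<le> opnorm n M" unfolding mat_app_scale l2_scale c by simp
  then show ?thesis using pos by (simp add: divide_le_eq)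
qed

lemma opnorm_entry: assumes M: "M \<in> carrier_mat n n" and "i < n" "j < n"
  shows "cmod (M $$ (i,j)) \<le> opnorm n M"
proof -
  let ?v = "\<lambda>k. if k = j then 1 else 0 :: complex"
  have "(l2 n ?v)\<^sup>2 = (\<Sum>k<n. if k = j then 1 else 0)" unfolding l2_sq by (intro sum.cong) auto
  also have "\<dots> = 1" using \<open>j < n\<close> by simp
  finally have "l2 n ?v \<le> 1" using power2_le_imp_le[of "l2 n ?v" 1] by simp
  moreover have "mat_app M ?v i = M $$ (i,j)" unfolding mat_app_def using M \<open>j < n\<close> by (simp add: if_distrib cong: if_cong)
  ultimately show ?thesis using opnorm_ge[OF M, of ?v] l2_entry[OF \<open>i < n\<close>, of "mat_app M ?v"] by simp
qed

lemma opnorm_le_entry_sum: assumes "M \<in> carrier_mat n n" shows "opnorm n M \<le> entry_sum n M"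
proof (rule opnorm_leI)
  fix v assume "l2 n v \<le> 1"
  then have "entry_sum n M * l2 n v \<le> entry_sum n M * 1" using entry_sum_nonneg by (intro mult_left_mono) auto
  then show "l2 n (mat_app M v) \<le> entry_sum n M" using l2_mat_app_le_entry_sum[OF assms, of v] by simp
qed

lemma opnorm_add: assumes "M \<in> carrier_mat n n" "N \<in> carrier_mat n n"
  shows "opnorm n (M + N) \<le> opnorm n M + opnorm n N"
proof (rule opnorm_leI)
  fix v assume v: "l2 n v \<le> 1"
  have "l2 n (mat_app (M + N) v) = l2 n (\<lambda>i. mat_app M v i + mat_app N v i)"
    by (rule l2_cong) (use assms in \<open>auto simp: mat_app_def algebra_simps sum.distrib\<close>)
  also have "\<dots> \<le> l2 n (mat_app M v) + l2 n (mat_app N v)" by (rule l2_triangle)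
  finally show "l2 n (mat_app (M + N) v) \<le> opnorm n M + opnorm n N"
    using opnorm_ge[OF assms(1) v] opnorm_ge[OF assms(2) v] by simp
qed

lemma opnorm_smult_le: assumes "M \<in> carrier_mat n n"
  shows "opnorm n (a \<cdot>\<^sub>m M) \<le> cmod a * opnorm n M"
proof (rule opnorm_leI)
  fix v assume v: "l2 n v \<le> 1"
  have "l2 n (mat_app (a \<cdot>\<^sub>m M) v) = l2 n (\<lambda>i. a * mat_app M v i)"
    by (rule l2_cong) (use assms in \<open>auto simp: mat_app_def algebra_simps sum_distrib_left\<close>)
  also have "\<dots> = cmod a * l2 n (mat_app M v)" by (rule l2_scale)
  finally show "l2 n (mat_app (a \<cdot>\<^sub>m M) v) \<le> cmod a * opnorm n M"
    using opnorm_ge[OF assms v] by (simp add: mult_left_mono)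
qed

text \<open>The converse inequality is the easy one for the factor \<open>1 / a\<close>.\<close>

lemma opnorm_smult: assumes M: "M \<in> carrier_mat n n"
  shows "opnorm n (a \<cdot>\<^sub>m M) = cmod a * opnorm n M"
proof (cases "a = 0")
  case True
  then show ?thesis using opnorm_smult_le[OF M, of a] opnorm_nonneg[of "a \<cdot>\<^sub>m M" n] M by simp
next
  case False
  have "(1 / a) \<cdot>\<^sub>m (a \<cdot>\<^sub>m M) = M" using False by (intro eq_matI) auto
  then have "opnorm n M \<le> opnorm n (a \<cdot>\<^sub>m M) / cmod a"
    using opnorm_smult_le[of "a \<cdot>\<^sub>m M" n "1 / a"] M by (simp add: norm_divide)
  then have "cmod a * opnorm n M \<le> opnorm n (a \<cdot>\<^sub>m M)" using False by (simp add: field_simps)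
  then show ?thesis using opnorm_smult_le[OF M, of a] by simp
qed

lemma mat_app_mult: assumes "M \<in> carrier_mat n n" "N \<in> carrier_mat n n" "i < n"
  shows "mat_app (M * N) v i = mat_app M (mat_app N v) i"
proof -
  have "mat_app (M * N) v i = (\<Sum>j<n. \<Sum>k<n. M $$ (i,k) * N $$ (k,j) * v j)"
    unfolding mat_app_def using assms
    by (auto simp: scalar_prod_def lessThan_atLeast0 sum_distrib_right intro!: sum.cong)
  also have "\<dots> = (\<Sum>k<n. \<Sum>j<n. M $$ (i,k) * N $$ (k,j) * v j)" by (rule sum.swap)
  also have "\<dots> = mat_app M (mat_app N v) i"
    unfolding mat_app_def using assms by (auto simp: sum_distrib_left mult.assoc)
  finally show ?thesis .
qed

lemma opnorm_mult: assumes M: "M \<in> carrier_mat n n" and N: "N \<in> carrier_mat n n"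
  shows "opnorm n (M * N) \<le> opnorm n M * opnorm n N"
proof (rule opnorm_leI)
  fix v assume v: "l2 n v \<le> 1"
  have "l2 n (mat_app (M * N) v) = l2 n (mat_app M (mat_app N v))"
    by (rule l2_cong) (use mat_app_mult[OF M N] in auto)
  also have "\<dots> \<le> opnorm n M * l2 n (mat_app N v)" by (rule l2_mat_app_le[OF M])
  also have "\<dots> \<le> opnorm n M * opnorm n N"
    using opnorm_ge[OF N v] opnorm_nonneg[OF M] by (rule mult_left_mono)
  finally show "l2 n (mat_app (M * N) v) \<le> opnorm n M * opnorm n N" .
qed

lemma mat_adjoint_closed [simp]: "M \<in> carrier_mat n n \<Longrightarrow> mat_adjoint M \<in> carrier_mat n n"
  by auto

lemma mat_adjoint_adjoint: "mat_adjoint (mat_adjoint M) = (M :: complex mat)"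
  by (intro eq_matI) auto

text \<open>The squared norm of the image of \<open>v\<close> is the inner product of
  \<open>v\<close> with its image under \<open>mat_adjoint M * M\<close>; Cauchy-Schwarz does the
  rest. This is the source of the C*-identity.\<close>

lemma l2_mat_app_sq: assumes M: "M \<in> carrier_mat n n"
  shows "(l2 n (mat_app M v))\<^sup>2 \<le> l2 n v * l2 n (mat_app (mat_adjoint M * M) v)"
proof -
  let ?w = "mat_app (mat_adjoint M * M) v"
  have Ma: "mat_adjoint M \<in> carrier_mat n n" using M by simp
  have "complex_of_real ((l2 n (mat_app M v))\<^sup>2) = (\<Sum>i<n. cnj (mat_app M v i) * mat_app M v i)"
    unfolding l2_sq of_real_sum by (intro sum.cong refl) (simp only: complex_norm_square mult.commute)
  also have "\<dots> = (\<Sum>i<n. \<Sum>k<n. cnj (v k) * (mat_adjoint M $$ (k,i) * mat_app M v i))"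
    using M by (intro sum.cong refl) (auto simp: mat_app_def sum_distrib_right intro!: sum.cong)
  also have "\<dots> = (\<Sum>k<n. \<Sum>i<n. cnj (v k) * (mat_adjoint M $$ (k,i) * mat_app M v i))" by (rule sum.swap)
  also have "\<dots> = (\<Sum>k<n. cnj (v k) * ?w k)"
    using mat_app_mult[OF Ma M] M by (intro sum.cong refl) (simp add: mat_app_def[of "mat_adjoint M"] sum_distrib_left)
  finally have "complex_of_real ((l2 n (mat_app M v))\<^sup>2) = (\<Sum>k<n. cnj (v k) * ?w k)" .
  then have "(l2 n (mat_app M v))\<^sup>2 = cmod (\<Sum>k<n. cnj (v k) * ?w k)"
    by (metis norm_of_real abs_of_nonneg zero_le_power2)
  also have "\<dots> \<le> (\<Sum>k<n. \<bar>cmod (v k)\<bar> * \<bar>cmod (?w k)\<bar>)"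
    by (rule order_trans[OF norm_sum]) (simp add: norm_mult)
  also have "\<dots> \<le> l2 n v * l2 n ?w" unfolding l2_def by (rule L2_set_mult_ineq)
  finally show ?thesis .
qed

lemma opnorm_sq_le: assumes M: "M \<in> carrier_mat n n"
  shows "(opnorm n M)\<^sup>2 \<le> opnorm n (mat_adjoint M * M)"
proof -
  have N: "mat_adjoint M * M \<in> carrier_mat n n" using M by (simp add: mult_carrier_mat[of _ n n])
  have "opnorm n M \<le> sqrt (opnorm n (mat_adjoint M * M))"
  proof (rule opnorm_leI)
    fix v assume v: "l2 n v \<le> 1"
    have "(l2 n (mat_app M v))\<^sup>2 \<le> l2 n v * l2 n (mat_app (mat_adjoint M * M) v)" by (rule l2_mat_app_sq[OF M])
    also have "\<dots> \<le> 1 * opnorm n (mat_adjoint M * M)" using v opnorm_ge[OF N v] by (intro mult_mono) auto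
    finally show "l2 n (mat_app M v) \<le> sqrt (opnorm n (mat_adjoint M * M))" by (intro real_le_rsqrt) simp
  qed
  then show ?thesis using opnorm_nonneg[OF M] opnorm_nonneg[OF N] by (metis power_mono real_sqrt_pow2)
qed

text \<open>One factor \<open>opnorm n M\<close> cancels in \<open>opnorm_sq_le\<close>; applied to
  the adjoint as well, this makes the involution isometric.\<close>

lemma opnorm_le_adjoint: assumes M: "M \<in> carrier_mat n n"
  shows "opnorm n M \<le> opnorm n (mat_adjoint M)"
proof (cases "opnorm n M = 0")
  case True then show ?thesis using opnorm_nonneg[of "mat_adjoint M" n] M by simp
next
  case False
  then have pos: "opnorm n M > 0" using opnorm_nonneg[OF M] by simp
  have "(opnorm n M)\<^sup>2 \<le> opnorm n (mat_adjoint M) * opnorm n M"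
    using opnorm_sq_le[OF M] opnorm_mult[of "mat_adjoint M" n M] M by simp
  then show ?thesis using pos by (simp add: power2_eq_square)
qed

lemma opnorm_cstar: assumes M: "M \<in> carrier_mat n n"
  shows "opnorm n (mat_adjoint M * M) = (opnorm n M)\<^sup>2"
proof -
  have "opnorm n (mat_adjoint M) \<le> opnorm n M"
    using opnorm_le_adjoint[of "mat_adjoint M" n] M by (simp add: mat_adjoint_adjoint)
  then have "opnorm n (mat_adjoint M) * opnorm n M \<le> opnorm n M * opnorm n M"
    using opnorm_nonneg[OF M] by (rule mult_right_mono)
  then show ?thesis
    using opnorm_sq_le[OF M] opnorm_mult[of "mat_adjoint M" n M] M by (simp add: power2_eq_square)
qed

definition mat_cstar :: "nat \<Rightarrow> complex mat cstar" where
  "mat_cstar n = \<lparr>carrier = carrier_mat n n, monoid.mult = (*), one = 1\<^sub>m n, zero = 0\<^sub>m n n, add = (+),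
     module.smult = (\<cdot>\<^sub>m), star = mat_adjoint, nrm = opnorm n\<rparr>"

lemma mat_cstar_simps [simp]:
  "carrier (mat_cstar n) = carrier_mat n n" "monoid.mult (mat_cstar n) = (*)" "zero (mat_cstar n) = 0\<^sub>m n n"
  "add (mat_cstar n) = (+)" "module.smult (mat_cstar n) = (\<cdot>\<^sub>m)" "star (mat_cstar n) = mat_adjoint"
  "nrm (mat_cstar n) = opnorm n"
  by (simp_all add: mat_cstar_def)

lemma abelian_group_mat_cstar: "abelian_group (mat_cstar n)"
proof (rule abelian_groupI)
  fix M assume "M \<in> carrier (mat_cstar n)"
  then show "\<exists>N\<in>carrier (mat_cstar n). N \<oplus>\<^bsub>mat_cstar n\<^esub> M = \<zero>\<^bsub>mat_cstar n\<^esub>"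
    by (intro bexI[of _ "- M"]) auto
qed (auto simp: comm_add_mat)

lemma a_minus_mat_cstar: assumes "M \<in> carrier_mat n n" "N \<in> carrier_mat n n"
  shows "M \<ominus>\<^bsub>mat_cstar n\<^esub> N = M - N"
proof -
  interpret abelian_group "mat_cstar n" by (rule abelian_group_mat_cstar)
  have "\<ominus>\<^bsub>mat_cstar n\<^esub> N = - N"
    using assms minus_equality[of "- N" N] by simp
  then show ?thesis using assms by (simp add: minus_eq minus_add_uminus_mat)
qed

text \<open>Entries are dominated by the operator norm, which is dominated by the entry sum, so a
  limit may be formed entrywise.\<close>

lemma mat_cstar_complete:
  assumes X: "range X \<subseteq> carrier_mat n n"
    and cauchy: "\<forall>\<epsilon>>0. \<exists>N::nat. \<forall>m\<ge>N. \<forall>k\<ge>N. opnorm n (X m - X k) < \<epsilon>"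
  shows "\<exists>M\<in>carrier_mat n n. (\<lambda>m. opnorm n (X m - M)) \<longlonglongrightarrow> 0"
proof -
  have Xc: "X m \<in> carrier_mat n n" for m using X by auto
  have conv: "convergent (\<lambda>m. X m $$ (i,j))" if "i < n" "j < n" for i j
  proof -
    have "Cauchy (\<lambda>m. X m $$ (i,j))"
    proof (rule metric_CauchyI)
      fix e :: real assume "e > 0"
      then obtain N where N: "\<And>m k. m \<ge> N \<Longrightarrow> k \<ge> N \<Longrightarrow> opnorm n (X m - X k) < e" using cauchy by meson
      have "dist (X m $$ (i,j)) (X k $$ (i,j)) < e" if mk: "m \<ge> N" "k \<ge> N" for m k
        using opnorm_entry[OF minus_carrier_mat[OF Xc[of k]], of i j "X m"] Xc[of m] Xc[of k] \<open>i < n\<close> \<open>j < n\<close> N[OF mk]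
        by (simp add: dist_norm)
      then show "\<exists>N. \<forall>m\<ge>N. \<forall>k\<ge>N. dist (X m $$ (i,j)) (X k $$ (i,j)) < e" by blast
    qed
    then show ?thesis by (simp add: Cauchy_convergent_iff)
  qed
  define M where "M = mat n n (\<lambda>(i,j). lim (\<lambda>m. X m $$ (i,j)))"
  have Mc: "M \<in> carrier_mat n n" unfolding M_def by simp
  have lim: "(\<lambda>m. X m $$ (i,j)) \<longlonglongrightarrow> M $$ (i,j)" if "i < n" "j < n" for i j
    using conv[OF that] that unfolding M_def by (simp add: convergent_LIMSEQ_iff)
  have "(\<lambda>m. \<Sum>i<n. \<Sum>j<n. cmod (X m $$ (i,j) - M $$ (i,j))) \<longlonglongrightarrow> (\<Sum>i<n. \<Sum>j<n. cmod (M $$ (i,j) - M $$ (i,j)))"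
    by (intro tendsto_intros lim) auto
  then have es: "(\<lambda>m. entry_sum n (X m - M)) \<longlonglongrightarrow> 0"
    unfolding entry_sum_def using Xc Mc by simp
  have "(\<lambda>m. opnorm n (X m - M)) \<longlonglongrightarrow> 0"
  proof (rule tendsto_sandwich[OF _ _ tendsto_const es])
    show "\<forall>\<^sub>F m in sequentially. 0 \<le> opnorm n (X m - M)" using Xc Mc by (intro always_eventually allI opnorm_nonneg) auto
    show "\<forall>\<^sub>F m in sequentially. opnorm n (X m - M) \<le> entry_sum n (X m - M)"
      using Xc Mc by (intro always_eventually allI opnorm_le_entry_sum) auto
  qed
  then show ?thesis using Mc by blast
qed

lemma opnorm_eq_0: assumes M: "M \<in> carrier_mat n n" shows "opnorm n M = 0 \<longleftrightarrow> M = 0\<^sub>m n n"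
proof
  assume 0: "opnorm n M = 0"
  show "M = 0\<^sub>m n n"
    by (intro eq_matI) (use opnorm_entry[OF M] M 0 in auto)
next
  assume "M = 0\<^sub>m n n"
  then have "entry_sum n M = 0" unfolding entry_sum_def by simp
  then show "opnorm n M = 0" using opnorm_le_entry_sum[OF M] opnorm_nonneg[OF M] by simp
qed

lemma mat_adjoint_mult: assumes "M \<in> carrier_mat n n" "N \<in> carrier_mat n n"
  shows "mat_adjoint (M * N) = mat_adjoint N * mat_adjoint (M :: complex mat)"
  using assms by (intro eq_matI) (auto simp: scalar_prod_def mult.commute intro!: sum.cong)

lemma cstar_algebra_mat_cstar: "cstar_algebra (mat_cstar n)"
proof (intro cstar_algebra.intro abelian_group_mat_cstar cstar_algebra_axioms.intro, goal_cases)
  case 2 then show ?case by (simp add: assoc_mult_mat)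
next
  case 3 then show ?case by (simp add: add_mult_distrib_mat)
next
  case 4 then show ?case by (simp add: mult_add_distrib_mat)
next
  case (6 x a b) then show ?case by (intro eq_matI) (auto simp: algebra_simps)
next
  case (7 x y a) then show ?case by (intro eq_matI) (auto simp: algebra_simps)
next
  case (8 x a b) then show ?case by (intro eq_matI) (auto simp: algebra_simps)
next
  case (9 x) then show ?case by (intro eq_matI) auto
next
  case (10 x y a) then show ?case by (simp add: mult_smult_assoc_mat)
next
  case (11 x y a) then show ?case by (simp add: mult_smult_distrib)
next
  case (13 x y) then show ?case by (intro eq_matI) auto
next
  case (14 x a) then show ?case by (intro eq_matI) auto
next
  case (15 x y) then show ?case by (simp add: mat_adjoint_mult)
next
  case (16 x) then show ?case by (simp add: mat_adjoint_adjoint)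
next
  case (23 X)
  have c: "\<And>m. X m \<in> carrier_mat n n" using 23(1) by auto
  have "\<exists>M\<in>carrier_mat n n. (\<lambda>m. opnorm n (X m - M)) \<longlonglongrightarrow> 0"
    using 23 by (intro mat_cstar_complete) (simp_all add: a_minus_mat_cstar[OF c c])
  then show ?case using a_minus_mat_cstar[OF c] by auto
qed (simp_all add: opnorm_nonneg opnorm_eq_0 opnorm_smult opnorm_add opnorm_mult opnorm_cstar mult_carrier_mat[of _ n n])

section \<open>Transport to the test carrier\<close>

text \<open>Universality speaks of algebras carried by \<open>test_carrier\<close>, so matrix
  algebras have to be copied there along an injection. The operations decode, compute in
  \<open>B\<close> and encode again.\<close>

definition transport :: "('a \<Rightarrow> 'b) \<Rightarrow> 'a cstar \<Rightarrow> 'b cstar" where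
  "transport f B = (let g = inv_into (carrier B) f in
     \<lparr>carrier = f ` carrier B, monoid.mult = \<lambda>x y. f (g x \<otimes>\<^bsub>B\<^esub> g y), one = f \<one>\<^bsub>B\<^esub>,
      zero = f \<zero>\<^bsub>B\<^esub>, add = \<lambda>x y. f (g x \<oplus>\<^bsub>B\<^esub> g y), module.smult = \<lambda>a x. f (a \<odot>\<^bsub>B\<^esub> g x),
      star = \<lambda>x. f (star B (g x)), nrm = \<lambda>x. nrm B (g x)\<rparr>)"

locale transported = cstar_algebra B for B :: "'a cstar" (structure) +
  fixes f :: "'a \<Rightarrow> 'b"
  assumes inj: "inj_on f (carrier B)"
begin

lemma transport_simps:
  "carrier (transport f B) = f ` carrier B"
  "\<zero>\<^bsub>transport f B\<^esub> = f \<zero>"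
  "x \<in> carrier B \<Longrightarrow> y \<in> carrier B \<Longrightarrow> f x \<otimes>\<^bsub>transport f B\<^esub> f y = f (x \<otimes> y)"
  "x \<in> carrier B \<Longrightarrow> y \<in> carrier B \<Longrightarrow> f x \<oplus>\<^bsub>transport f B\<^esub> f y = f (x \<oplus> y)"
  "x \<in> carrier B \<Longrightarrow> a \<odot>\<^bsub>transport f B\<^esub> f x = f (a \<odot> x)"
  "x \<in> carrier B \<Longrightarrow> star (transport f B) (f x) = f (star B x)"
  "x \<in> carrier B \<Longrightarrow> nrm (transport f B) (f x) = nrm B x"
  using inj by (simp_all add: transport_def Let_def)

lemma f_eq_iff: "x \<in> carrier B \<Longrightarrow> y \<in> carrier B \<Longrightarrow> f x = f y \<longleftrightarrow> x = y"
  using inj by (auto dest: inj_onD)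

lemma abelian_group_transport: "abelian_group (transport f B)"
proof (rule abelian_groupI)
  fix x assume "x \<in> carrier (transport f B)"
  then obtain x' where "x' \<in> carrier B" "x = f x'" by (auto simp: transport_simps)
  then show "\<exists>y\<in>carrier (transport f B). y \<oplus>\<^bsub>transport f B\<^esub> x = \<zero>\<^bsub>transport f B\<^esub>"
    by (intro bexI[of _ "f (\<ominus> x')"]) (auto simp: transport_simps l_neg)
qed (auto simp: transport_simps a_ac)

lemma transport_minus: assumes "x \<in> carrier B" "y \<in> carrier B"
  shows "f x \<ominus>\<^bsub>transport f B\<^esub> f y = f (x \<ominus> y)"
proof -
  interpret T: abelian_group "transport f B" by (rule abelian_group_transport)
  have "\<ominus>\<^bsub>transport f B\<^esub> f y = f (\<ominus> y)"
    using assms by (intro T.minus_equality) (auto simp: transport_simps l_neg)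
  then show ?thesis using assms by (simp add: T.minus_eq minus_eq transport_simps)
qed

lemma cstar_algebra_transport: "cstar_algebra (transport f B)"
proof (intro cstar_algebra.intro abelian_group_transport cstar_algebra_axioms.intro, goal_cases)
  case (23 X)
  then have "\<And>n. X n \<in> f ` carrier B" by (auto simp: transport_simps)
  then have "\<forall>n. \<exists>y\<in>carrier B. X n = f y" by blast
  then obtain Y where Y: "\<And>n. Y n \<in> carrier B" "\<And>n. X n = f (Y n)" by metis
  have "\<exists>y\<in>carrier B. (\<lambda>n. nrm B (Y n \<ominus> y)) \<longlonglongrightarrow> 0"
    using 23(2) Y by (intro complete) (auto simp: transport_minus transport_simps)
  then show ?case using Y by (auto simp: transport_minus transport_simps)
qed (auto simp: transport_simps mult_closed mult_assoc distr_right distr_left scale_closed scale_add_left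
    scale_add_right scale_scale scale_one scale_mult_left scale_mult_right star_closed star_add star_scale
    star_mult star_star nrm_nonneg nrm_eq_0 f_eq_iff nrm_scale nrm_triangle nrm_mult cstar_identity)

lemma ultragraph_family_transport:
  assumes G: "is_ultragraph G" and fam: "ultragraph_family G B q t"
  shows "ultragraph_family G (transport f B) (\<lambda>X. f (q X)) (\<lambda>e. f (t e))"
proof -
  have q: "X \<in> gen_verts G \<Longrightarrow> q X \<in> carrier B" for X
    using fam unfolding ultragraph_family_def projection_def by blast
  have t: "e \<in> edges G \<Longrightarrow> t e \<in> carrier B" for e
    using fam unfolding ultragraph_family_def partial_isometry_def by blast
  have tt: "e \<in> edges G \<Longrightarrow> t e \<otimes> star B (t e) \<in> carrier B" "e \<in> edges G \<Longrightarrow> star B (t e) \<otimes> t e \<in> carrier B"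
    "e \<in> edges G \<Longrightarrow> star B (t e) \<in> carrier B" for e
    using t mult_closed star_closed by auto
  note simps = transport_simps transport_minus q t tt gen_verts.inter gen_verts.union
  have fs: "f (q {v}) = (\<Oplus>\<^bsub>transport f B\<^esub>e\<in>emitted G {v}. f (t e) \<otimes>\<^bsub>transport f B\<^esub> star (transport f B) (f (t e)))"
    if v: "is_regular G v" for v
  proof -
    interpret T: abelian_group "transport f B" by (rule abelian_group_transport)
    have fin: "finite (emitted G {v})" and sub: "emitted G {v} \<subseteq> edges G"
      using v unfolding is_regular_def emitted_def by auto
    have "q {v} = finsum B (\<lambda>e. t e \<otimes> star B (t e)) (emitted G {v})"
      using fam v unfolding ultragraph_family_def by blast
    then have "f (q {v}) = f (finsum B (\<lambda>e. t e \<otimes> star B (t e)) (emitted G {v}))" by simp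
    also have "\<dots> = finsum (transport f B) (\<lambda>e. f (t e \<otimes> star B (t e))) (emitted G {v})"
      using sub by (intro finsum_additive[OF fin _ abelian_group_transport]) (auto simp: simps)
    also have "\<dots> = finsum (transport f B) (\<lambda>e. f (t e) \<otimes>\<^bsub>transport f B\<^esub> star (transport f B) (f (t e))) (emitted G {v})"
      using sub by (intro T.finsum_cong') (auto simp: simps)
    finally show ?thesis .
  qed
  have src: "q {src G e} \<in> carrier B" if "e \<in> edges G" for e
    using G that q gen_verts.vertex[of "src G e" G] unfolding is_ultragraph_def by simp
  note F = fam[unfolded ultragraph_family_def projection_def partial_isometry_def proj_le_def]
  show ?thesis
    unfolding ultragraph_family_def projection_def partial_isometry_def proj_le_def
  proof (intro conjI ballI allI impI)
    fix X assume X: "X \<in> gen_verts G"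
    then show "f (q X) \<in> carrier (transport f B)" "star (transport f B) (f (q X)) = f (q X)"
      "f (q X) \<otimes>\<^bsub>transport f B\<^esub> f (q X) = f (q X)"
      using F by (simp_all add: simps)
    fix Y assume Y: "Y \<in> gen_verts G"
    have "q X \<otimes> q Y = q (X \<inter> Y)" "q (X \<union> Y) = q X \<oplus> q Y \<ominus> q (X \<inter> Y)" using F X Y by blast+
    then show "f (q X) \<otimes>\<^bsub>transport f B\<^esub> f (q Y) = f (q (X \<inter> Y))"
      "f (q (X \<union> Y)) = f (q X) \<oplus>\<^bsub>transport f B\<^esub> f (q Y) \<ominus>\<^bsub>transport f B\<^esub> f (q (X \<inter> Y))"
      using X Y by (simp_all add: simps)
  next
    fix e assume e: "e \<in> edges G"
    have "t e \<otimes> star B (t e) \<otimes> t e = t e" "star B (t e) \<otimes> t e = q (rng G e)"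
      "t e \<otimes> star B (t e) = q {src G e} \<otimes> (t e \<otimes> star B (t e))" using F e by blast+
    then show "f (t e) \<in> carrier (transport f B)"
      "f (t e) \<otimes>\<^bsub>transport f B\<^esub> star (transport f B) (f (t e)) \<otimes>\<^bsub>transport f B\<^esub> f (t e) = f (t e)"
      "star (transport f B) (f (t e)) \<otimes>\<^bsub>transport f B\<^esub> f (t e) = f (q (rng G e))"
      "f (t e) \<otimes>\<^bsub>transport f B\<^esub> star (transport f B) (f (t e)) =
        f (q {src G e}) \<otimes>\<^bsub>transport f B\<^esub> (f (t e) \<otimes>\<^bsub>transport f B\<^esub> star (transport f B) (f (t e)))"
      using e src[OF e] by (simp_all add: simps)
    fix e' assume e': "e' \<in> edges G" and "e \<noteq> e'"
    then have "t e \<otimes> star B (t e) \<otimes> (t e' \<otimes> star B (t e')) = \<zero>" using F e by blast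
    then show "f (t e) \<otimes>\<^bsub>transport f B\<^esub> star (transport f B) (f (t e)) \<otimes>\<^bsub>transport f B\<^esub>
       (f (t e') \<otimes>\<^bsub>transport f B\<^esub> star (transport f B) (f (t e'))) = \<zero>\<^bsub>transport f B\<^esub>"
      using e e' by (simp add: simps)
  next
    show "f (q {}) = \<zero>\<^bsub>transport f B\<^esub>" using F by (simp add: simps)
  qed (rule fs)
qed

end

text \<open>Functions on lists have room for a matrix: the entry at \<open>(i,j)\<close> becomes the
  value at the list of the two numbers \<open>i\<close> and \<open>j\<close>, and all other values
  are \<open>0\<close>.\<close>

definition encode_mat :: "complex mat \<Rightarrow> ('v, 'e) test_carrier" where
  "encode_mat M l = (case l of [Inr (Inr i), Inr (Inr j)] \<Rightarrow> if i < dim_row M \<and> j < dim_col M then M $$ (i,j) else 0 | _ \<Rightarrow> 0)"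

lemma inj_encode_mat: "inj_on (encode_mat :: complex mat \<Rightarrow> ('v,'e) test_carrier) (carrier_mat n n)"
proof (rule inj_onI)
  fix M N :: "complex mat" assume MN: "M \<in> carrier_mat n n" "N \<in> carrier_mat n n"
    and eq: "(encode_mat M :: ('v,'e) test_carrier) = encode_mat N"
  have "M $$ (i,j) = N $$ (i,j)" if "i < n" "j < n" for i j
    using fun_cong[OF eq, of "[Inr (Inr i), Inr (Inr j)]"] that MN by (simp add: encode_mat_def)
  then show "M = N" using MN by (intro eq_matI) auto
qed

text \<open>Encode the matrices, use universality, decode. From here on, representations of
  \<open>A\<close> are produced by checking the relations on matrices.\<close>

lemma fin_dim_rep_of_family:
  assumes G: "is_ultragraph G" and alg: "is_ultragraph_algebra (G :: ('v,'e) ultragraph) A p s" and fam: "ultragraph_family G (mat_cstar n) q t"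
  shows "\<exists>\<pi>. fin_dim_rep A n \<pi> \<and> (\<forall>X\<in>gen_verts G. \<pi> (p X) = q X) \<and> (\<forall>e\<in>edges G. \<pi> (s e) = t e)"
proof -
  let ?f = "encode_mat :: complex mat \<Rightarrow> ('v,'e) test_carrier"
  let ?B = "transport ?f (mat_cstar n)"
  interpret transported "mat_cstar n" ?f
    using inj_encode_mat cstar_algebra_mat_cstar by (auto intro!: transported.intro transported_axioms.intro)
  obtain h where h: "star_hom A ?B h" "\<forall>X\<in>gen_verts G. h (p X) = ?f (q X)" "\<forall>e\<in>edges G. h (s e) = ?f (t e)"
  proof -
    have "\<forall>(B :: ('v, 'e) test_carrier cstar) q t. cstar_algebra B \<and> ultragraph_family G B q t \<longrightarrow>
        (\<exists>h. star_hom A B h \<and> (\<forall>X\<in>gen_verts G. h (p X) = q X) \<and> (\<forall>e\<in>edges G. h (s e) = t e))"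
      using alg unfolding is_ultragraph_algebra_def by simp
    from this[rule_format, of ?B, OF conjI, OF cstar_algebra_transport ultragraph_family_transport[OF G fam]]
    show ?thesis using that by blast
  qed
  define g where "g = inv_into (carrier_mat n n) ?f"
  have gf: "g (?f M) = M" if "M \<in> carrier_mat n n" for M
    using that inj unfolding g_def by simp
  have hx: "\<exists>M\<in>carrier_mat n n. h x = ?f M" if "x \<in> carrier A" for x
    using h(1) that unfolding star_hom_def by (auto simp: transport_simps)
  have "q X \<in> carrier_mat n n" if "X \<in> gen_verts G" for X
    using fam that unfolding ultragraph_family_def projection_def by simp
  moreover have "t e \<in> carrier_mat n n" if "e \<in> edges G" for e
    using fam that unfolding ultragraph_family_def partial_isometry_def by simp
  moreover have "fin_dim_rep A n (\<lambda>x. g (h x))"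
    unfolding fin_dim_rep_def
  proof (intro conjI ballI allI)
    fix x assume x: "x \<in> carrier A"
    obtain M where M: "M \<in> carrier_mat n n" "h x = ?f M" using hx x by blast
    show "g (h x) \<in> carrier_mat n n" using M gf by simp
    have "h (star A x) = star ?B (h x)" "\<And>a. h (a \<odot>\<^bsub>A\<^esub> x) = a \<odot>\<^bsub>?B\<^esub> h x"
      using h(1) x unfolding star_hom_def by auto
    then show "g (h (star A x)) = mat_adjoint (g (h x))" "\<And>a. g (h (a \<odot>\<^bsub>A\<^esub> x)) = a \<cdot>\<^sub>m g (h x)"
      using M gf transport_simps(5,6)[of M] by simp_all
    fix y assume y: "y \<in> carrier A"
    obtain N where N: "N \<in> carrier_mat n n" "h y = ?f N" using hx y by blast
    have "h (x \<oplus>\<^bsub>A\<^esub> y) = h x \<oplus>\<^bsub>?B\<^esub> h y" "h (x \<otimes>\<^bsub>A\<^esub> y) = h x \<otimes>\<^bsub>?B\<^esub> h y"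
      using h(1) x y unfolding star_hom_def by auto
    then show "g (h (x \<oplus>\<^bsub>A\<^esub> y)) = g (h x) + g (h y)" "g (h (x \<otimes>\<^bsub>A\<^esub> y)) = g (h x) * g (h y)"
      using M N gf transport_simps(3,4)[of M N] by (simp_all add: mult_carrier_mat[of M n n])
  qed
  ultimately show ?thesis using h gf by (intro exI[of _ "\<lambda>x. g (h x)"]) simp
qed

section \<open>Cycles and transient edges\<close>

lemma is_path_successively:
  "is_path G es \<longleftrightarrow> es \<noteq> [] \<and> set es \<subseteq> edges G \<and> successively (\<lambda>e f. src G f \<in> rng G e) es"
  unfolding is_path_def successively_conv_nth by blast

lemma is_path_Cons: "is_path G (e # es) \<longleftrightarrow> e \<in> edges G \<and> (es = [] \<or> is_path G es \<and> src G (hd es) \<in> rng G e)"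
  by (cases es) (auto simp: is_path_successively)

lemma is_path_append: "xs \<noteq> [] \<Longrightarrow> ys \<noteq> [] \<Longrightarrow>
    is_path G (xs @ ys) \<longleftrightarrow> is_path G xs \<and> is_path G ys \<and> src G (hd ys) \<in> rng G (last xs)"
  by (auto simp: is_path_successively successively_append_iff)

text \<open>Strong induction on the length: a repeated source yields a shorter closed walk with the
  same initial vertex, so the vertex in the conclusion never changes.\<close>

lemma closed_walk_on_cycle:
  assumes "is_path G es" "path_src G es \<in> path_rng G es"
  shows "on_cycle G (path_src G es)"
  using assms
proof (induction "length es" arbitrary: es rule: less_induct)
  case less
  have ne: "es \<noteq> []" using less.prems(1) by (simp add: is_path_def)
  show ?case
  proof (cases "distinct (map (src G) es)")
    case True
    then have "is_cycle G es" using less.prems unfolding is_cycle_def by simp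
    then show ?thesis using ne unfolding on_cycle_def path_src_def by (metis hd_in_set imageI)
  next
    case False
    then obtain i j where ij: "i < j" "j < length es" "src G (es ! i) = src G (es ! j)"
      unfolding distinct_conv_nth by (metis (no_types, lifting) length_map nat_neq_iff nth_map order.strict_trans)
    have "\<exists>es'. length es' < length es \<and> is_path G es' \<and> path_src G es' = path_src G es \<and> path_src G es' \<in> path_rng G es'"
    \<comment> \<open>If the start itself is revisited, the walk up to that visit is closed;
      otherwise the loop between the two visits is cut out.\<close>
    proof (cases "i = 0")
      case True
      let ?a = "take j es" and ?b = "drop j es"
      have nab: "?a \<noteq> []" "?b \<noteq> []" using ij by auto
      have p: "is_path G ?a" "src G (hd ?b) \<in> rng G (last ?a)"
        using less.prems(1) is_path_append[OF nab, of G] by (simp_all)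
      have "hd ?a = hd es" "hd ?b = es ! j" using ij ne by (auto simp: hd_drop_conv_nth)
      then show ?thesis using p ij True ne unfolding path_src_def path_rng_def
        by (intro exI[of _ ?a]) (auto simp: hd_conv_nth)
    next
      case False
      let ?a = "take i es" and ?b = "drop i es" and ?c = "take j es" and ?d = "drop j es"
      have nab: "?a \<noteq> []" "?b \<noteq> []" "?c \<noteq> []" "?d \<noteq> []" using ij False by auto
      have p: "is_path G ?a" "is_path G ?d" "src G (hd ?b) \<in> rng G (last ?a)"
        using less.prems(1) is_path_append[OF nab(1,2), of G] is_path_append[OF nab(3,4), of G] by simp_all
      have h: "hd ?b = es ! i" "hd ?d = es ! j" using ij by (auto simp: hd_drop_conv_nth)
      have "is_path G (?a @ ?d)" using p h ij(3) is_path_append[OF nab(1,4), of G] by simp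
      moreover have "hd (?a @ ?d) = hd es" "last (?a @ ?d) = last es" using nab ij False by (auto simp: hd_append)
      ultimately show ?thesis using ij less.prems(2) unfolding path_src_def path_rng_def
        by (intro exI[of _ "?a @ ?d"]) auto
    qed
    then show ?thesis using less.hyps by metis
  qed
qed

lemma emitted_Un: "emitted G (X \<union> Y) = emitted G X \<union> emitted G Y"
  unfolding emitted_def by auto

lemma gen_verts_subset_verts:
  assumes "is_ultragraph G" "B \<in> gen_verts G" shows "B \<subseteq> verts G"
  using assms(2) by induction (use assms(1) in \<open>auto simp: is_ultragraph_def\<close>)

lemma emitted_mono: "X \<subseteq> Y \<Longrightarrow> emitted G X \<subseteq> emitted G Y"
  unfolding emitted_def by auto

locale rfd_ultragraph =
  fixes G :: "('v, 'e) ultragraph"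
  assumes ultragraph: "is_ultragraph G"
    and B1: "no_infinite_receivers G"
    and B2: "no_cycle_has_exit G"
    and B3: "no_infinite_backward_chains G"
    and B4: "every_vertex_terminates G"
begin

lemma edgeD: "e \<in> edges G \<Longrightarrow> src G e \<in> verts G" "e \<in> edges G \<Longrightarrow> rng G e \<subseteq> verts G" "e \<in> edges G \<Longrightarrow> rng G e \<noteq> {}"
  using ultragraph unfolding is_ultragraph_def by auto

section \<open>Rigidity of cycles without exits\<close>

text \<open>A vertex in the range of a cycle edge is not a sink, hence emits an edge, and the
  absence of exits leaves only the next edge of the cycle.\<close>

lemma cycle_step:
  assumes c: "is_cycle G c" and i: "i < length c"
  shows "emitted G {src G (c ! i)} = {c ! i}" "rng G (c ! i) = {src G (c ! (Suc i mod length c))}"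
proof -
  let ?n = "length c"
  have E: "set c \<subseteq> edges G" using c unfolding is_cycle_def is_path_def by simp
  have n0: "?n > 0" using i by linarith
  have noexit: "f = c ! (Suc j mod ?n)" if "j < ?n" "f \<in> edges G" "src G f \<in> rng G (c ! j)" for f j
    using B2 c that unfolding no_cycle_has_exit_def has_exit_def by blast
  have nosink: "\<not> is_sink G w" if "j < ?n" "w \<in> rng G (c ! j)" for w j
    using B2 c that unfolding no_cycle_has_exit_def has_exit_def by blast
  have step: "src G (c ! (Suc j mod ?n)) \<in> rng G (c ! j)" if j: "j < ?n" for j
  proof (cases "Suc j < ?n")
    case True
    then show ?thesis using c unfolding is_cycle_def is_path_def by simp
  next
    case False
    then have "Suc j = ?n" using j by simp
    moreover have "c \<noteq> []" using n0 by auto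
    moreover have "length c - 1 = j" using \<open>Suc j = ?n\<close> by linarith
    ultimately have "last c = c ! j" "hd c = c ! 0" by (simp_all only: last_conv_nth hd_conv_nth not_False_eq_True)
    then show ?thesis using c \<open>Suc j = ?n\<close> unfolding is_cycle_def path_src_def path_rng_def by simp
  qed
  show r: "rng G (c ! i) = {src G (c ! (Suc i mod ?n))}"
  proof
    show "{src G (c ! (Suc i mod ?n))} \<subseteq> rng G (c ! i)" using step[OF i] by simp
    show "rng G (c ! i) \<subseteq> {src G (c ! (Suc i mod ?n))}"
    proof
      fix u assume u: "u \<in> rng G (c ! i)"
      have "u \<in> verts G" using u E i edgeD(2)[of "c ! i"] nth_mem[OF i] by blast
      then have "emitted G {u} \<noteq> {}" using nosink[OF i u] unfolding is_sink_def by simp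
      then obtain f where "f \<in> edges G" "src G f = u" unfolding emitted_def by blast
      then show "u \<in> {src G (c ! (Suc i mod ?n))}" using noexit[OF i, of f] u by simp
    qed
  qed
  \<comment> \<open>The cyclic predecessor of \<open>i\<close>: an edge leaving the source of
    \<open>c ! i\<close> starts in the range of \<open>c ! j\<close>, where exits are
    excluded.\<close>
  define j where "j = (i + (?n - 1)) mod ?n"
  have j: "j < ?n" unfolding j_def using n0 by simp
  have ji: "Suc j mod ?n = i" unfolding j_def using i n0 by (simp add: mod_Suc_eq)
  have "f = c ! i" if "f \<in> edges G" "src G f = src G (c ! i)" for f
    using noexit[OF j that(1)] step[OF j] that(2) ji by simp
  moreover have "c ! i \<in> edges G" using E nth_mem[OF i] by blast
  ultimately show "emitted G {src G (c ! i)} = {c ! i}" unfolding emitted_def by auto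
qed

text \<open>\<open>the_elem\<close> is meaningful only at vertices on cycles, where both sets are
  singletons; there \<open>nx\<close> is the successor along the cycle.\<close>

definition en :: "'v \<Rightarrow> 'e" where "en v = the_elem (emitted G {v})"
definition nx :: "'v \<Rightarrow> 'v" where "nx v = the_elem (rng G (en v))"

lemma on_cycle_step:
  assumes "on_cycle G v"
  shows "emitted G {v} = {en v}" "rng G (en v) = {nx v}" "on_cycle G (nx v)"
    "\<exists>k>0. (nx ^^ k) v = v"
proof -
  obtain c i where c: "is_cycle G c" and i: "i < length c" "v = src G (c ! i)"
    using assms unfolding on_cycle_def by (metis imageE in_set_conv_nth)
  have en_c: "en (src G (c ! j)) = c ! j" "nx (src G (c ! j)) = src G (c ! (Suc j mod length c))"
    if "j < length c" for j
    using cycle_step[OF c that] unfolding nx_def en_def by simp_all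
  have n0: "length c > 0" using i by linarith
  show "emitted G {v} = {en v}" "rng G (en v) = {nx v}" using cycle_step[OF c i(1)] en_c[OF i(1)] i(2) by simp_all
  show "on_cycle G (nx v)" using en_c(2)[OF i(1)] c n0 i(2) unfolding on_cycle_def by auto
  have "(nx ^^ k) v = src G (c ! ((i + k) mod length c))" for k
  proof (induction k)
    case 0 show ?case using i by simp
  next
    case (Suc k)
    then show ?case using en_c(2)[of "(i + k) mod length c"] n0 by (simp add: mod_Suc_eq)
  qed
  from this[of "length c"] show "\<exists>k>0. (nx ^^ k) v = v" using i n0 by (intro exI[of _ "length c"]) simp
qed

lemma on_cycle_en: assumes "on_cycle G v" shows "en v \<in> edges G" "src G (en v) = v"
proof -
  have "en v \<in> emitted G {v}" using on_cycle_step(1)[OF assms] by simp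
  then show "en v \<in> edges G" "src G (en v) = v" unfolding emitted_def by auto
qed

lemma on_cycle_edge: assumes "e \<in> edges G" "on_cycle G (src G e)" shows "en (src G e) = e" "rng G e = {nx (src G e)}"
proof -
  have "e \<in> emitted G {src G e}" using assms(1) unfolding emitted_def by simp
  then show "en (src G e) = e" using on_cycle_step(1)[OF assms(2)] by simp
  then show "rng G e = {nx (src G e)}" using on_cycle_step(2)[OF assms(2)] by simp
qed

lemma on_cycle_funpow: "on_cycle G v \<Longrightarrow> on_cycle G ((nx ^^ k) v)"
  by (induction k) (auto intro: on_cycle_step(3))

lemma on_cycle_verts: "on_cycle G v \<Longrightarrow> v \<in> verts G"
  using on_cycle_en edgeD(1) by metis

lemma nx_inverse: assumes "on_cycle G v" shows "\<exists>j. (nx ^^ j) (nx v) = v"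
proof -
  obtain k where "k > 0" "(nx ^^ k) v = v" using on_cycle_step(4)[OF assms] by blast
  then have "(nx ^^ (k - 1)) (nx v) = v" by (cases k) (simp_all add: funpow_swap1)
  then show ?thesis by blast
qed

text \<open>Vertices of periods \<open>k\<close> and \<open>l\<close> both return after
  \<open>k * l\<close> steps, and equality after the first step persists until then.\<close>

lemma nx_inj: assumes "on_cycle G v" "on_cycle G w" "nx v = nx w" shows "v = w"
proof -
  obtain k l where k: "k > 0" "(nx ^^ k) v = v" and l: "l > 0" "(nx ^^ l) w = w"
    using on_cycle_step(4) assms by metis
  have kv: "(nx ^^ (k * l)) v = v" using k(2) by (metis funpow_mod_eq mod_mult_self1_is_0 funpow_0)
  have lw: "(nx ^^ (k * l)) w = w" using l(2) by (metis funpow_mod_eq mod_mult_self2_is_0 funpow_0)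
  obtain m where "k * l = Suc m" using k l by (metis Suc_pred mult_pos_pos)
  then show ?thesis using kv lw assms(3) by (simp add: funpow_Suc_right del: funpow.simps)
qed

lemma nx_funpow_inj: assumes "on_cycle G v" "on_cycle G w" "(nx ^^ k) v = (nx ^^ k) w" shows "v = w"
  using assms(3) by (induction k) (auto dest: nx_inj[OF on_cycle_funpow[OF assms(1)] on_cycle_funpow[OF assms(2)]])

lemma finite_orbit: assumes "on_cycle G v" shows "finite (range (\<lambda>k. (nx ^^ k) v))"
proof -
  obtain k where k: "k > 0" "(nx ^^ k) v = v" using on_cycle_step(4)[OF assms] by blast
  have "range (\<lambda>k. (nx ^^ k) v) \<subseteq> (\<lambda>j. (nx ^^ j) v) ` {..<k}"
  proof clarify
    fix m
    have "(nx ^^ m) v = (nx ^^ (m mod k)) v" using k(2) by (simp add: funpow_mod_eq)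
    then show "(nx ^^ m) v \<in> (\<lambda>j. (nx ^^ j) v) ` {..<k}" using k(1) by auto
  qed
  then show ?thesis by (rule finite_subset) simp
qed

section \<open>Finiteness of cycle-avoiding paths\<close>

definition transient :: "'e set" where
  "transient = {e \<in> edges G. \<not> on_cycle G (src G e)}"

text \<open>A descending chain is a backward chain of edges. The third graph condition excludes it
  if the edges are distinct; a repeated edge would close a walk and put its source on a cycle,
  against transience.\<close>

lemma wf_transient: "wf {(e', e). e' \<in> transient \<and> e \<in> transient \<and> src G e \<in> rng G e'}"
  unfolding wf_iff_no_infinite_down_chain
proof
  assume "\<exists>f. \<forall>i. (f (Suc i), f i) \<in> {(e', e). e' \<in> transient \<and> e \<in> transient \<and> src G e \<in> rng G e'}"
  then obtain f where f: "\<And>i. f i \<in> transient" "\<And>i. src G (f i) \<in> rng G (f (Suc i))" by auto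
  have "\<not> inj f" using B3 f unfolding no_infinite_backward_chains_def transient_def by auto
  then obtain i j where ij: "i < j" "f i = f j" unfolding inj_def by (metis nat_neq_iff)
  \<comment> \<open>The segment is reversed, since the chain runs against the edges: it goes from
    \<open>f j\<close> to \<open>f (Suc i)\<close>, and \<open>f i = f j\<close> closes it.\<close>
  define es where "es = map (\<lambda>m. f (j - m)) [0..<j - i]"
  have "is_path G es"
  proof -
    have "src G (f (j - Suc m)) \<in> rng G (f (j - m))" if "Suc m < j - i" for m
      using f(2)[of "j - Suc m"] that by (simp add: Suc_diff_Suc)
    then show ?thesis unfolding is_path_def es_def using ij f(1) by (auto simp: transient_def)
  qed
  moreover have "path_src G es = src G (f j)" "path_rng G es = rng G (f (Suc i))"
    unfolding path_src_def path_rng_def es_def using ij by (auto simp: hd_map last_map)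
  moreover have "src G (f j) \<in> rng G (f (Suc i))" using f(2)[of i] ij by simp
  ultimately have "on_cycle G (src G (f j))" using closed_walk_on_cycle[of G es] by simp
  then show False using f(1)[of j] unfolding transient_def by simp
qed

text \<open>Well-founded induction backwards along edges; the first graph condition leaves finitely
  many predecessors at each step, as in Koenig's lemma.\<close>

lemma finite_transient_paths_edge:
  "e \<in> transient \<Longrightarrow> finite {\<alpha>. is_path G \<alpha> \<and> set \<alpha> \<subseteq> transient \<and> last \<alpha> = e}"
proof (induction e rule: wf_induct_rule[OF wf_transient])
  case (1 e)
  let ?P = "\<lambda>e. {\<alpha>. is_path G \<alpha> \<and> set \<alpha> \<subseteq> transient \<and> last \<alpha> = e}"
  let ?E = "{e' \<in> transient. src G e \<in> rng G e'}"
  have "src G e \<in> verts G" using 1 edgeD unfolding transient_def by simp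
  then have "finite {e' \<in> edges G. src G e \<in> rng G e'}" using B1 unfolding no_infinite_receivers_def by simp
  then have fE: "finite ?E" by (rule rev_finite_subset) (auto simp: transient_def)
  have "?P e \<subseteq> insert [e] (\<Union>e'\<in>?E. (\<lambda>\<alpha>. \<alpha> @ [e]) ` ?P e')"
  proof
    fix \<alpha> assume a: "\<alpha> \<in> ?P e"
    then have ne: "\<alpha> \<noteq> []" by (auto simp: is_path_def)
    then have eq: "\<alpha> = butlast \<alpha> @ [e]" using a by (metis (mono_tags, lifting) append_butlast_last_id mem_Collect_eq)
    show "\<alpha> \<in> insert [e] (\<Union>e'\<in>?E. (\<lambda>\<alpha>. \<alpha> @ [e]) ` ?P e')"
    proof (cases "butlast \<alpha> = []")
      case True then show ?thesis using eq by simp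
    next
      case False
      then have b: "is_path G (butlast \<alpha>)" "src G e \<in> rng G (last (butlast \<alpha>))"
        using a eq is_path_append[OF False, of "[e]" G] by (metis (mono_tags, lifting) list.discI list.sel(1) mem_Collect_eq)+
      have s: "set (butlast \<alpha>) \<subseteq> transient" using a by (auto dest: in_set_butlastD)
      then have "last (butlast \<alpha>) \<in> ?E" using b False last_in_set by blast
      then show ?thesis using b s eq by blast
    qed
  qed
  moreover have "finite (insert [e] (\<Union>e'\<in>?E. (\<lambda>\<alpha>. \<alpha> @ [e]) ` ?P e'))"
    using fE 1 by (auto intro!: finite_UN_I)
  ultimately show ?case by (rule finite_subset)
qed

lemma finite_transient_paths:
  assumes "v \<in> verts G"
  shows "finite {\<alpha>. is_path G \<alpha> \<and> set \<alpha> \<subseteq> transient \<and> v \<in> path_rng G \<alpha>}"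
proof -
  let ?E = "{e \<in> transient. v \<in> rng G e}"
  have "finite {e \<in> edges G. v \<in> rng G e}" using B1 assms unfolding no_infinite_receivers_def by simp
  then have "finite ?E" by (rule rev_finite_subset) (auto simp: transient_def)
  then have "finite (\<Union>e\<in>?E. {\<alpha>. is_path G \<alpha> \<and> set \<alpha> \<subseteq> transient \<and> last \<alpha> = e})"
    using finite_transient_paths_edge by auto
  then show ?thesis
  proof (rule rev_finite_subset, intro subsetI)
    fix \<alpha> assume a: "\<alpha> \<in> {\<alpha>. is_path G \<alpha> \<and> set \<alpha> \<subseteq> transient \<and> v \<in> path_rng G \<alpha>}"
    then have "last \<alpha> \<in> set \<alpha>" by (simp add: is_path_def)
    then show "\<alpha> \<in> (\<Union>e\<in>?E. {\<alpha>. is_path G \<alpha> \<and> set \<alpha> \<subseteq> transient \<and> last \<alpha> = e})"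
      using a by (auto simp: path_rng_def)
  qed
qed

section \<open>Terminal boundary sets as points of the lattice\<close>

lemma terminal_set_gen: assumes "X \<in> terminal_sets G" shows "X \<in> gen_verts G"
  using assms unfolding terminal_sets_def minimal_infinite_emitter_def minimal_sink_def is_sink_def
  by (auto intro: gen_verts.vertex)

text \<open>If two proper parts covered \<open>X\<close>, minimality would make both of them finite
  or finitely emitting, hence \<open>X\<close> too. Thus \<open>X \<subseteq> B\<close> is a lattice
  character in \<open>B\<close>, as needed for the value of \<open>p B\<close> at an empty path. By
  the last clause the relation at a regular vertex imposes nothing there.\<close>

lemma terminal_set_prime:
  assumes X: "X \<in> terminal_sets G"
  shows "X \<noteq> {}" "\<And>B C. B \<in> gen_verts G \<Longrightarrow> C \<in> gen_verts G \<Longrightarrow> X \<subseteq> B \<union> C \<Longrightarrow> X \<subseteq> B \<or> X \<subseteq> C"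
    "is_regular G v \<Longrightarrow> \<not> X \<subseteq> {v}"
proof -
  have Xg: "X \<in> gen_verts G" by (rule terminal_set_gen[OF X])
  from X consider (mie) "minimal_infinite_emitter G X" | (ms) "minimal_sink G X" | (s) w where "X = {w}" "is_sink G w"
    unfolding terminal_sets_def by blast
  note cases = this
  show "X \<noteq> {}" using cases
    by cases (auto simp: minimal_infinite_emitter_def minimal_sink_def emitted_def)
  show "\<not> X \<subseteq> {v}" if v: "is_regular G v"
  proof
    assume sub: "X \<subseteq> {v}"
    have fin: "finite (emitted G X)" "finite X" using v emitted_mono[OF sub, of G] sub finite_subset unfolding is_regular_def by auto
    show False using cases
    proof cases
      case (s w)
      then show ?thesis using sub v by (auto simp: is_sink_def is_regular_def)
    qed (use fin in \<open>auto simp: minimal_infinite_emitter_def minimal_sink_def\<close>)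
  qed
  fix B C assume BC: "B \<in> gen_verts G" "C \<in> gen_verts G" and sub: "X \<subseteq> B \<union> C"
  have eq: "X = (X \<inter> B) \<union> (X \<inter> C)" using sub by blast
  have g: "X \<inter> B \<in> gen_verts G" "X \<inter> C \<in> gen_verts G" using Xg BC by (auto intro: gen_verts.inter)
  show "X \<subseteq> B \<or> X \<subseteq> C" using cases
  proof cases
    case mie
    have "infinite (emitted G (X \<inter> B) \<union> emitted G (X \<inter> C))"
      using mie eq emitted_Un[of G "X \<inter> B" "X \<inter> C"] unfolding minimal_infinite_emitter_def by simp
    then have "infinite (emitted G (X \<inter> B)) \<or> infinite (emitted G (X \<inter> C))" by simp
    moreover have "finite (emitted G Y)" if "Y \<in> gen_verts G" "Y \<subset> X" for Y
      using mie that unfolding minimal_infinite_emitter_def by auto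
    ultimately have "\<not> X \<inter> B \<subset> X \<or> \<not> X \<inter> C \<subset> X" using g by auto
    then show ?thesis by auto
  next
    case ms
    have "infinite ((X \<inter> B) \<union> (X \<inter> C))" using ms eq unfolding minimal_sink_def by simp
    then have "infinite (X \<inter> B) \<or> infinite (X \<inter> C)" by simp
    moreover have "finite Y" if "Y \<in> gen_verts G" "Y \<subset> X" for Y
      using ms that unfolding minimal_sink_def by auto
    ultimately have "\<not> X \<inter> B \<subset> X \<or> \<not> X \<inter> C \<subset> X" using g by auto
    then show ?thesis by auto
  next
    case s
    then show ?thesis using sub by auto
  qed
qed

lemma on_cycle_regular: "on_cycle G v \<Longrightarrow> is_regular G v"
  unfolding is_regular_def using on_cycle_step(1)[of v] on_cycle_verts[of v] by simp

end

section \<open>Representations on boundary paths\<close>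

type_synonym 'e state = "nat \<Rightarrow> 'e option"

definition cons_state :: "'e \<Rightarrow> 'e state \<Rightarrow> 'e state" where
  "cons_state e \<omega> = case_nat (Some e) \<omega>"

lemma cons_state_simps [simp]: "cons_state e \<omega> 0 = Some e" "cons_state e \<omega> \<circ> Suc = \<omega>" "cons_state e \<omega> (Suc i) = \<omega> i"
  by (auto simp: cons_state_def)

lemma cons_state_eq_iff [simp]: "cons_state e \<omega> = cons_state f \<omega>' \<longleftrightarrow> e = f \<and> \<omega> = \<omega>'"
  by (metis cons_state_simps(1,2) option.inject)

lemma cons_state_tail: "\<omega> 0 = Some e \<Longrightarrow> cons_state e (\<omega> \<circ> Suc) = \<omega>"
  by (rule ext) (auto simp: cons_state_def split: nat.split)

text \<open>A state is a boundary path: an infinite path, or a finite one padded with \<open>None\<close>, which then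
  ends in the terminal boundary set \<open>X\<close>. The lattice character \<open>state_in G X \<omega>\<close> tells which
  sets contain the source of \<open>\<omega>\<close>; the empty path has source \<open>X\<close>.\<close>

definition state_in :: "('v, 'e) ultragraph \<Rightarrow> 'v set \<Rightarrow> 'e state \<Rightarrow> 'v set \<Rightarrow> bool" where
  "state_in G X \<omega> B = (case \<omega> 0 of None \<Rightarrow> X \<subseteq> B | Some e \<Rightarrow> src G e \<in> B)"

lemma state_in_cons [simp]: "state_in G X (cons_state e \<omega>) B \<longleftrightarrow> src G e \<in> B"
  by (simp add: state_in_def)

lemma state_in_mono: "state_in G X \<omega> B \<Longrightarrow> B \<subseteq> C \<Longrightarrow> state_in G X \<omega> C"
  by (auto simp: state_in_def split: option.splits)

text \<open>Removing the first edge must stay inside \<open>\<Omega>\<close> for the range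
  projection of \<open>s e\<close> to consist of all states beginning with \<open>e\<close>;
  prepending must stay inside for the source projection to be that of \<open>rng G e\<close>. The
  demands on \<open>X\<close> apply only if an empty path occurs, which permits
  \<open>X = {}\<close> for purely infinite paths.\<close>

definition state_space :: "('v, 'e) ultragraph \<Rightarrow> 'v set \<Rightarrow> 'e state set \<Rightarrow> bool" where
  "state_space G X \<Omega> \<longleftrightarrow> finite \<Omega> \<and>
     (\<forall>\<omega>\<in>\<Omega>. \<forall>e. \<omega> 0 = Some e \<longrightarrow> e \<in> edges G \<and> \<omega> \<circ> Suc \<in> \<Omega> \<and> state_in G X (\<omega> \<circ> Suc) (rng G e)) \<and>
     (\<forall>\<omega>\<in>\<Omega>. \<forall>e\<in>edges G. state_in G X \<omega> (rng G e) \<longrightarrow> cons_state e \<omega> \<in> \<Omega>) \<and>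
     (\<forall>\<omega>\<in>\<Omega>. \<omega> 0 = None \<longrightarrow> X \<noteq> {} \<and> (\<forall>v. is_regular G v \<longrightarrow> \<not> X \<subseteq> {v}) \<and>
        (\<forall>B\<in>gen_verts G. \<forall>C\<in>gen_verts G. X \<subseteq> B \<union> C \<longrightarrow> X \<subseteq> B \<or> X \<subseteq> C))"

definition diag_proj :: "nat \<Rightarrow> (nat \<Rightarrow> bool) \<Rightarrow> complex mat" where
  "diag_proj n P = mat n n (\<lambda>(i,j). if i = j \<and> P i then 1 else 0)"

lemma diag_proj_closed [simp]: "diag_proj n P \<in> carrier_mat n n"
  by (simp add: diag_proj_def)

lemma diag_proj_mult: "diag_proj n P * diag_proj n Q = diag_proj n (\<lambda>i. P i \<and> Q i)"
proof (intro eq_matI)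
  fix i j assume ij: "i < dim_row (diag_proj n (\<lambda>i. P i \<and> Q i))" "j < dim_col (diag_proj n (\<lambda>i. P i \<and> Q i))"
  then have ij': "i < n" "j < n" by (auto simp: diag_proj_def)
  have "(diag_proj n P * diag_proj n Q) $$ (i,j)
      = (\<Sum>k<n. (if i = k \<and> P i then 1 else 0) * (if k = j \<and> Q k then 1 else 0))"
    using ij' by (simp add: diag_proj_def scalar_prod_def lessThan_atLeast0)
  also have "\<dots> = (\<Sum>k<n. if k = i then (if i = j \<and> P i \<and> Q i then 1 else 0) else 0)"
    by (intro sum.cong) auto
  also have "\<dots> = diag_proj n (\<lambda>i. P i \<and> Q i) $$ (i,j)" using ij' by (simp add: diag_proj_def)
  finally show "(diag_proj n P * diag_proj n Q) $$ (i,j) = diag_proj n (\<lambda>i. P i \<and> Q i) $$ (i,j)" .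
qed (auto simp: diag_proj_def)

lemma diag_proj_adjoint: "mat_adjoint (diag_proj n P) = diag_proj n P"
  by (intro eq_matI) (auto simp: diag_proj_def)

lemma diag_proj_cong: "(\<And>i. i < n \<Longrightarrow> P i = Q i) \<Longrightarrow> diag_proj n P = diag_proj n Q"
  by (intro eq_matI) (auto simp: diag_proj_def)

lemma finsum_mat_cstar_index:
  assumes "finite I" "\<And>i. i \<in> I \<Longrightarrow> f i \<in> carrier_mat n n" "a < n" "b < n"
  shows "finsum (mat_cstar n) f I $$ (a,b) = (\<Sum>i\<in>I. f i $$ (a,b))"
  using assms(1,2)
proof (induction I rule: finite_induct)
  interpret abelian_group "mat_cstar n" by (rule abelian_group_mat_cstar)
  {
    case empty then show ?case using assms by simp
  next
    case (insert i I)
    then have "f \<in> I \<rightarrow> carrier (mat_cstar n)" "f i \<in> carrier (mat_cstar n)" by auto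
    moreover from this have "finsum (mat_cstar n) f I \<in> carrier_mat n n" using finsum_closed by fastforce
    ultimately show ?case using insert assms(3,4) by (simp add: finsum_insert)
  }
qed

text \<open>An edge acts by prepending itself, times a unimodular \<open>z\<close>. The scalar
  cancels in every relation; later it is varied on the circle to detect degrees.\<close>

lemma ultragraph_family_states:
  assumes G: "is_ultragraph G" and \<Omega>: "state_space G X \<Omega>" and w: "bij_betw w {..<n} \<Omega>" and z: "cmod z = 1"
  shows "ultragraph_family G (mat_cstar n)
    (\<lambda>B. diag_proj n (\<lambda>i. state_in G X (w i) B))
    (\<lambda>e. mat n n (\<lambda>(i,j). if w i = cons_state e (w j) \<and> state_in G X (w j) (rng G e) then z else 0))"
    (is "ultragraph_family G _ ?q ?t")
proof -
  have zz: "z * cnj z = 1" "cnj z * z = 1" using z by (simp_all add: complex_norm_square[symmetric] mult.commute)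
  have tc: "?t e \<in> carrier_mat n n" for e by simp
  have inj: "w i = w j \<longleftrightarrow> i = j" if "i < n" "j < n" for i j
    using w that unfolding bij_betw_def inj_on_def by auto
  have w\<Omega>: "w i \<in> \<Omega>" if "i < n" for i using w that unfolding bij_betw_def by auto
  have surj: "\<exists>i<n. w i = \<omega>" if "\<omega> \<in> \<Omega>" for \<omega>
    using w that unfolding bij_betw_def by (metis imageE lessThan_iff)
  have tail: "e \<in> edges G" "w i \<circ> Suc \<in> \<Omega>" "state_in G X (w i \<circ> Suc) (rng G e)" if "i < n" "w i 0 = Some e" for i e
    using \<Omega> w\<Omega>[OF that(1)] that(2) unfolding state_space_def by auto
  have cons: "cons_state e (w j) \<in> \<Omega>" if "j < n" "e \<in> edges G" "state_in G X (w j) (rng G e)" for e j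
    using \<Omega> w\<Omega>[OF that(1)] that(2,3) unfolding state_space_def by auto
  have ranges: "?t e * mat_adjoint (?t e) = diag_proj n (\<lambda>i. w i 0 = Some e)" if e: "e \<in> edges G" for e
  proof (intro eq_matI)
    fix i j assume "i < dim_row (diag_proj n (\<lambda>i. w i 0 = Some e))" "j < dim_col (diag_proj n (\<lambda>i. w i 0 = Some e))"
    then have ij: "i < n" "j < n" by (auto simp: diag_proj_def)
    let ?b = "\<lambda>i k. w i = cons_state e (w k) \<and> state_in G X (w k) (rng G e)"
    have "(?t e * mat_adjoint (?t e)) $$ (i,j) = (\<Sum>k<n. (if ?b i k then z else 0) * cnj (if ?b j k then z else 0))"
      using ij by (simp add: scalar_prod_def lessThan_atLeast0)
    also have "\<dots> = (if i = j \<and> w i 0 = Some e then 1 else 0)"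
    proof (cases "w i 0 = Some e")
      case True
      \<comment> \<open>Only the index \<open>m\<close> of the tail of \<open>w i\<close>
        contributes to the sum.\<close>
      obtain m where m: "m < n" "w m = w i \<circ> Suc" using surj tail(2)[OF ij(1) True] by blast
      have wi: "w i = cons_state e (w m)" unfolding m(2) using cons_state_tail[of "w i", OF True] by simp
      have bi: "?b i k \<longleftrightarrow> k = m" if "k < n" for k
        using wi inj[OF that m(1)] tail(3)[OF ij(1) True] m by auto
      have "(\<Sum>k<n. (if ?b i k then z else 0) * cnj (if ?b j k then z else 0)) = (\<Sum>k<n. if k = m then (if ?b j m then 1 else 0) else 0)"
        by (intro sum.cong refl) (use bi zz in auto)
      also have "\<dots> = (if ?b j m then 1 else 0)" using m(1) by simp
      also have "?b j m \<longleftrightarrow> i = j" using bi[OF m(1)] wi inj[OF ij] by auto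
      finally show ?thesis using True by simp
    next
      case False
      then have "\<not> ?b i k" for k by (metis cons_state_simps(1))
      then show ?thesis using False by simp
    qed
    finally show "(?t e * mat_adjoint (?t e)) $$ (i,j) = diag_proj n (\<lambda>i. w i 0 = Some e) $$ (i,j)"
      using ij by (simp add: diag_proj_def)
  qed (auto simp: diag_proj_def)
  have sources: "mat_adjoint (?t e) * ?t e = ?q (rng G e)" if e: "e \<in> edges G" for e
  proof (intro eq_matI)
    fix i j assume "i < dim_row (?q (rng G e))" "j < dim_col (?q (rng G e))"
    then have ij: "i < n" "j < n" by (auto simp: diag_proj_def)
    let ?b = "\<lambda>k i. w k = cons_state e (w i) \<and> state_in G X (w i) (rng G e)"
    have "(mat_adjoint (?t e) * ?t e) $$ (i,j) = (\<Sum>k<n. cnj (if ?b k i then z else 0) * (if ?b k j then z else 0))"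
      using ij by (simp add: scalar_prod_def lessThan_atLeast0)
    also have "\<dots> = (if i = j \<and> state_in G X (w i) (rng G e) then 1 else 0)"
    proof (cases "state_in G X (w i) (rng G e)")
      case True
      obtain m where m: "m < n" "w m = cons_state e (w i)" using surj cons[OF ij(1) e True] by blast
      have bi: "?b k i \<longleftrightarrow> k = m" if "k < n" for k using m inj[OF that m(1)] True by auto
      have "(\<Sum>k<n. cnj (if ?b k i then z else 0) * (if ?b k j then z else 0)) = (\<Sum>k<n. if k = m then (if ?b m j then 1 else 0) else 0)"
        by (intro sum.cong refl) (use bi zz in auto)
      also have "\<dots> = (if ?b m j then 1 else 0)" using m(1) by simp
      also have "?b m j \<longleftrightarrow> i = j" using m(2) inj[OF ij] True by auto
      finally show ?thesis using True by simp
    qed simp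
    finally show "(mat_adjoint (?t e) * ?t e) $$ (i,j) = ?q (rng G e) $$ (i,j)"
      using ij by (simp add: diag_proj_def)
  qed (auto simp: diag_proj_def)
  have inter: "state_in G X \<omega> B \<and> state_in G X \<omega> C \<longleftrightarrow> state_in G X \<omega> (B \<inter> C)" for \<omega> B C
    by (auto simp: state_in_def split: option.splits)
  \<comment> \<open>At an empty path, additivity over unions is exactly the primeness of
    \<open>X\<close>.\<close>
  have union: "state_in G X (w i) (B \<union> C) \<longleftrightarrow> state_in G X (w i) B \<or> state_in G X (w i) C"
    if "i < n" "B \<in> gen_verts G" "C \<in> gen_verts G" for i B C
  proof (cases "w i 0")
    case None
    then have "X \<subseteq> B \<union> C \<longrightarrow> X \<subseteq> B \<or> X \<subseteq> C"
      using \<Omega> w\<Omega>[OF that(1)] that(2,3) unfolding state_space_def by blast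
    then show ?thesis using None unfolding state_in_def by auto
  qed (simp add: state_in_def)
  have empty: "\<not> state_in G X (w i) {}" if "i < n" for i
    using \<Omega> w\<Omega>[OF that(1)] unfolding state_space_def state_in_def by (auto split: option.splits)
  have absorb: "?t e * ?q (rng G e) = ?t e" for e
  proof (intro eq_matI)
    fix i j assume "i < dim_row (?t e)" "j < dim_col (?t e)"
    then have ij: "i < n" "j < n" by auto
    have "(?t e * ?q (rng G e)) $$ (i,j) =
        (\<Sum>k<n. ?t e $$ (i,k) * (if k = j \<and> state_in G X (w k) (rng G e) then 1 else 0))"
      using ij by (simp add: scalar_prod_def lessThan_atLeast0 diag_proj_def)
    also have "\<dots> = (\<Sum>k<n. if k = j then ?t e $$ (i,j) else 0)"
      using ij by (intro sum.cong) auto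
    finally show "(?t e * ?q (rng G e)) $$ (i,j) = ?t e $$ (i,j)" using ij by simp
  qed (auto simp: diag_proj_def)
  have regular: "?q {v} = finsum (mat_cstar n) (\<lambda>e. ?t e \<otimes>\<^bsub>mat_cstar n\<^esub> star (mat_cstar n) (?t e)) (emitted G {v})"
    if v: "is_regular G v" for v
  proof -
    interpret M: abelian_group "mat_cstar n" by (rule abelian_group_mat_cstar)
    have fin: "finite (emitted G {v})" and sub: "emitted G {v} \<subseteq> edges G" using v unfolding is_regular_def emitted_def by auto
    have "finsum (mat_cstar n) (\<lambda>e. ?t e \<otimes>\<^bsub>mat_cstar n\<^esub> star (mat_cstar n) (?t e)) (emitted G {v})
      = finsum (mat_cstar n) (\<lambda>e. diag_proj n (\<lambda>i. w i 0 = Some e)) (emitted G {v})"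
      using sub ranges by (intro M.finsum_cong') auto
    also have "\<dots> = ?q {v}"
    proof (intro eq_matI)
      fix i j assume "i < dim_row (?q {v})" "j < dim_col (?q {v})"
      then have ij: "i < n" "j < n" by (auto simp: diag_proj_def)
      have "finsum (mat_cstar n) (\<lambda>e. diag_proj n (\<lambda>i. w i 0 = Some e)) (emitted G {v}) $$ (i,j)
        = (\<Sum>e\<in>emitted G {v}. if w i 0 = Some e then if i = j then 1 else 0 else 0)"
        using ij fin by (subst finsum_mat_cstar_index) (auto simp: diag_proj_def intro!: sum.cong)
      also have "\<dots> = (if i = j \<and> state_in G X (w i) {v} then 1 else 0)"
      proof (cases "w i 0")
        \<comment> \<open>Both sides vanish at an empty path: the sum because no edge comes first,
          the other side because \<open>X\<close> is not contained in \<open>{v}\<close>.\<close>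
        case None
        then show ?thesis using \<Omega> w\<Omega>[OF ij(1)] v unfolding state_space_def state_in_def by auto
      next
        case (Some e)
        then have "e \<in> edges G" using tail(1)[OF ij(1)] by simp
        then have "e \<in> emitted G {v} \<longleftrightarrow> state_in G X (w i) {v}" unfolding state_in_def emitted_def using Some by auto
        then show ?thesis using Some fin by (simp add: sum.delta')
      qed
      finally show "finsum (mat_cstar n) (\<lambda>e. diag_proj n (\<lambda>i. w i 0 = Some e)) (emitted G {v}) $$ (i,j) = ?q {v} $$ (i,j)"
        using ij by (simp add: diag_proj_def)
    next
      have "finsum (mat_cstar n) (\<lambda>e. diag_proj n (\<lambda>i. w i 0 = Some e)) (emitted G {v}) \<in> carrier (mat_cstar n)"
        by (rule M.finsum_closed) auto
      then show "dim_row (finsum (mat_cstar n) (\<lambda>e. diag_proj n (\<lambda>i. w i 0 = Some e)) (emitted G {v})) = dim_row (?q {v})"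
        "dim_col (finsum (mat_cstar n) (\<lambda>e. diag_proj n (\<lambda>i. w i 0 = Some e)) (emitted G {v})) = dim_col (?q {v})"
        by (auto simp: diag_proj_def)
    qed
    finally show ?thesis by simp
  qed
  show ?thesis
    unfolding ultragraph_family_def projection_def partial_isometry_def proj_le_def
  proof (intro conjI ballI allI impI)
    fix B assume B: "B \<in> gen_verts G"
    show "?q B \<in> carrier (mat_cstar n)" "star (mat_cstar n) (?q B) = ?q B" "?q B \<otimes>\<^bsub>mat_cstar n\<^esub> ?q B = ?q B"
      by (simp_all add: diag_proj_adjoint diag_proj_mult)
    fix C assume C: "C \<in> gen_verts G"
    show "?q B \<otimes>\<^bsub>mat_cstar n\<^esub> ?q C = ?q (B \<inter> C)" by (simp add: diag_proj_mult inter)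
    have "?q (B \<union> C) = ?q B + ?q C - ?q (B \<inter> C)"
      by (intro eq_matI) (auto simp: diag_proj_def union[OF _ B C] inter[symmetric])
    then show "?q (B \<union> C) = ?q B \<oplus>\<^bsub>mat_cstar n\<^esub> ?q C \<ominus>\<^bsub>mat_cstar n\<^esub> ?q (B \<inter> C)"
      by (simp add: a_minus_mat_cstar)
  next
    fix e assume e: "e \<in> edges G"
    show "?t e \<in> carrier (mat_cstar n)" by simp
    have "?t e * mat_adjoint (?t e) * ?t e = ?t e * (mat_adjoint (?t e) * ?t e)"
      by (rule assoc_mult_mat[of _ n n _ n _ n]) auto
    then show "?t e \<otimes>\<^bsub>mat_cstar n\<^esub> star (mat_cstar n) (?t e) \<otimes>\<^bsub>mat_cstar n\<^esub> ?t e = ?t e"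
      using sources[OF e] absorb[of e] by simp
    show "star (mat_cstar n) (?t e) \<otimes>\<^bsub>mat_cstar n\<^esub> ?t e = ?q (rng G e)" using sources[OF e] by simp
    have "diag_proj n (\<lambda>i. w i 0 = Some e) = ?q {src G e} * diag_proj n (\<lambda>i. w i 0 = Some e)"
      unfolding diag_proj_mult by (rule diag_proj_cong) (auto simp: state_in_def)
    then show "?t e \<otimes>\<^bsub>mat_cstar n\<^esub> star (mat_cstar n) (?t e) =
        ?q {src G e} \<otimes>\<^bsub>mat_cstar n\<^esub> (?t e \<otimes>\<^bsub>mat_cstar n\<^esub> star (mat_cstar n) (?t e))"
      using ranges[OF e] by simp
    fix f assume f: "f \<in> edges G" and ef: "e \<noteq> f"
    have "diag_proj n (\<lambda>i. w i 0 = Some e) * diag_proj n (\<lambda>i. w i 0 = Some f) = 0\<^sub>m n n"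
      unfolding diag_proj_mult using ef by (intro eq_matI) (auto simp: diag_proj_def)
    then show "?t e \<otimes>\<^bsub>mat_cstar n\<^esub> star (mat_cstar n) (?t e) \<otimes>\<^bsub>mat_cstar n\<^esub>
        (?t f \<otimes>\<^bsub>mat_cstar n\<^esub> star (mat_cstar n) (?t f)) = \<zero>\<^bsub>mat_cstar n\<^esub>"
      using ranges[OF e] ranges[OF f] by simp
  next
    have "?q {} = 0\<^sub>m n n" by (intro eq_matI) (auto simp: diag_proj_def empty)
    then show "?q {} = \<zero>\<^bsub>mat_cstar n\<^esub>" by simp
  qed (rule regular)
qed

text \<open>Entries are addressed by states instead of positions. The bound
  \<open>sqrt (card \<Omega>)\<close> does not involve \<open>z\<close>, which later gives one
  constant for the whole circle.\<close>

lemma state_representation: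
  fixes A :: "'a cstar"
  assumes G: "is_ultragraph G" and alg: "is_ultragraph_algebra G A p s"
    and \<Omega>: "state_space G X \<Omega>" and z: "cmod z = 1"
  obtains M :: "'a \<Rightarrow> 'e state \<Rightarrow> 'e state \<Rightarrow> complex" where
    "\<And>\<omega> \<omega>'. \<omega> \<in> \<Omega> \<Longrightarrow> \<omega>' \<in> \<Omega> \<Longrightarrow> fd_functional A (sqrt (card \<Omega>)) (\<lambda>x. M x \<omega> \<omega>')"
    "\<And>x y \<omega> \<omega>'. x \<in> carrier A \<Longrightarrow> y \<in> carrier A \<Longrightarrow> \<omega> \<in> \<Omega> \<Longrightarrow> \<omega>' \<in> \<Omega> \<Longrightarrow>
       M (x \<otimes>\<^bsub>A\<^esub> y) \<omega> \<omega>' = (\<Sum>\<kappa>\<in>\<Omega>. M x \<omega> \<kappa> * M y \<kappa> \<omega>')"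
    "\<And>x \<omega> \<omega>'. x \<in> carrier A \<Longrightarrow> \<omega> \<in> \<Omega> \<Longrightarrow> \<omega>' \<in> \<Omega> \<Longrightarrow> M (star A x) \<omega> \<omega>' = cnj (M x \<omega>' \<omega>)"
    "\<And>B \<omega> \<omega>'. B \<in> gen_verts G \<Longrightarrow> \<omega> \<in> \<Omega> \<Longrightarrow> \<omega>' \<in> \<Omega> \<Longrightarrow>
       M (p B) \<omega> \<omega>' = (if \<omega> = \<omega>' \<and> state_in G X \<omega> B then 1 else 0)"
    "\<And>e \<omega> \<omega>'. e \<in> edges G \<Longrightarrow> \<omega> \<in> \<Omega> \<Longrightarrow> \<omega>' \<in> \<Omega> \<Longrightarrow>
       M (s e) \<omega> \<omega>' = (if \<omega> = cons_state e \<omega>' \<and> state_in G X \<omega>' (rng G e) then z else 0)"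
proof -
  interpret cstar_algebra A using alg unfolding is_ultragraph_algebra_def by simp
  have "finite \<Omega>" using \<Omega> unfolding state_space_def by simp
  define n where "n = card \<Omega>"
  obtain w where w: "bij_betw w {..<n} \<Omega>"
    using ex_bij_betw_nat_finite[OF \<open>finite \<Omega>\<close>] unfolding n_def lessThan_atLeast0 by blast
  obtain \<pi> where rep: "fin_dim_rep A n \<pi>"
    and \<pi>p: "\<And>B. B \<in> gen_verts G \<Longrightarrow> \<pi> (p B) = diag_proj n (\<lambda>i. state_in G X (w i) B)"
    and \<pi>s: "\<And>e. e \<in> edges G \<Longrightarrow> \<pi> (s e) = mat n n (\<lambda>(i,j). if w i = cons_state e (w j) \<and> state_in G X (w j) (rng G e) then z else 0)"
    using fin_dim_rep_of_family[OF G alg ultragraph_family_states[OF G \<Omega> w z]] by blast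
  define ix where "ix = inv_into {..<n} w"
  have ix: "ix \<omega> < n" "w (ix \<omega>) = \<omega>" if "\<omega> \<in> \<Omega>" for \<omega>
    using w that inv_into_into[of \<omega> w "{..<n}"] unfolding ix_def bij_betw_def by (auto simp: f_inv_into_f)
  have wi: "ix (w i) = i" if "i < n" for i
    using w that unfolding ix_def bij_betw_def by simp
  have dims: "dim_row (\<pi> x) = n" "dim_col (\<pi> x) = n" if "x \<in> carrier A" for x
    using fin_dim_repD(1)[OF rep that] by auto
  show thesis
  proof (rule that[of "\<lambda>x \<omega> \<omega>'. \<pi> x $$ (ix \<omega>, ix \<omega>')"], goal_cases)
    case (1 \<omega> \<omega>')
    then show ?case using fd_functional_entry[OF rep] ix unfolding n_def by simp
  next
    case (2 x y \<omega> \<omega>')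
    have "\<pi> (x \<otimes>\<^bsub>A\<^esub> y) $$ (ix \<omega>, ix \<omega>') = (\<Sum>k<n. \<pi> x $$ (ix \<omega>, k) * \<pi> y $$ (k, ix \<omega>'))"
      using 2 ix dims by (simp add: fin_dim_repD[OF rep] scalar_prod_def lessThan_atLeast0)
    also have "\<dots> = (\<Sum>k<n. \<pi> x $$ (ix \<omega>, ix (w k)) * \<pi> y $$ (ix (w k), ix \<omega>'))"
      by (intro sum.cong) (auto simp: wi)
    also have "\<dots> = (\<Sum>\<kappa>\<in>\<Omega>. \<pi> x $$ (ix \<omega>, ix \<kappa>) * \<pi> y $$ (ix \<kappa>, ix \<omega>'))"
      by (rule sum.reindex_bij_betw[OF w])
    finally show ?case .
  next
    case (3 x \<omega> \<omega>')
    then show ?case using ix dims by (simp add: fin_dim_repD[OF rep])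
  next
    case (4 B \<omega> \<omega>')
    then have "ix \<omega> = ix \<omega>' \<longleftrightarrow> \<omega> = \<omega>'" using ix(2) by metis
    then show ?case using 4 ix by (simp add: \<pi>p diag_proj_def)
  next
    case (5 e \<omega> \<omega>')
    then show ?case using ix by (simp add: \<pi>s)
  qed
qed

section \<open>Existence of boundary paths\<close>

inductive_set ext_states :: "('v, 'e) ultragraph \<Rightarrow> 'v set \<Rightarrow> 'e state set \<Rightarrow> 'e state set"
  for G :: "('v, 'e) ultragraph" and X :: "'v set" and Base :: "'e state set" where
  base: "\<omega> \<in> Base \<Longrightarrow> \<omega> \<in> ext_states G X Base"
| cons: "\<omega> \<in> ext_states G X Base \<Longrightarrow> e \<in> edges G \<Longrightarrow> state_in G X \<omega> (rng G e) \<Longrightarrow>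
    cons_state e \<omega> \<in> ext_states G X Base"

context rfd_ultragraph
begin

text \<open>Finiteness is the point. A state is a cycle-avoiding path in front of a base state: a
  cycle edge can only precede a base state, and \<open>recur\<close> keeps the result in the base.
  By \<open>point\<close>, the paths in front of one base state share a vertex in their ranges, so
  there are finitely many.\<close>

lemma state_space_ext_states:
  assumes fin: "finite Base"
    and tail: "\<And>\<omega> e. \<omega> \<in> Base \<Longrightarrow> \<omega> 0 = Some e \<Longrightarrow> e \<in> edges G \<and> \<omega> \<circ> Suc \<in> Base \<and> state_in G X (\<omega> \<circ> Suc) (rng G e)"
    and none: "\<And>\<omega>. \<omega> \<in> Base \<Longrightarrow> \<omega> 0 = None \<Longrightarrow> X \<noteq> {} \<and> (\<forall>v. is_regular G v \<longrightarrow> \<not> X \<subseteq> {v}) \<and>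
        (\<forall>B\<in>gen_verts G. \<forall>C\<in>gen_verts G. X \<subseteq> B \<union> C \<longrightarrow> X \<subseteq> B \<or> X \<subseteq> C)"
    and point: "\<And>\<omega>. \<omega> \<in> Base \<Longrightarrow> \<exists>v\<in>verts G. \<forall>B. state_in G X \<omega> B \<longrightarrow> v \<in> B"
    and recur: "\<And>\<omega> e. \<omega> \<in> Base \<Longrightarrow> e \<in> edges G \<Longrightarrow> on_cycle G (src G e) \<Longrightarrow> state_in G X \<omega> (rng G e) \<Longrightarrow> cons_state e \<omega> \<in> Base"
  shows "state_space G X (ext_states G X Base)"
proof -
  let ?S = "\<lambda>\<omega>. {\<alpha>. is_path G \<alpha> \<and> set \<alpha> \<subseteq> transient \<and> state_in G X \<omega> (path_rng G \<alpha>)}"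
  have S: "\<exists>\<alpha> \<omega>0. \<omega>0 \<in> Base \<and> \<omega> = foldr cons_state \<alpha> \<omega>0 \<and> (\<alpha> = [] \<or> \<alpha> \<in> ?S \<omega>0)"
    if "\<omega> \<in> ext_states G X Base" for \<omega>
    using that
  proof induction
    case (base \<omega>)
    then show ?case by (intro exI[of _ "[]"] exI[of _ \<omega>]) simp
  next
    case (cons \<omega> e)
    then obtain \<alpha> \<omega>0 where a: "\<omega>0 \<in> Base" "\<omega> = foldr cons_state \<alpha> \<omega>0" "\<alpha> = [] \<or> \<alpha> \<in> ?S \<omega>0" by blast
    show ?case
    proof (cases "on_cycle G (src G e)")
      case True
      \<comment> \<open>The range of a cycle edge is a single cycle vertex, and no transient edge
        starts there.\<close>
      have "\<alpha> = []"
      proof (rule ccontr)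
        assume "\<alpha> \<noteq> []"
        then obtain f \<alpha>' where f: "\<alpha> = f # \<alpha>'" by (cases \<alpha>) auto
        then have "src G f \<in> rng G e" using a cons by simp
        then have "on_cycle G (src G f)" using on_cycle_edge(2)[OF cons(2) True] on_cycle_step(3)[OF True] by simp
        then show False using a(3) f unfolding transient_def by simp
      qed
      then show ?thesis using a recur[OF a(1) cons(2) True] cons(3)
        by (intro exI[of _ "[]"] exI[of _ "cons_state e \<omega>"]) simp
    next
      case False
      then have e: "e \<in> transient" using cons(2) unfolding transient_def by simp
      have "e # \<alpha> \<in> ?S \<omega>0"
      proof (cases \<alpha>)
        case Nil then show ?thesis using a cons e by (simp add: is_path_def path_rng_def)
      next
        case (Cons f \<alpha>')
        then show ?thesis using a cons e by (simp add: is_path_Cons[of G e] path_rng_def)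
      qed
      then show ?thesis using a by (intro exI[of _ "e # \<alpha>"] exI[of _ \<omega>0]) simp
    qed
  qed
  have "finite (?S \<omega>0)" if \<omega>0: "\<omega>0 \<in> Base" for \<omega>0
  proof -
    obtain v where v: "v \<in> verts G" "\<And>B. state_in G X \<omega>0 B \<Longrightarrow> v \<in> B" using point[OF \<omega>0] by blast
    show ?thesis by (rule finite_subset[OF _ finite_transient_paths[OF v(1)]]) (use v(2) in auto)
  qed
  then have "finite (\<Union>\<omega>0\<in>Base. (\<lambda>\<alpha>. foldr cons_state \<alpha> \<omega>0) ` (insert [] (?S \<omega>0)))" using fin by simp
  moreover have "ext_states G X Base \<subseteq> (\<Union>\<omega>0\<in>Base. (\<lambda>\<alpha>. foldr cons_state \<alpha> \<omega>0) ` (insert [] (?S \<omega>0)))"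
  proof
    fix \<omega> assume "\<omega> \<in> ext_states G X Base"
    then obtain \<alpha> \<omega>0 where "\<omega>0 \<in> Base" "\<omega> = foldr cons_state \<alpha> \<omega>0" "\<alpha> = [] \<or> \<alpha> \<in> ?S \<omega>0" using S by blast
    then show "\<omega> \<in> (\<Union>\<omega>0\<in>Base. (\<lambda>\<alpha>. foldr cons_state \<alpha> \<omega>0) ` (insert [] (?S \<omega>0)))" by blast
  qed
  ultimately have 1: "finite (ext_states G X Base)" by (rule finite_subset[rotated])
  have 2: "e \<in> edges G \<and> \<omega> \<circ> Suc \<in> ext_states G X Base \<and> state_in G X (\<omega> \<circ> Suc) (rng G e)"
    if "\<omega> \<in> ext_states G X Base" "\<omega> 0 = Some e" for \<omega> e
    using that
  proof cases
    case base
    then show ?thesis using tail that(2) ext_states.base by blast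
  qed (use that(2) in auto)
  have 3: "\<omega> \<in> Base" if "\<omega> \<in> ext_states G X Base" "\<omega> 0 = None" for \<omega>
    using that by cases auto
  show ?thesis unfolding state_space_def
  proof (intro conjI ballI allI impI)
    fix \<omega> assume \<omega>: "\<omega> \<in> ext_states G X Base"
    show "cons_state e \<omega> \<in> ext_states G X Base" if "e \<in> edges G" "state_in G X \<omega> (rng G e)" for e
      using \<omega> that by (rule ext_states.cons)
    assume "\<omega> 0 = None"
    from none[OF 3[OF \<omega> this] this]
    show "X \<noteq> {}" "\<And>v. is_regular G v \<Longrightarrow> \<not> X \<subseteq> {v}"
      "\<And>B C. B \<in> gen_verts G \<Longrightarrow> C \<in> gen_verts G \<Longrightarrow> X \<subseteq> B \<union> C \<Longrightarrow> X \<subseteq> B \<or> X \<subseteq> C" by simp_all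
  qed (use 1 2 in auto)
qed

lemma foldr_cons_ext_states:
  assumes "is_path G \<alpha>" "\<omega> \<in> ext_states G X Base" "state_in G X \<omega> (path_rng G \<alpha>)"
  shows "foldr cons_state \<alpha> \<omega> \<in> ext_states G X Base \<and> state_in G X (foldr cons_state \<alpha> \<omega>) {path_src G \<alpha>}"
  using assms(1,3)
proof (induction \<alpha>)
  case (Cons e \<alpha>)
  show ?case
  proof (cases "\<alpha> = []")
    case True
    then show ?thesis using Cons.prems assms(2) by (simp add: is_path_Cons path_rng_def path_src_def ext_states.cons)
  next
    case False
    then have p: "e \<in> edges G" "is_path G \<alpha>" "src G (hd \<alpha>) \<in> rng G e" using Cons.prems is_path_Cons by metis+
    have "foldr cons_state \<alpha> \<omega> \<in> ext_states G X Base" "state_in G X (foldr cons_state \<alpha> \<omega>) {src G (hd \<alpha>)}"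
      using Cons.IH[OF p(2)] Cons.prems(2) False by (simp_all add: path_rng_def path_src_def)
    moreover from this(2) have "state_in G X (foldr cons_state \<alpha> \<omega>) (rng G e)" using p(3) state_in_mono by blast
    ultimately show ?thesis using p(1) by (simp add: ext_states.cons path_src_def)
  qed
qed (simp add: is_path_def)

definition cycle_state :: "'v \<Rightarrow> 'e state" where
  "cycle_state v = (\<lambda>i. Some (en ((nx ^^ i) v)))"

lemma cycle_state_cons: "cycle_state v = cons_state (en v) (cycle_state (nx v))"
  by (rule ext) (auto simp: cycle_state_def cons_state_def funpow_swap1 split: nat.split)

lemma state_in_cycle_state: "on_cycle G v \<Longrightarrow> state_in G X (cycle_state v) B \<longleftrightarrow> v \<in> B"
  using on_cycle_en(2)[of v] by (simp add: state_in_def cycle_state_def)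

definition cycle_states :: "'v \<Rightarrow> 'e state set" where
  "cycle_states v = ext_states G {} (range (\<lambda>k. cycle_state ((nx ^^ k) v)))"

lemma cycle_states_base: "cycle_state ((nx ^^ k) v) \<in> cycle_states v"
  unfolding cycle_states_def by (intro ext_states.base) auto

text \<open>The base consists of the infinite paths around one cycle, one for each of its finitely
  many vertices. No state is an empty path, so \<open>X = {}\<close> is harmless.\<close>

lemma state_space_cycle_states:
  assumes v: "on_cycle G v"
  shows "state_space G {} (cycle_states v)"
  unfolding cycle_states_def
proof (rule state_space_ext_states)
  note oc = on_cycle_funpow[OF v]
  have "range (\<lambda>k. cycle_state ((nx ^^ k) v)) = cycle_state ` range (\<lambda>k. (nx ^^ k) v)" by auto
  then show "finite (range (\<lambda>k. cycle_state ((nx ^^ k) v)))" using finite_orbit[OF v] by simp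
  fix \<omega> assume "\<omega> \<in> range (\<lambda>k. cycle_state ((nx ^^ k) v))"
  then obtain k where k: "\<omega> = cycle_state ((nx ^^ k) v)" by blast
  define u where "u = (nx ^^ k) v"
  have u: "on_cycle G u" "\<omega> = cycle_state u" using oc[of k] k u_def by auto
  show "\<exists>v\<in>verts G. \<forall>B. state_in G {} \<omega> B \<longrightarrow> v \<in> B"
    using u on_cycle_verts[OF u(1)] state_in_cycle_state[OF u(1)] by blast
  have "\<omega> 0 = Some (en u)" by (simp add: u cycle_state_def)
  then show "\<omega> 0 = None \<Longrightarrow> {} \<noteq> {} \<and> (\<forall>v. is_regular G v \<longrightarrow> \<not> {} \<subseteq> {v}) \<and>
        (\<forall>B\<in>gen_verts G. \<forall>C\<in>gen_verts G. {} \<subseteq> B \<union> C \<longrightarrow> {} \<subseteq> B \<or> {} \<subseteq> C)" by simp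
  have su: "\<omega> \<circ> Suc = cycle_state (nx u)" unfolding u cycle_state_cons[of u] by simp
  have nu: "nx u = (nx ^^ Suc k) v" by (simp add: u_def)
  fix e
  show "e \<in> edges G \<and> \<omega> \<circ> Suc \<in> range (\<lambda>k. cycle_state ((nx ^^ k) v)) \<and> state_in G {} (\<omega> \<circ> Suc) (rng G e)"
    if "\<omega> 0 = Some e"
  proof -
    have e: "e = en u" using that \<open>\<omega> 0 = Some (en u)\<close> by simp
    have "cycle_state (nx u) \<in> range (\<lambda>k. cycle_state ((nx ^^ k) v))" unfolding nu by blast
    then show ?thesis
      using e su on_cycle_en(1)[OF u(1)] on_cycle_step(2,3)[OF u(1)] state_in_cycle_state[of "nx u"] by simp
  qed
  show "cons_state e \<omega> \<in> range (\<lambda>k. cycle_state ((nx ^^ k) v))"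
    if e: "e \<in> edges G" and c: "on_cycle G (src G e)" and i: "state_in G {} \<omega> (rng G e)"
  proof -
    have uu: "u = nx (src G e)" using i u state_in_cycle_state[OF u(1)] on_cycle_edge(2)[OF e c] by simp
    \<comment> \<open>The predecessor on the cycle is also reached by going forward, so it belongs
      to the same orbit.\<close>
    obtain j where "(nx ^^ j) (nx (src G e)) = src G e" using nx_inverse[OF c] by blast
    then have "src G e = (nx ^^ (j + k)) v" using uu u_def by (simp add: funpow_add)
    moreover have "cons_state e \<omega> = cycle_state (src G e)"
      unfolding cycle_state_cons[of "src G e"] on_cycle_edge(1)[OF e c] u(2) uu ..
    ultimately show ?thesis by auto
  qed
qed

lemma state_space_terminal:
  assumes X: "X \<in> terminal_sets G"
  shows "state_space G X (ext_states G X {\<lambda>_. None})"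
proof (rule state_space_ext_states)
  fix \<omega> :: "'e state" assume "\<omega> \<in> {\<lambda>_. None}"
  then have w: "\<omega> = (\<lambda>_. None)" by simp
  obtain x where x: "x \<in> X" using terminal_set_prime(1)[OF X] by blast
  have "X \<subseteq> verts G"
    using gen_verts_subset_verts[OF ultragraph terminal_set_gen[OF X]] .
  then show "\<exists>v\<in>verts G. \<forall>B. state_in G X \<omega> B \<longrightarrow> v \<in> B" using x w by (auto simp: state_in_def)
  show "X \<noteq> {} \<and> (\<forall>v. is_regular G v \<longrightarrow> \<not> X \<subseteq> {v}) \<and>
        (\<forall>B\<in>gen_verts G. \<forall>C\<in>gen_verts G. X \<subseteq> B \<union> C \<longrightarrow> X \<subseteq> B \<or> X \<subseteq> C)"
    using terminal_set_prime[OF X] by blast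
  fix e
  show "\<omega> 0 = Some e \<Longrightarrow> e \<in> edges G \<and> \<omega> \<circ> Suc \<in> {\<lambda>_. None} \<and> state_in G X (\<omega> \<circ> Suc) (rng G e)"
    using w by simp
  show "cons_state e \<omega> \<in> {\<lambda>_. None}"
    if e: "e \<in> edges G" "on_cycle G (src G e)" and i: "state_in G X \<omega> (rng G e)"
  proof -
    \<comment> \<open>A cycle edge ends in a single regular vertex, which contains no terminal set;
      so no cycle edge can precede the empty path.\<close>
    have "X \<subseteq> {nx (src G e)}" using i w on_cycle_edge(2)[OF e] by (simp add: state_in_def)
    then show ?thesis using terminal_set_prime(3)[OF X on_cycle_regular[OF on_cycle_step(3)[OF e(2)]]] by simp
  qed
qed simp

text \<open>The fourth graph condition enters here: whatever the vertex reaches supplies the end of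
  a boundary path that starts at the vertex.\<close>

lemma state_space_at_vertex:
  assumes v: "v \<in> verts G"
  shows "\<exists>X \<Omega>. state_space G X \<Omega> \<and> (\<exists>\<omega>\<in>\<Omega>. state_in G X \<omega> {v})"
proof -
  have "reaches_terminal_set G v \<or> reaches_cycle G v" using B4 v unfolding every_vertex_terminates_def by simp
  then consider (t0) "{v} \<in> terminal_sets G"
    | (t1) \<alpha> X where "is_path G \<alpha>" "path_src G \<alpha> = v" "X \<in> terminal_sets G" "X \<subseteq> path_rng G \<alpha>"
    | (c0) "on_cycle G v"
    | (c1) \<alpha> w where "is_path G \<alpha>" "path_src G \<alpha> = v" "w \<in> path_rng G \<alpha>" "on_cycle G w"
    unfolding reaches_terminal_set_def reaches_cycle_def by blast
  then show ?thesis
  proof cases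
    case t0
    have "(\<lambda>_. None) \<in> ext_states G {v} {\<lambda>_. None}" by (intro ext_states.base) simp
    then show ?thesis using state_space_terminal[OF t0]
      by (intro exI[of _ "{v}"] exI[of _ "ext_states G {v} {\<lambda>_. None}"] conjI bexI[of _ "\<lambda>_. None"]) (simp_all add: state_in_def)
  next
    case (t1 \<alpha> X)
    have "(\<lambda>_. None) \<in> ext_states G X {\<lambda>_. None}" by (intro ext_states.base) simp
    from foldr_cons_ext_states[OF t1(1) this] state_space_terminal[OF t1(3)] t1(2,4)
    show ?thesis by (simp add: state_in_def[of G X "\<lambda>_. None"]) blast
  next
    case c0
    have "state_in G {} (cycle_state v) {v}" using state_in_cycle_state[OF c0] by simp
    then show ?thesis using state_space_cycle_states[OF c0] cycle_states_base[of 0 v] by auto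
  next
    case (c1 \<alpha> w)
    have "state_in G {} (cycle_state w) (path_rng G \<alpha>)" using state_in_cycle_state[OF c1(4)] c1(3) by simp
    from foldr_cons_ext_states[OF c1(1) cycle_states_base[of 0 w, unfolded cycle_states_def, simplified] this]
      state_space_cycle_states[OF c1(4)] c1(2)
    show ?thesis unfolding cycle_states_def by auto
  qed
qed

end

section \<open>Projections of difference sets\<close>

locale ultragraph_cstar = rfd_ultragraph G + cstar_algebra A
  for G :: "('v, 'e) ultragraph" and A :: "'a cstar" (structure) +
  fixes p :: "'v set \<Rightarrow> 'a" and s :: "'e \<Rightarrow> 'a"
  assumes fam: "ultragraph_family G A p s"
begin

lemma p_rules:
  assumes "X \<in> gen_verts G"
  shows "p X \<in> carrier A" "star A (p X) = p X" "p X \<otimes> p X = p X"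
    "Y \<in> gen_verts G \<Longrightarrow> p X \<otimes> p Y = p (X \<inter> Y)"
    "Y \<in> gen_verts G \<Longrightarrow> p (X \<union> Y) = p X \<oplus> p Y \<ominus> p (X \<inter> Y)"
  using fam assms unfolding ultragraph_family_def projection_def by simp_all

lemma p_empty: "p {} = \<zero>"
  using fam unfolding ultragraph_family_def by simp

lemma s_closed [simp]: "e \<in> edges G \<Longrightarrow> s e \<in> carrier A"
  using fam unfolding ultragraph_family_def partial_isometry_def by simp

lemma s_star_closed [simp]: "e \<in> edges G \<Longrightarrow> star A (s e) \<in> carrier A"
  by (simp add: star_closed)

lemma rng_gen [simp]: "e \<in> edges G \<Longrightarrow> rng G e \<in> gen_verts G"
  by (rule gen_verts.range)

lemma src_gen [simp]: "e \<in> edges G \<Longrightarrow> {src G e} \<in> gen_verts G"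
  by (intro gen_verts.vertex edgeD)

lemma s_star_s: "e \<in> edges G \<Longrightarrow> star A (s e) \<otimes> s e = p (rng G e)"
  using fam unfolding ultragraph_family_def by simp

lemma s_p_rng: assumes e: "e \<in> edges G" shows "s e \<otimes> p (rng G e) = s e"
proof -
  have "s e \<otimes> star A (s e) \<otimes> s e = s e" using fam e unfolding ultragraph_family_def partial_isometry_def by simp
  then show ?thesis using e by (simp add: s_star_s[symmetric] mult_assoc)
qed

lemma p_src_s: assumes e: "e \<in> edges G" shows "p {src G e} \<otimes> s e = s e"
proof -
  have 1: "s e \<otimes> star A (s e) \<otimes> s e = s e" using fam e unfolding ultragraph_family_def partial_isometry_def by simp
  have 2: "s e \<otimes> star A (s e) = p {src G e} \<otimes> (s e \<otimes> star A (s e))"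
    using fam e unfolding ultragraph_family_def proj_le_def by simp
  have "p {src G e} \<otimes> s e = p {src G e} \<otimes> (s e \<otimes> star A (s e)) \<otimes> s e"
    using e p_rules(1)[OF src_gen[OF e]] 1 by (simp add: mult_assoc mult_closed)
  then show ?thesis using 1 2 by simp
qed

lemma p_s: assumes e: "e \<in> edges G" and X: "X \<in> gen_verts G"
  shows "p X \<otimes> s e = (if src G e \<in> X then s e else \<zero>)"
proof -
  have "p X \<otimes> s e = p X \<otimes> p {src G e} \<otimes> s e"
    using e X p_rules(1) by (simp add: mult_assoc p_src_s)
  also have "p X \<otimes> p {src G e} = p (X \<inter> {src G e})" using e X by (simp add: p_rules(4))
  finally show ?thesis using e by (auto simp: p_src_s p_empty Int_insert_right)
qed

text \<open>Orthogonality of the range projections passes to the partial isometries, since each of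
  them is fixed by its own range projection.\<close>

lemma s_star_s_orth: assumes e: "e \<in> edges G" and f: "f \<in> edges G" and ne: "e \<noteq> f"
  shows "star A (s e) \<otimes> s f = \<zero>"
proof -
  have z: "(s e \<otimes> star A (s e)) \<otimes> (s f \<otimes> star A (s f)) = \<zero>"
    using fam e f ne unfolding ultragraph_family_def by blast
  have re: "star A (s e) = star A (s e) \<otimes> (s e \<otimes> star A (s e))"
    using arg_cong[OF s_p_rng[OF e], of "star A"] e p_rules(1,2)[OF rng_gen[OF e]]
    by (simp add: star_mult s_star_s[symmetric] mult_assoc)
  have rf: "s f = (s f \<otimes> star A (s f)) \<otimes> s f"
    using s_p_rng[OF f] f by (simp add: s_star_s[symmetric] mult_assoc)
  have "star A (s e) \<otimes> s f = (star A (s e) \<otimes> (s e \<otimes> star A (s e))) \<otimes> ((s f \<otimes> star A (s f)) \<otimes> s f)"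
    using re rf by simp
  also have "\<dots> = star A (s e) \<otimes> ((s e \<otimes> star A (s e)) \<otimes> (s f \<otimes> star A (s f))) \<otimes> s f"
    using e f by (simp add: mult_assoc mult_closed)
  finally show ?thesis using z e f by simp
qed

lemma p_regular: "is_regular G v \<Longrightarrow> p {v} = finsum A (\<lambda>e. s e \<otimes> star A (s e)) (emitted G {v})"
  using fam unfolding ultragraph_family_def by blast

text \<open>Cutting vertex sets into atoms leaves \<open>gen_verts G\<close>, which has no
  complements. Differences of two members suffice: they are stable under intersecting with a member
  and under removing one.\<close>

definition diffs :: "'v set set" where
  "diffs = {X - Y | X Y. X \<in> gen_verts G \<and> Y \<in> gen_verts G}"

text \<open>A difference has many presentations \<open>X - Y\<close>; one is chosen, and
  \<open>P_eq\<close> shows that all give the same value.\<close>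

definition P :: "'v set \<Rightarrow> 'a" where
  "P D = (SOME x. \<exists>X Y. X \<in> gen_verts G \<and> Y \<in> gen_verts G \<and> D = X - Y \<and> x = p X \<ominus> p (X \<inter> Y))"

text \<open>Only the part of \<open>X\<close> inside \<open>Z\<close> matters once \<open>Z\<close>
  covers the difference. Two presentations of one set are compared by shrinking both to
  \<open>X \<inter> X'\<close>.\<close>

lemma diff_p_shrink:
  assumes X: "X \<in> gen_verts G" and Y: "Y \<in> gen_verts G" and Z: "Z \<in> gen_verts G" and sub: "X - Y \<subseteq> Z"
  shows "p (X \<inter> Z) \<ominus> p (X \<inter> Z \<inter> Y) = p X \<ominus> p (X \<inter> Y)"
proof -
  have g: "X \<inter> Z \<in> gen_verts G" "X \<inter> Y \<in> gen_verts G" "X \<inter> Z \<inter> Y \<in> gen_verts G" using X Y Z by (auto intro: gen_verts.inter)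
  have eq: "X = (X \<inter> Z) \<union> (X \<inter> Y)" "X \<inter> Z \<inter> Y = (X \<inter> Z) \<inter> (X \<inter> Y)" using sub by auto
  have "p X = p (X \<inter> Z) \<oplus> p (X \<inter> Y) \<ominus> p (X \<inter> Z \<inter> Y)"
    using p_rules(5)[OF g(1,2)] eq by metis
  then have "p X \<ominus> p (X \<inter> Y) = p (X \<inter> Y) \<oplus> (p (X \<inter> Z) \<ominus> p (X \<inter> Z \<inter> Y)) \<ominus> p (X \<inter> Y)"
    using p_rules(1)[OF g(1)] p_rules(1)[OF g(2)] p_rules(1)[OF g(3)] by (simp add: minus_eq a_ac)
  also have "\<dots> = p (X \<inter> Z) \<ominus> p (X \<inter> Z \<inter> Y)"
    using p_rules(1)[OF g(1)] p_rules(1)[OF g(2)] p_rules(1)[OF g(3)]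
    by (simp add: minus_eq a_comm[of "p (X \<inter> Y)"] a_assoc r_neg)
  finally show ?thesis by simp
qed

lemma P_eq: assumes X: "X \<in> gen_verts G" and Y: "Y \<in> gen_verts G"
  shows "P (X - Y) = p X \<ominus> p (X \<inter> Y)"
proof -
  have "\<exists>X' Y'. X' \<in> gen_verts G \<and> Y' \<in> gen_verts G \<and> X - Y = X' - Y' \<and> P (X - Y) = p X' \<ominus> p (X' \<inter> Y')"
    unfolding P_def by (rule someI_ex) (use assms in blast)
  then obtain X' Y' where *: "X' \<in> gen_verts G" "Y' \<in> gen_verts G" "X - Y = X' - Y'" "P (X - Y) = p X' \<ominus> p (X' \<inter> Y')" by blast
  have "X' \<inter> X \<inter> Y' = X \<inter> X' \<inter> Y" "X' \<inter> X = X \<inter> X'" using *(3) by auto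
  then show ?thesis
    using diff_p_shrink[OF X Y *(1)] diff_p_shrink[OF *(1,2) X] *(3,4) by (metis Diff_subset)
qed

lemma diffs_cases: assumes "D \<in> diffs"
  obtains X Y where "X \<in> gen_verts G" "Y \<in> gen_verts G" "D = X - Y" "P D = p X \<ominus> p (X \<inter> Y)"
  using assms P_eq unfolding diffs_def by blast

lemma diffs_closed: assumes "D \<in> diffs" "Z \<in> gen_verts G" shows "D \<inter> Z \<in> diffs" "D - Z \<in> diffs"
proof -
  obtain X Y where XY: "X \<in> gen_verts G" "Y \<in> gen_verts G" "D = X - Y" using assms(1) unfolding diffs_def by blast
  have "D \<inter> Z = (X \<inter> Z) - Y" "D - Z = X - (Y \<union> Z)" using XY by auto
  then show "D \<inter> Z \<in> diffs" "D - Z \<in> diffs"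
    unfolding diffs_def using XY(1,2) assms(2) gen_verts.inter[of X G Z] gen_verts.union[of Y G Z] by blast+
qed

lemma gen_diffs: "X \<in> gen_verts G \<Longrightarrow> X \<in> diffs"
  unfolding diffs_def using gen_verts.empty[of G] by blast

lemma P_gen: assumes "X \<in> gen_verts G" shows "P X = p X"
  using P_eq[OF assms gen_verts.empty] assms by (simp add: p_empty minus_eq_scale p_rules)

lemma P_closed [simp]: "D \<in> diffs \<Longrightarrow> P D \<in> carrier A"
  by (erule diffs_cases) (simp add: p_rules(1) gen_verts.inter)

lemma P_star: "D \<in> diffs \<Longrightarrow> star A (P D) = P D"
  by (erule diffs_cases) (simp add: star_minus p_rules gen_verts.inter)

lemma P_empty: "P {} = \<zero>"
  using P_gen[OF gen_verts.empty] p_empty by simp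

lemma P_mult_p: assumes D: "D \<in> diffs" and Z: "Z \<in> gen_verts G" shows "P D \<otimes> p Z = P (D \<inter> Z)"
proof -
  obtain X Y where XY: "X \<in> gen_verts G" "Y \<in> gen_verts G" "D = X - Y" "P D = p X \<ominus> p (X \<inter> Y)" using D by (rule diffs_cases)
  have "D \<inter> Z = (X \<inter> Z) - Y" using XY by auto
  moreover have "X \<inter> Y \<inter> Z = X \<inter> Z \<inter> Y" by auto
  ultimately show ?thesis using XY Z P_eq[of "X \<inter> Z" Y]
    by (simp add: mult_minus_left p_rules gen_verts.inter)
qed

lemma P_split: assumes D: "D \<in> diffs" and Z: "Z \<in> gen_verts G" shows "P D = P (D \<inter> Z) \<oplus> P (D - Z)"
proof -
  obtain X Y where XY: "X \<in> gen_verts G" "Y \<in> gen_verts G" "D = X - Y" "P D = p X \<ominus> p (X \<inter> Y)" using D by (rule diffs_cases)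
  have g: "X \<inter> Z \<in> gen_verts G" "X \<inter> Y \<in> gen_verts G" "X \<inter> Z \<inter> Y \<in> gen_verts G" "Y \<union> Z \<in> gen_verts G"
    using XY Z by (auto intro: gen_verts.intros)
  note c = p_rules(1)[OF g(1)] p_rules(1)[OF g(2)] p_rules(1)[OF g(3)] p_rules(1)[OF XY(1)]
  have 1: "P (D \<inter> Z) = p (X \<inter> Z) \<ominus> p (X \<inter> Z \<inter> Y)"
  proof -
    have "D \<inter> Z = (X \<inter> Z) - Y" using XY by auto
    then show ?thesis using P_eq[OF g(1) XY(2)] by simp
  qed
  have "X \<inter> (Y \<union> Z) = (X \<inter> Y) \<union> (X \<inter> Z)" "(X \<inter> Y) \<inter> (X \<inter> Z) = X \<inter> Z \<inter> Y" by auto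
  then have "p (X \<inter> (Y \<union> Z)) = p (X \<inter> Y) \<oplus> p (X \<inter> Z) \<ominus> p (X \<inter> Z \<inter> Y)" using p_rules(5)[OF g(2,1)] by simp
  moreover have "D - Z = X - (Y \<union> Z)" using XY by auto
  ultimately have 2: "P (D - Z) = p X \<ominus> (p (X \<inter> Y) \<oplus> p (X \<inter> Z) \<ominus> p (X \<inter> Z \<inter> Y))" using P_eq[OF XY(1) g(4)] by simp
  define a where "a = p (X \<inter> Z) \<ominus> p (X \<inter> Z \<inter> Y)"
  have a: "a \<in> carrier A" unfolding a_def using c by simp
  have "p (X \<inter> Y) \<oplus> p (X \<inter> Z) \<ominus> p (X \<inter> Z \<inter> Y) = p (X \<inter> Y) \<oplus> a"
    unfolding a_def using c by (simp add: minus_eq a_assoc)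
  then have "P (D \<inter> Z) \<oplus> P (D - Z) = a \<oplus> (p X \<ominus> (p (X \<inter> Y) \<oplus> a))" using 1 2 a_def by simp
  also have "\<dots> = p X \<oplus> \<ominus> p (X \<inter> Y) \<oplus> (a \<oplus> \<ominus> a)"
    using a c by (simp only: minus_eq minus_add) (simp add: a_ac)
  also have "\<dots> = P D" using a c XY(4) by (simp add: r_neg minus_eq)
  finally show ?thesis by simp
qed

lemma P_mult: assumes D: "D \<in> diffs" and D': "D' \<in> diffs" shows "P D \<otimes> P D' = P (D \<inter> D')"
proof -
  obtain X Y where XY: "X \<in> gen_verts G" "Y \<in> gen_verts G" "D' = X - Y" "P D' = p X \<ominus> p (X \<inter> Y)" using D' by (rule diffs_cases)
  note dX = diffs_closed[OF D XY(1)]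
  have dXY: "D \<inter> X \<inter> Y \<in> diffs" "D \<inter> X - Y \<in> diffs" using diffs_closed[OF dX(1) XY(2)] by auto
  have "P D \<otimes> P D' = P D \<otimes> p X \<ominus> P D \<otimes> p (X \<inter> Y)" unfolding XY(4)
    using D XY by (intro mult_minus_right) (auto intro: p_rules gen_verts.inter)
  also have "\<dots> = P (D \<inter> X) \<ominus> P (D \<inter> X \<inter> Y)"
    using XY gen_verts.inter[OF XY(1,2)] by (simp add: P_mult_p[OF D] Int_assoc)
  also have "P (D \<inter> X) = P (D \<inter> X \<inter> Y) \<oplus> P (D \<inter> X - Y)" by (rule P_split[OF dX(1) XY(2)])
  also have "P (D \<inter> X \<inter> Y) \<oplus> P (D \<inter> X - Y) \<ominus> P (D \<inter> X \<inter> Y) = P (D \<inter> X - Y)"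
    using P_closed[OF dXY(1)] P_closed[OF dXY(2)] by (simp add: a_comm[of "P (D \<inter> X \<inter> Y)"] minus_eq a_assoc r_neg)
  also have "D \<inter> X - Y = D \<inter> D'" using XY(3) by auto
  finally show ?thesis .
qed

lemma P_s: assumes D: "D \<in> diffs" and e: "e \<in> edges G"
  shows "P D \<otimes> s e = (if src G e \<in> D then s e else \<zero>)"
proof -
  obtain X Y where XY: "X \<in> gen_verts G" "Y \<in> gen_verts G" "D = X - Y" "P D = p X \<ominus> p (X \<inter> Y)" using D by (rule diffs_cases)
  have "P D \<otimes> s e = p X \<otimes> s e \<ominus> p (X \<inter> Y) \<otimes> s e" unfolding XY(4)
    using XY e by (intro mult_minus_left) (auto intro: p_rules gen_verts.inter)
  also have "\<dots> = (if src G e \<in> D then s e else \<zero>)"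
    using XY e gen_verts.inter[OF XY(1,2)] by (auto simp: p_s minus_eq r_neg)
  finally show ?thesis .
qed

section \<open>Partition into atoms\<close>

text \<open>The nonempty cells of the Venn diagram of \<open>F\<close> inside
  \<open>D\<close>.\<close>

definition parts :: "'v set set \<Rightarrow> 'v set \<Rightarrow> 'v set set" where
  "parts F D = {{u \<in> D. \<forall>Z\<in>F. u \<in> Z \<longleftrightarrow> v \<in> Z} | v. v \<in> D}"

lemma parts_insert: "parts F (D \<inter> Z) \<union> parts F (D - Z) \<subseteq> parts (insert Z F) D"
proof -
  have "{u \<in> D \<inter> Z. \<forall>Z\<in>F. u \<in> Z \<longleftrightarrow> v \<in> Z} = {u \<in> D. \<forall>Z\<in>insert Z F. u \<in> Z \<longleftrightarrow> v \<in> Z}" if "v \<in> D \<inter> Z" for v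
    using that by auto
  moreover have "{u \<in> D - Z. \<forall>Z\<in>F. u \<in> Z \<longleftrightarrow> v \<in> Z} = {u \<in> D. \<forall>Z\<in>insert Z F. u \<in> Z \<longleftrightarrow> v \<in> Z}" if "v \<in> D - Z" for v
    using that by auto
  ultimately show ?thesis unfolding parts_def by blast
qed

lemma parts_diffs:
  assumes "finite F" "F \<subseteq> gen_verts G" "D \<in> diffs"
  shows "parts F D \<subseteq> diffs"
  using assms
proof (induction F arbitrary: D rule: finite_induct)
  case empty
  then show ?case by (auto simp: parts_def)
next
  case (insert Z F)
  show ?case
  proof
    fix C assume "C \<in> parts (insert Z F) D"
    then obtain v where v: "v \<in> D" "C = {u \<in> D. \<forall>Z\<in>insert Z F. u \<in> Z \<longleftrightarrow> v \<in> Z}" unfolding parts_def by blast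
    define C' where "C' = {u \<in> D. \<forall>Z\<in>F. u \<in> Z \<longleftrightarrow> v \<in> Z}"
    have "C' \<in> diffs" using insert v(1) unfolding C'_def parts_def by blast
    moreover have "C = (if v \<in> Z then C' \<inter> Z else C' - Z)" using v by (auto simp: C'_def)
    ultimately show "C \<in> diffs" using diffs_closed[of C' Z] insert.prems(1) by simp
  qed
qed

text \<open>The members of \<open>F\<close> are inserted one at a time, and \<open>P_split\<close>
  cuts \<open>D\<close> along each.\<close>

lemma P_in_span_parts:
  assumes "finite F" "F \<subseteq> gen_verts G" "D \<in> diffs"
  shows "P D \<in> lspan A (P ` parts F D)"
  using assms
proof (induction F arbitrary: D rule: finite_induct)
  case empty
  show ?case
  proof (cases "D = {}")
    case True then show ?thesis by (simp add: P_empty lspan.zero)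
  next
    case False
    then have "parts {} D = {D}" by (auto simp: parts_def)
    then show ?thesis using empty by (simp add: lspan_base)
  qed
next
  case (insert Z F)
  have Z: "Z \<in> gen_verts G" using insert by simp
  note dc = diffs_closed[OF insert.prems(2) Z]
  have sub: "P ` parts (insert Z F) D \<subseteq> carrier A"
    using parts_diffs[of "insert Z F" D] insert by auto
  have "P (D \<inter> Z) \<in> lspan A (P ` parts (insert Z F) D)" "P (D - Z) \<in> lspan A (P ` parts (insert Z F) D)"
    using insert.IH[OF _ dc(1)] insert.IH[OF _ dc(2)] insert.prems(1) parts_insert[of F D Z]
    by (simp_all add: lspan_mono[OF _ image_mono])
  then show ?case unfolding P_split[OF insert.prems(2) Z] by (rule lspan_add[OF sub])
qed

end

text \<open>The data that finitely many generators involve. Sources, ranges and cycle vertices are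
  put into \<open>F\<close> so that they never cut an atom; \<open>K0\<close> is closed under
  \<open>nx\<close> so that moving along a cycle stays inside.\<close>

locale finite_stage = ultragraph_cstar G A p s
  for G :: "('v, 'e) ultragraph" and A :: "'a cstar" (structure) and p s +
  fixes E0 :: "'e set" and K0 :: "'v set" and F :: "'v set set"
  assumes E0: "finite E0" "E0 \<subseteq> transient"
    and K0: "finite K0" "\<And>v. v \<in> K0 \<Longrightarrow> on_cycle G v" "\<And>v. v \<in> K0 \<Longrightarrow> nx v \<in> K0"
    and F: "finite F" "F \<subseteq> gen_verts G"
    and F_src: "\<And>e. e \<in> E0 \<Longrightarrow> {src G e} \<in> F" and F_rng: "\<And>e. e \<in> E0 \<Longrightarrow> rng G e \<in> F"
    and F_K0: "\<And>v. v \<in> K0 \<Longrightarrow> {v} \<in> F"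
begin

lemma E0_edges [simp]: "e \<in> E0 \<Longrightarrow> e \<in> edges G"
  using E0(2) unfolding transient_def by auto

definition atoms :: "'v set set" where "atoms = parts F (\<Union>F)"

lemma Union_F: "\<Union>F \<in> gen_verts G"
  using F by (induction F rule: finite_induct) (auto intro: gen_verts.intros)

lemma atoms_diffs: "D \<in> atoms \<Longrightarrow> D \<in> diffs"
  using parts_diffs[OF F gen_diffs[OF Union_F]] unfolding atoms_def by blast

text \<open>An atom is determined by the members of \<open>F\<close> that contain it.\<close>

lemma finite_atoms: "finite atoms"
proof -
  have "atoms \<subseteq> (\<lambda>S. {u \<in> \<Union>F. {Z \<in> F. u \<in> Z} = S}) ` Pow F"
  proof
    fix D assume "D \<in> atoms"
    then obtain v where v: "D = {u \<in> \<Union>F. \<forall>Z\<in>F. u \<in> Z \<longleftrightarrow> v \<in> Z}" unfolding atoms_def parts_def by blast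
    then have "D = {u \<in> \<Union>F. {Z \<in> F. u \<in> Z} = {Z \<in> F. v \<in> Z}}" by blast
    then show "D \<in> (\<lambda>S. {u \<in> \<Union>F. {Z \<in> F. u \<in> Z} = S}) ` Pow F" by blast
  qed
  then show ?thesis using F(1) by (simp add: finite_subset)
qed

lemma atom_ne: "D \<in> atoms \<Longrightarrow> D \<noteq> {}"
  unfolding atoms_def parts_def by blast

lemma atom_dichotomy: "D \<in> atoms \<Longrightarrow> Z \<in> F \<Longrightarrow> D \<subseteq> Z \<or> D \<inter> Z = {}"
  unfolding atoms_def parts_def by auto

lemma atom_disjoint: "D \<in> atoms \<Longrightarrow> D' \<in> atoms \<Longrightarrow> D \<noteq> D' \<Longrightarrow> D \<inter> D' = {}"
  unfolding atoms_def parts_def by auto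

lemma atom_singleton: "{v} \<in> F \<Longrightarrow> {v} \<in> atoms"
  unfolding atoms_def parts_def by (auto intro!: exI[of _ v])

text \<open>Holds because \<open>{src G e}\<close> was put into \<open>F\<close>; this is what lets
  every path to the atom be continued by \<open>e\<close>.\<close>

lemma atom_src: "D \<in> atoms \<Longrightarrow> e \<in> E0 \<Longrightarrow> src G e \<in> D \<Longrightarrow> D = {src G e}"
  using atom_dichotomy[OF _ F_src, of D e] by auto

lemma p_in_span_atoms: assumes Z: "Z \<in> F" shows "p Z \<in> lspan A (P ` {D \<in> atoms. D \<subseteq> Z})"
proof -
  have "parts F Z \<subseteq> {D \<in> atoms. D \<subseteq> Z}"
  proof
    fix D assume "D \<in> parts F Z"
    then obtain v where v: "v \<in> Z" "D = {u \<in> Z. \<forall>Z\<in>F. u \<in> Z \<longleftrightarrow> v \<in> Z}" unfolding parts_def by blast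
    then have "D = {u \<in> \<Union>F. \<forall>Z\<in>F. u \<in> Z \<longleftrightarrow> v \<in> Z}" using Z by blast
    then show "D \<in> {D \<in> atoms. D \<subseteq> Z}" using v Z unfolding atoms_def parts_def by blast
  qed
  moreover have "p Z \<in> lspan A (P ` parts F Z)"
    using P_in_span_parts[OF F, of Z] gen_diffs[of Z] P_gen[of Z] Z F(2) by auto
  ultimately show ?thesis by (rule lspan_mono[OF _ image_mono, rotated])
qed

end

section \<open>Gap projections\<close>

context finite_stage
begin

text \<open>The subtraction makes \<open>gap D\<close> orthogonal to every chosen edge, and thereby
  words of different length orthogonal; otherwise the range of a longer word could lie under that of
  a shorter one.\<close>

definition gap :: "'v set \<Rightarrow> 'a" where
  "gap D = P D \<ominus> finsum A (\<lambda>e. s e \<otimes> star A (s e)) {e \<in> E0. src G e \<in> D}"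

lemma finite_E0_sub: "finite {e \<in> E0. Q e}" using E0(1) by simp

lemma ss_closed [simp]: "e \<in> E0 \<Longrightarrow> s e \<otimes> star A (s e) \<in> carrier A"
  by (simp add: mult_closed)

lemma ss_image [simp]: "(\<lambda>e. s e \<otimes> star A (s e)) ` {e \<in> E0. Q e} \<subseteq> carrier A"
  by auto

lemma ss_sum_closed [simp]: "finsum A (\<lambda>e. s e \<otimes> star A (s e)) {e \<in> E0. Q e} \<in> carrier A"
  by (rule finsum_closed) auto

lemma gap_closed [simp]: "D \<in> atoms \<Longrightarrow> gap D \<in> carrier A"
  unfolding gap_def by (simp add: atoms_diffs)

lemma gap_star: assumes D: "D \<in> atoms" shows "star A (gap D) = gap D"
proof -
  have "star A (finsum A (\<lambda>e. s e \<otimes> star A (s e)) {e \<in> E0. src G e \<in> D})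
    = finsum A (\<lambda>e. star A (s e \<otimes> star A (s e))) {e \<in> E0. src G e \<in> D}"
    by (rule finsum_star) (auto simp: finite_E0_sub)
  also have "\<dots> = finsum A (\<lambda>e. s e \<otimes> star A (s e)) {e \<in> E0. src G e \<in> D}"
    by (rule finsum_cong') (auto simp: star_mult star_star)
  finally show ?thesis using D by (simp add: gap_def star_minus P_star atoms_diffs)
qed

text \<open>Among the subtracted range projections only that of \<open>e\<close> sees
  \<open>s e\<close>. It occurs exactly when \<open>src G e\<close> lies in \<open>D\<close>, and
  then reproduces \<open>s e\<close> just as \<open>P D\<close> does.\<close>

lemma gap_s: assumes D: "D \<in> atoms" and e: "e \<in> E0" shows "gap D \<otimes> s e = \<zero>"
proof -
  let ?I = "{e \<in> E0. src G e \<in> D}"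
  have orth: "s f \<otimes> star A (s f) \<otimes> s e = (if f = e then s e else \<zero>)" if "f \<in> E0" for f
    using that e s_star_s_orth[of f e] s_p_rng[of e] s_star_s[of e] by (simp add: mult_assoc)
  have "finsum A (\<lambda>e. s e \<otimes> star A (s e)) ?I \<otimes> s e = finsum A (\<lambda>f. s f \<otimes> star A (s f) \<otimes> s e) ?I"
    using e by (intro finsum_mult_right) (auto simp: finite_E0_sub)
  also have "\<dots> = finsum A (\<lambda>f. if f = e then s e else \<zero>) ?I"
    using orth e by (intro finsum_cong') auto
  also have "\<dots> = P D \<otimes> s e"
  proof (cases "src G e \<in> D")
    case True
    then have "finsum A (\<lambda>f. if f = e then s e else \<zero>) ?I = (if e = e then s e else \<zero>)"
      using e by (intro finsum_delta) (auto simp: finite_E0_sub)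
    then show ?thesis using True e by (simp add: P_s atoms_diffs[OF D])
  next
    case False
    then have "finsum A (\<lambda>f. if f = e then s e else \<zero>) ?I = finsum A (\<lambda>f. \<zero>) ?I"
      using e by (intro finsum_cong') auto
    then show ?thesis using False e by (simp add: P_s atoms_diffs[OF D])
  qed
  finally have "finsum A (\<lambda>e. s e \<otimes> star A (s e)) ?I \<otimes> s e = P D \<otimes> s e" .
  moreover have "gap D \<otimes> s e = P D \<otimes> s e \<ominus> finsum A (\<lambda>e. s e \<otimes> star A (s e)) ?I \<otimes> s e"
    unfolding gap_def using e atoms_diffs[OF D] by (intro mult_minus_left) auto
  ultimately show ?thesis using e atoms_diffs[OF D] by (simp add: mult_closed minus_eq r_neg)
qed

lemma s_star_gap: assumes D: "D \<in> atoms" and e: "e \<in> E0" shows "star A (s e) \<otimes> gap D = \<zero>"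
  using arg_cong[OF gap_s[OF D e], of "star A"] D e by (simp add: star_mult gap_star)

lemma P_ss: assumes D: "D \<in> diffs" and e: "e \<in> E0"
  shows "P D \<otimes> (s e \<otimes> star A (s e)) = (if src G e \<in> D then s e \<otimes> star A (s e) else \<zero>)"
  using D e P_s[OF D, of e] by (simp add: mult_assoc[symmetric])

lemma P_gap: assumes D: "D \<in> atoms" and C: "C \<in> diffs"
  shows "D \<subseteq> C \<Longrightarrow> P C \<otimes> gap D = gap D" "D \<inter> C = {} \<Longrightarrow> P C \<otimes> gap D = \<zero>"
proof -
  let ?I = "{e \<in> E0. src G e \<in> D}"
  have "P C \<otimes> gap D = P C \<otimes> P D \<ominus> P C \<otimes> finsum A (\<lambda>e. s e \<otimes> star A (s e)) ?I"
    unfolding gap_def using C atoms_diffs[OF D] by (intro mult_minus_right) auto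
  also have "P C \<otimes> finsum A (\<lambda>e. s e \<otimes> star A (s e)) ?I = finsum A (\<lambda>e. P C \<otimes> (s e \<otimes> star A (s e))) ?I"
    using C by (intro finsum_mult_left) (auto simp: finite_E0_sub)
  also have "P C \<otimes> P D = P (C \<inter> D)" using P_mult[OF C atoms_diffs[OF D]] .
  finally have eq: "P C \<otimes> gap D = P (C \<inter> D) \<ominus> finsum A (\<lambda>e. P C \<otimes> (s e \<otimes> star A (s e))) ?I" .
  show "P C \<otimes> gap D = gap D" if "D \<subseteq> C"
  proof -
    have "finsum A (\<lambda>e. P C \<otimes> (s e \<otimes> star A (s e))) ?I = finsum A (\<lambda>e. s e \<otimes> star A (s e)) ?I"
      using P_ss[OF C] that by (intro finsum_cong') auto
    moreover have "C \<inter> D = D" using that by auto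
    ultimately show ?thesis using eq unfolding gap_def by simp
  qed
  show "P C \<otimes> gap D = \<zero>" if "D \<inter> C = {}"
  proof -
    have "finsum A (\<lambda>e. P C \<otimes> (s e \<otimes> star A (s e))) ?I = finsum A (\<lambda>e. \<zero>) ?I"
      using P_ss[OF C] that by (intro finsum_cong') auto
    moreover have "C \<inter> D = {}" using that by auto
    ultimately show ?thesis using eq by (simp add: P_empty minus_eq)
  qed
qed

lemma gap_mult: assumes D: "D \<in> atoms" and D': "D' \<in> atoms"
  shows "gap D \<otimes> gap D' = (if D = D' then gap D else \<zero>)"
proof -
  let ?I = "{e \<in> E0. src G e \<in> D}"
  have "gap D \<otimes> gap D' = P D \<otimes> gap D' \<ominus> finsum A (\<lambda>e. s e \<otimes> star A (s e)) ?I \<otimes> gap D'"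
    unfolding gap_def[of D] using D' atoms_diffs[OF D] by (intro mult_minus_left) auto
  also have "finsum A (\<lambda>e. s e \<otimes> star A (s e)) ?I \<otimes> gap D' = finsum A (\<lambda>e. s e \<otimes> star A (s e) \<otimes> gap D') ?I"
    using D' by (intro finsum_mult_right) (auto simp: finite_E0_sub)
  also have "\<dots> = finsum A (\<lambda>e. \<zero>) ?I"
    using D' s_star_gap[OF D'] by (intro finsum_cong') (auto simp: mult_assoc)
  finally have "gap D \<otimes> gap D' = P D \<otimes> gap D'" using D D' atoms_diffs[OF D] by (simp add: minus_eq_scale mult_closed)
  then show ?thesis using P_gap[OF D' atoms_diffs[OF D]] atom_disjoint[OF D' D] by auto
qed

lemma p_gap: assumes D: "D \<in> atoms" and Z: "Z \<in> gen_verts G" and sub: "D \<subseteq> Z" shows "p Z \<otimes> gap D = gap D"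
  using P_gap(1)[OF D gen_diffs[OF Z] sub] P_gen[OF Z] by simp

text \<open>A dead atom is a vertex that emits chosen edges and no others; the relation at regular
  vertices then equates its projection with the subtracted sum.\<close>

definition live :: "'v set \<Rightarrow> bool" where
  "live D \<longleftrightarrow> (\<forall>e\<in>E0. src G e \<notin> D) \<or> (\<exists>f\<in>edges G - E0. src G f \<in> D)"

lemma gap_dead: assumes D: "D \<in> atoms" and dead: "\<not> live D" shows "gap D = \<zero>"
proof -
  obtain e where e: "e \<in> E0" "src G e \<in> D" using dead unfolding live_def by blast
  have Dv: "D = {src G e}" using atom_src[OF D e] .
  have sub: "emitted G {src G e} \<subseteq> E0" using dead Dv unfolding live_def emitted_def by auto
  have "is_regular G (src G e)"
    unfolding is_regular_def using edgeD(1)[of e] E0_edges[OF e(1)] finite_subset[OF sub E0(1)] by (auto simp: emitted_def)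
  then have "p D = finsum A (\<lambda>e. s e \<otimes> star A (s e)) (emitted G {src G e})" using p_regular Dv by simp
  moreover have "emitted G {src G e} = {e \<in> E0. src G e \<in> D}" using sub Dv unfolding emitted_def by auto
  moreover have "P D = p D" using Dv e P_gen by simp
  ultimately show ?thesis unfolding gap_def by (simp add: minus_eq r_neg)
qed

section \<open>Transport of gap projections along paths\<close>

primrec lmul :: "'e list \<Rightarrow> 'a \<Rightarrow> 'a" where
  "lmul [] x = x"
| "lmul (e # \<alpha>) x = s e \<otimes> lmul \<alpha> x"

text \<open>Right multiplication by the adjoint of the word \<open>\<beta>\<close>, defined through
  the involution so that its laws follow from those of \<open>lmul\<close>.\<close>

definition rmul :: "'e list \<Rightarrow> 'a \<Rightarrow> 'a" where
  "rmul \<beta> x = star A (lmul \<beta> (star A x))"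

lemma lmul_closed [simp]: "set \<alpha> \<subseteq> E0 \<Longrightarrow> x \<in> carrier A \<Longrightarrow> lmul \<alpha> x \<in> carrier A"
  by (induction \<alpha>) (auto simp: mult_closed)

lemma rmul_closed [simp]: "set \<alpha> \<subseteq> E0 \<Longrightarrow> x \<in> carrier A \<Longrightarrow> rmul \<alpha> x \<in> carrier A"
  by (simp add: rmul_def star_closed)

lemma lmul_mult: "set \<alpha> \<subseteq> E0 \<Longrightarrow> x \<in> carrier A \<Longrightarrow> y \<in> carrier A \<Longrightarrow> lmul \<alpha> (x \<otimes> y) = lmul \<alpha> x \<otimes> y"
  by (induction \<alpha>) (auto simp: mult_assoc)

lemma rmul_mult: "set \<alpha> \<subseteq> E0 \<Longrightarrow> x \<in> carrier A \<Longrightarrow> y \<in> carrier A \<Longrightarrow> rmul \<alpha> (x \<otimes> y) = x \<otimes> rmul \<alpha> y"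
  by (simp add: rmul_def star_mult lmul_mult star_closed star_star)

lemma lmul_add: "set \<alpha> \<subseteq> E0 \<Longrightarrow> x \<in> carrier A \<Longrightarrow> y \<in> carrier A \<Longrightarrow> lmul \<alpha> (x \<oplus> y) = lmul \<alpha> x \<oplus> lmul \<alpha> y"
  by (induction \<alpha>) (auto simp: distr_left)

lemma lmul_scale: "set \<alpha> \<subseteq> E0 \<Longrightarrow> x \<in> carrier A \<Longrightarrow> lmul \<alpha> (a \<odot> x) = a \<odot> lmul \<alpha> x"
  by (induction \<alpha>) (auto simp: scale_mult_right)

lemma lmul_zero: "set \<alpha> \<subseteq> E0 \<Longrightarrow> lmul \<alpha> \<zero> = \<zero>"
  by (induction \<alpha>) auto

lemma rmul_add: "set \<alpha> \<subseteq> E0 \<Longrightarrow> x \<in> carrier A \<Longrightarrow> y \<in> carrier A \<Longrightarrow> rmul \<alpha> (x \<oplus> y) = rmul \<alpha> x \<oplus> rmul \<alpha> y"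
  by (simp add: rmul_def star_add lmul_add star_closed)

lemma rmul_scale: "set \<alpha> \<subseteq> E0 \<Longrightarrow> x \<in> carrier A \<Longrightarrow> rmul \<alpha> (a \<odot> x) = a \<odot> rmul \<alpha> x"
  by (simp add: rmul_def star_scale lmul_scale star_closed)

lemma lmul_append: "lmul (\<alpha> @ \<beta>) x = lmul \<alpha> (lmul \<beta> x)"
  by (induction \<alpha>) auto

lemma rmul_append: "set \<alpha> \<subseteq> E0 \<Longrightarrow> set \<beta> \<subseteq> E0 \<Longrightarrow> x \<in> carrier A \<Longrightarrow> rmul (\<alpha> @ \<beta>) x = rmul \<alpha> (rmul \<beta> x)"
  by (simp add: rmul_def lmul_append star_star star_closed)

text \<open>The empty path leads to every set, so that an atom itself can be a matrix unit index
  without transport.\<close>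

definition path_to :: "'e list \<Rightarrow> 'v set \<Rightarrow> bool" where
  "path_to \<alpha> D \<longleftrightarrow> \<alpha> = [] \<or> is_path G \<alpha> \<and> set \<alpha> \<subseteq> E0 \<and> D \<subseteq> path_rng G \<alpha>"

lemma path_to_set: "path_to \<alpha> D \<Longrightarrow> set \<alpha> \<subseteq> E0"
  unfolding path_to_def by auto

lemma path_to_Nil [simp]: "path_to [] D" unfolding path_to_def by simp

lemma path_to_Cons: "path_to (e # \<alpha>) D \<longleftrightarrow>
    e \<in> E0 \<and> path_to \<alpha> D \<and> (if \<alpha> = [] then D \<subseteq> rng G e else src G (hd \<alpha>) \<in> rng G e)"
  unfolding path_to_def by (auto simp: is_path_Cons path_rng_def)

lemma p_lmul_gap: assumes D: "D \<in> atoms" and \<alpha>: "path_to (e # \<alpha>) D" shows "p (rng G e) \<otimes> lmul \<alpha> (gap D) = lmul \<alpha> (gap D)"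
proof (cases \<alpha>)
  case Nil
  then show ?thesis using \<alpha> D by (simp add: path_to_Cons p_gap)
next
  case (Cons f \<beta>)
  have f: "f \<in> E0" "e \<in> E0" "set \<beta> \<subseteq> E0" "src G f \<in> rng G e" using \<alpha> path_to_set[OF \<alpha>] Cons by (auto simp: path_to_Cons)
  then have "p (rng G e) \<otimes> (s f \<otimes> lmul \<beta> (gap D)) = (p (rng G e) \<otimes> s f) \<otimes> lmul \<beta> (gap D)"
    using D p_rules(1)[OF rng_gen[of e]] by (simp add: mult_assoc)
  then show ?thesis using f Cons by (simp add: p_s)
qed

text \<open>Equal first edges cancel, because the range projection fixes the remainder; different
  ones are orthogonal; and when one word ends first, its gap projection annihilates the next edge of
  the other.\<close>

lemma lmul_gap_orth:
  assumes D: "D \<in> atoms" and D': "D' \<in> atoms"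
  shows "path_to \<beta> D \<Longrightarrow> path_to \<gamma> D' \<Longrightarrow>
    star A (lmul \<beta> (gap D)) \<otimes> lmul \<gamma> (gap D') = (if \<beta> = \<gamma> \<and> D = D' then gap D else \<zero>)"
proof (induction \<beta> arbitrary: \<gamma>)
  case Nil
  show ?case
  proof (cases \<gamma>)
    case Nil
    then show ?thesis using D D' by (simp add: gap_star gap_mult)
  next
    case (Cons f \<gamma>')
    then have f: "f \<in> E0" "set \<gamma>' \<subseteq> E0" using Nil.prems path_to_set[of \<gamma> D'] by auto
    then have "gap D \<otimes> (s f \<otimes> lmul \<gamma>' (gap D')) = (gap D \<otimes> s f) \<otimes> lmul \<gamma>' (gap D')"
      using D D' by (simp add: mult_assoc)
    then show ?thesis using Cons f D D' by (simp add: gap_star gap_s)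
  qed
next
  case (Cons e \<beta>)
  have e: "e \<in> E0" "set \<beta> \<subseteq> E0" "path_to \<beta> D" using Cons.prems(1) path_to_set[OF Cons.prems(1)] by (auto simp: path_to_Cons)
  note c = lmul_closed[OF e(2) gap_closed[OF D]]
  show ?case
  proof (cases \<gamma>)
    case Nil
    have "star A (s e \<otimes> lmul \<beta> (gap D)) \<otimes> gap D' = star A (lmul \<beta> (gap D)) \<otimes> (star A (s e) \<otimes> gap D')"
      using e c D' by (simp add: star_mult mult_assoc star_closed)
    then show ?thesis using Nil e c D' by (simp add: s_star_gap star_closed)
  next
    case \<gamma>: (Cons f \<gamma>')
    have f: "f \<in> E0" "set \<gamma>' \<subseteq> E0" "path_to \<gamma>' D'" using Cons.prems(2) \<gamma> path_to_set[of \<gamma> D'] by (auto simp: path_to_Cons)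
    note c' = lmul_closed[OF f(2) gap_closed[OF D']]
    have eq: "star A (lmul (e # \<beta>) (gap D)) \<otimes> lmul \<gamma> (gap D')
      = star A (lmul \<beta> (gap D)) \<otimes> ((star A (s e) \<otimes> s f) \<otimes> lmul \<gamma>' (gap D'))"
      unfolding \<gamma> using e f c c' by (simp add: star_mult mult_assoc star_closed mult_closed)
    show ?thesis
    proof (cases "e = f")
      case True
      then have "(star A (s e) \<otimes> s f) \<otimes> lmul \<gamma>' (gap D') = lmul \<gamma>' (gap D')"
        using e p_lmul_gap[OF D', of f \<gamma>'] Cons.prems(2) \<gamma> by (simp add: s_star_s)
      then show ?thesis using eq Cons.IH[OF e(3) f(3)] True \<gamma> by simp
    next
      case False
      then show ?thesis using eq e f c c' \<gamma> by (simp add: s_star_s_orth star_closed)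
    qed
  qed
qed

section \<open>Products along a cycle\<close>

primrec around :: "'v \<Rightarrow> nat \<Rightarrow> 'a" where
  "around v 0 = p {v}"
| "around v (Suc k) = s (en v) \<otimes> around (nx v) k"

lemma singleton_gen: "on_cycle G v \<Longrightarrow> {v} \<in> gen_verts G"
  by (intro gen_verts.vertex on_cycle_verts)

text \<open>A cycle vertex emits one edge into one vertex, so the relation at regular vertices makes
  \<open>s (en v)\<close> a unitary between the corners at \<open>v\<close> and
  \<open>nx v\<close>.\<close>

lemma s_en: assumes v: "on_cycle G v"
  shows "s (en v) \<in> carrier A" "s (en v) \<otimes> star A (s (en v)) = p {v}" "star A (s (en v)) \<otimes> s (en v) = p {nx v}"
    "p {v} \<otimes> s (en v) = s (en v)" "s (en v) \<otimes> p {nx v} = s (en v)"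
proof -
  note en = on_cycle_en[OF v]
  show c: "s (en v) \<in> carrier A" using en by simp
  have "p {v} = finsum A (\<lambda>e. s e \<otimes> star A (s e)) {en v}"
    using p_regular[OF on_cycle_regular[OF v]] on_cycle_step(1)[OF v] by simp
  also have "\<dots> = s (en v) \<otimes> star A (s (en v))"
    using c by (intro finsum_delta[where f="\<lambda>e. s e \<otimes> star A (s e)"]) (auto simp: mult_closed star_closed)
  finally show "s (en v) \<otimes> star A (s (en v)) = p {v}" by simp
  show "star A (s (en v)) \<otimes> s (en v) = p {nx v}" using s_star_s[OF en(1)] on_cycle_step(2)[OF v] by simp
  show "p {v} \<otimes> s (en v) = s (en v)" using p_src_s[OF en(1)] en(2) by simp
  show "s (en v) \<otimes> p {nx v} = s (en v)" using s_p_rng[OF en(1)] on_cycle_step(2)[OF v] by simp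
qed

lemma p_single: "on_cycle G v \<Longrightarrow> p {v} \<in> carrier A" "on_cycle G v \<Longrightarrow> star A (p {v}) = p {v}"
  "on_cycle G v \<Longrightarrow> p {v} \<otimes> p {v} = p {v}"
  using p_rules(1-3)[OF singleton_gen] by auto

lemma around_closed [simp]: "on_cycle G v \<Longrightarrow> around v k \<in> carrier A"
  by (induction k arbitrary: v) (auto simp: mult_closed s_en(1) on_cycle_step(3) p_single)

lemma around_left: "on_cycle G v \<Longrightarrow> p {v} \<otimes> around v k = around v k"
  using on_cycle_step(3)[of v] by (cases k) (simp_all add: p_single mult_assoc[symmetric] s_en)

lemma around_star_right: "on_cycle G v \<Longrightarrow> around v k \<otimes> star A (around v k) = p {v}"
proof (induction k arbitrary: v)
  case (Suc k)
  note nv = on_cycle_step(3)[OF Suc.prems]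
  have "around v (Suc k) \<otimes> star A (around v (Suc k)) = s (en v) \<otimes> (around (nx v) k \<otimes> star A (around (nx v) k)) \<otimes> star A (s (en v))"
    using nv s_en(1)[OF Suc.prems] by (simp add: star_mult mult_assoc mult_closed star_closed)
  then show ?case using Suc.IH[OF nv] s_en[OF Suc.prems] by simp
qed (simp add: p_single)

lemma around_star_left: "on_cycle G v \<Longrightarrow> star A (around v k) \<otimes> around v k = p {(nx ^^ k) v}"
proof (induction k arbitrary: v)
  case (Suc k)
  note nv = on_cycle_step(3)[OF Suc.prems]
  have "star A (around v (Suc k)) \<otimes> around v (Suc k) = star A (around (nx v) k) \<otimes> ((star A (s (en v)) \<otimes> s (en v)) \<otimes> around (nx v) k)"
    using nv s_en(1)[OF Suc.prems] by (simp add: star_mult mult_assoc mult_closed star_closed)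
  then show ?case using Suc.IH[OF nv] s_en(3)[OF Suc.prems] around_left[OF nv] by (simp add: funpow_swap1)
qed (simp add: p_single)

lemma around_add: "on_cycle G v \<Longrightarrow> around v (a + b) = around v a \<otimes> around ((nx ^^ a) v) b"
proof (induction a arbitrary: v)
  case 0 then show ?case by (simp add: around_left)
next
  case (Suc a)
  note nv = on_cycle_step(3)[OF Suc.prems]
  show ?case using Suc.IH[OF nv] s_en(1)[OF Suc.prems] nv on_cycle_funpow[OF nv, of a]
    by (simp add: mult_assoc funpow_swap1)
qed

text \<open>A common continuation of length \<open>c\<close> cancels, because the product of
  \<open>around x c\<close> with its adjoint is \<open>p {x}\<close>.\<close>

lemma around_shift:
  assumes v: "on_cycle G v" and w: "on_cycle G w" and eq: "(nx ^^ a) v = (nx ^^ b) w"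
  shows "around v (a + c) \<otimes> star A (around w (b + c)) = around v a \<otimes> star A (around w b)"
proof -
  define x where "x = (nx ^^ a) v"
  have x: "on_cycle G x" "(nx ^^ b) w = x" using on_cycle_funpow[OF v, of a] eq by (simp_all add: x_def)
  have "around v (a + c) \<otimes> star A (around w (b + c)) = around v a \<otimes> ((around x c \<otimes> star A (around x c)) \<otimes> star A (around w b))"
    unfolding around_add[OF v] around_add[OF w] x(2) x_def[symmetric] using v w x
    by (simp add: star_mult mult_assoc mult_closed star_closed)
  also have "(around x c \<otimes> star A (around x c)) \<otimes> star A (around w b) = star A (around w b \<otimes> p {x})"
    using w x by (simp add: around_star_right star_mult p_single)
  also have "around w b \<otimes> p {x} = around w b"
    using around_add[OF w, of b 0] x by simp
  finally show ?thesis .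
qed

end

section \<open>Matrix units\<close>

context finite_stage
begin

text \<open>The integer is the degree along a cycle; it is \<open>0\<close> away from the cycles. Dead atoms are
  excluded because their gap projection vanishes.\<close>

definition mid :: "'v set \<Rightarrow> int \<Rightarrow> 'v set \<Rightarrow> bool" where
  "mid D m D' \<longleftrightarrow> D \<in> atoms \<and> D' \<in> atoms \<and> live D \<and> live D' \<and>
     (m = 0 \<and> D = D' \<or> (\<exists>v\<in>K0. \<exists>w\<in>K0. D = {v} \<and> D' = {w} \<and> (\<exists>a b. m = int a - int b \<and> (nx ^^ a) v = (nx ^^ b) w)))"

text \<open>Reduced form without common continuation: for \<open>m\<close> different from
  \<open>0\<close> one factor is \<open>around\<close> of length \<open>0\<close>, a vertex
  projection. The two branches fit together since \<open>gap {v} = p {v}\<close> on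
  \<open>K0\<close>.\<close>

definition core :: "'v set \<Rightarrow> int \<Rightarrow> 'v set \<Rightarrow> 'a" where
  "core D m D' = (if m = 0 then gap D
     else around (the_elem D) (nat m) \<otimes> star A (around (the_elem D') (nat (- m))))"

lemma K0_atoms: "v \<in> K0 \<Longrightarrow> {v} \<in> atoms"
  using atom_singleton F_K0 by blast

lemma K0_no_E0: "v \<in> K0 \<Longrightarrow> e \<in> E0 \<Longrightarrow> src G e \<noteq> v"
  using K0(2) E0(2) unfolding transient_def by auto

lemma K0_live: "v \<in> K0 \<Longrightarrow> live {v}"
  using K0_no_E0 unfolding live_def by auto

lemma gap_K0: assumes v: "v \<in> K0" shows "gap {v} = p {v}"
proof -
  have "{e \<in> E0. src G e \<in> {v}} = {}" using K0_no_E0[OF v] by auto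
  then have "gap {v} = P {v} \<ominus> \<zero>" unfolding gap_def by (simp only: finsum_empty)
  then show ?thesis using P_gen[OF singleton_gen[OF K0(2)[OF v]]] p_single[OF K0(2)[OF v]]
    by (simp add: minus_eq_scale)
qed

text \<open>The right-hand side depends on \<open>a\<close> and \<open>b\<close> only through their
  difference: injectivity of \<open>nx\<close> allows the common part to be stripped by
  \<open>around_shift\<close>.\<close>

lemma core_cycle:
  assumes v: "v \<in> K0" and w: "w \<in> K0" and eq: "(nx ^^ a) v = (nx ^^ b) w"
  shows "core {v} (int a - int b) {w} = around v a \<otimes> star A (around w b)"
proof -
  note ocv = K0(2)[OF v] and ocw = K0(2)[OF w]
  define m where "m = int a - int b"
  \<comment> \<open>Splits off the shared length, leaving the positive and negative parts of
    \<open>m\<close>.\<close>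
  define c where "c = min a b"
  have ab: "a = nat m + c" "b = nat (- m) + c" unfolding m_def c_def by auto
  have "(nx ^^ c) ((nx ^^ nat m) v) = (nx ^^ c) ((nx ^^ nat (- m)) w)"
    using eq unfolding ab by (simp add: funpow_add[symmetric, THEN fun_cong, unfolded comp_def] add.commute)
  then have base: "(nx ^^ nat m) v = (nx ^^ nat (- m)) w"
    using nx_funpow_inj[OF on_cycle_funpow[OF ocv] on_cycle_funpow[OF ocw]] by blast
  have "around v a \<otimes> star A (around w b) = around v (nat m) \<otimes> star A (around w (nat (- m)))"
    unfolding ab by (rule around_shift[OF ocv ocw base])
  also have "\<dots> = core {v} m {w}"
  proof (cases "m = 0")
    case True
    then have "v = w" using base by simp
    then show ?thesis using True gap_K0[OF v] p_single[OF ocv] by (simp add: core_def)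
  qed (simp add: core_def)
  finally show ?thesis unfolding m_def by simp
qed

text \<open>Vertices of \<open>K0\<close> always fall under the cyclic case, even for
  \<open>m = 0\<close>, where \<open>mid\<close> admits both readings.\<close>

lemma mid_cases:
  assumes "mid D m D'"
  obtains (trivial) "m = 0" "D = D'" "\<forall>v\<in>K0. D \<noteq> {v}"
  | (cycle) v w a b where "v \<in> K0" "w \<in> K0" "D = {v}" "D' = {w}" "m = int a - int b" "(nx ^^ a) v = (nx ^^ b) w"
proof (cases "\<exists>v\<in>K0. \<exists>w\<in>K0. D = {v} \<and> D' = {w} \<and> (\<exists>a b. m = int a - int b \<and> (nx ^^ a) v = (nx ^^ b) w)")
  case True
  then show ?thesis using cycle by blast
next
  case False
  then have "m = 0" "D = D'" using assms unfolding mid_def by auto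
  moreover have "D \<noteq> {v}" if "v \<in> K0" for v
    using False that \<open>m = 0\<close> \<open>D = D'\<close> by (metis diff_self funpow_0)
  ultimately show ?thesis using trivial by blast
qed

lemma mid_cycle: "v \<in> K0 \<Longrightarrow> w \<in> K0 \<Longrightarrow> (nx ^^ a) v = (nx ^^ b) w \<Longrightarrow> mid {v} (int a - int b) {w}"
  unfolding mid_def using K0_atoms K0_live by blast

lemma mid_refl: "D \<in> atoms \<Longrightarrow> live D \<Longrightarrow> mid D 0 D"
  unfolding mid_def by simp

lemma midD: "mid D m D' \<Longrightarrow> D \<in> atoms" "mid D m D' \<Longrightarrow> D' \<in> atoms" "mid D m D' \<Longrightarrow> live D" "mid D m D' \<Longrightarrow> live D'"
  unfolding mid_def by auto

lemma core_0 [simp]: "core D 0 D' = gap D"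
  by (simp add: core_def)

lemma core_closed [simp]: assumes "mid D m D'" shows "core D m D' \<in> carrier A"
  using assms
proof (cases rule: mid_cases)
  case trivial
  then show ?thesis using midD(1)[OF assms] by simp
next
  case (cycle v w a b)
  then show ?thesis using core_cycle[OF cycle(1,2,6)] K0(2) by (simp add: mult_closed star_closed)
qed

lemma core_mult:
  assumes 1: "mid D m D'" and 2: "mid D' m' D''"
  shows "mid D (m + m') D''" "core D m D' \<otimes> core D' m' D'' = core D (m + m') D''"
proof -
  have "mid D (m + m') D'' \<and> core D m D' \<otimes> core D' m' D'' = core D (m + m') D''"
    using 1
  proof (cases rule: mid_cases)
    case trivial
    with 2 have "m' = 0" "D' = D''" by (auto elim: mid_cases)
    then show ?thesis using trivial 1 midD[OF 1] by (simp add: gap_mult)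
  next
    case (cycle v w a b)
    from 2 obtain x c d where 3: "x \<in> K0" "D'' = {x}" "m' = int c - int d" "(nx ^^ c) w = (nx ^^ d) x"
      by (rule mid_cases) (use cycle in auto)
    note oc = K0(2)[OF cycle(1)] K0(2)[OF cycle(2)] K0(2)[OF 3(1)]
    \<comment> \<open>Both factors are brought to the common length \<open>b + c\<close> at
      \<open>w\<close>, so that the inner terms cancel.\<close>
    have mm: "m + m' = int (a + c) - int (d + b)" using cycle(5) 3(3) by simp
    have e1: "(nx ^^ (a + c)) v = (nx ^^ (b + c)) w"
      using arg_cong[OF cycle(6), of "nx ^^ c"] by (simp add: funpow_add add.commute[of _ c])
    have e2: "(nx ^^ (b + c)) w = (nx ^^ (d + b)) x"
      using arg_cong[OF 3(4), of "nx ^^ b"] by (simp add: funpow_add add.commute[of d])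
    have "core D m D' = around v (a + c) \<otimes> star A (around w (b + c))"
      using core_cycle[OF cycle(1,2) e1] cycle by simp
    moreover have "core D' m' D'' = around w (b + c) \<otimes> star A (around x (d + b))"
      using core_cycle[OF cycle(2) 3(1) e2] cycle 3 by simp
    moreover have "core D (m + m') D'' = around v (a + c) \<otimes> star A (around x (d + b))"
      using core_cycle[OF cycle(1) 3(1), of "a + c" "d + b"] e1 e2 cycle(3) 3(2) unfolding mm by simp
    moreover have "around v (a + c) \<otimes> star A (around w (b + c)) \<otimes> (around w (b + c) \<otimes> star A (around x (d + b)))
       = (around v (a + c) \<otimes> (star A (around w (b + c)) \<otimes> around w (b + c))) \<otimes> star A (around x (d + b))"
      using oc by (simp add: mult_assoc mult_closed star_closed)
    moreover have "around v (a + c) \<otimes> (star A (around w (b + c)) \<otimes> around w (b + c)) = around v (a + c)"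
      using around_star_left[OF oc(2), of "b + c"] around_add[OF oc(1), of "a + c" 0] e1 by simp
    moreover have "mid D (m + m') D''"
      using mid_cycle[OF cycle(1) 3(1), of "a + c" "d + b"] e1 e2 cycle(3) 3(2) unfolding mm by simp
    ultimately show ?thesis by simp
  qed
  then show "mid D (m + m') D''" "core D m D' \<otimes> core D' m' D'' = core D (m + m') D''" by auto
qed

lemma core_star:
  assumes 1: "mid D m D'"
  shows "mid D' (- m) D" "star A (core D m D') = core D' (- m) D"
proof -
  have "mid D' (- m) D \<and> star A (core D m D') = core D' (- m) D"
    using 1
  proof (cases rule: mid_cases)
    case trivial
    then show ?thesis using 1 midD[OF 1] by (simp add: gap_star)
  next
    case (cycle v w a b)
    note oc = K0(2)[OF cycle(1)] K0(2)[OF cycle(2)]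
    have "core D' (- m) D = around w b \<otimes> star A (around v a)"
      using core_cycle[OF cycle(2,1), of b a] cycle by simp
    moreover have "star A (core D m D') = around w b \<otimes> star A (around v a)"
      using core_cycle[OF cycle(1,2,6)] cycle oc by (simp add: star_mult star_star star_closed)
    moreover have "mid D' (- m) D" using mid_cycle[OF cycle(2,1), of b a] cycle by simp
    ultimately show ?thesis by simp
  qed
  then show "mid D' (- m) D" "star A (core D m D') = core D' (- m) D" by auto
qed

lemma core_gap: assumes "mid D m D'" shows "gap D \<otimes> core D m D' = core D m D'" "core D m D' \<otimes> gap D' = core D m D'"
  using core_mult(2)[OF mid_refl assms] core_mult(2)[OF assms mid_refl] midD[OF assms] by simp_all

type_synonym ('x, 'y) index = "'y list \<times> 'x set \<times> int \<times> 'x set \<times> 'y list"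

definition indices :: "nat \<Rightarrow> ('v, 'e) index set" where
  "indices n = {(\<alpha>, D, m, D', \<beta>). path_to \<alpha> D \<and> path_to \<beta> D' \<and> mid D m D' \<and> \<bar>m\<bar> \<le> int n}"

text \<open>The degree sits in the left factor, while the right one carries \<open>gap D'\<close>,
  which \<open>core D m D'\<close> absorbs; so the formula is symmetric under the involution despite
  its look.\<close>

definition matrix_unit :: "('v, 'e) index \<Rightarrow> 'a" where
  "matrix_unit = (\<lambda>(\<alpha>, D, m, D', \<beta>). lmul \<alpha> (core D m D') \<otimes> star A (lmul \<beta> (gap D')))"

lemma matrix_unit_closed: "i \<in> indices n \<Longrightarrow> matrix_unit i \<in> carrier A"
  using path_to_set midD by (auto simp: indices_def matrix_unit_def intro!: mult_closed star_closed lmul_closed gap_closed)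

lemma matrix_unit_image: "matrix_unit ` indices n \<subseteq> carrier A"
  using matrix_unit_closed by auto

lemma lmul_core: assumes "path_to \<alpha> D" "mid D m D'" shows "lmul \<alpha> (core D m D') = lmul \<alpha> (gap D) \<otimes> core D m D'"
proof -
  have "lmul \<alpha> (gap D \<otimes> core D m D') = lmul \<alpha> (gap D) \<otimes> core D m D'"
    by (rule lmul_mult) (use assms midD path_to_set in auto)
  then show ?thesis using core_gap(1)[OF assms(2)] by simp
qed

text \<open>The two adjacent words collapse to a gap projection or to zero, and the degrees of the
  cores add.\<close>

lemma matrix_unit_mult:
  assumes i: "(\<alpha>, D, m, D', \<beta>) \<in> indices n" and j: "(\<gamma>, C, m', C', \<delta>) \<in> indices n'"
  shows "matrix_unit (\<alpha>, D, m, D', \<beta>) \<otimes> matrix_unit (\<gamma>, C, m', C', \<delta>) =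
    (if \<beta> = \<gamma> \<and> D' = C then matrix_unit (\<alpha>, D, m + m', C', \<delta>) else \<zero>)"
proof -
  have I: "path_to \<alpha> D" "path_to \<beta> D'" "mid D m D'" and J: "path_to \<gamma> C" "path_to \<delta> C'" "mid C m' C'"
    using i j unfolding indices_def by auto
  note sub = path_to_set[OF I(1)] path_to_set[OF I(2)] path_to_set[OF J(1)] path_to_set[OF J(2)]
  note c = lmul_closed[OF sub(1) core_closed[OF I(3)]] lmul_closed[OF sub(2) gap_closed[OF midD(2)[OF I(3)]]]
    lmul_closed[OF sub(3) gap_closed[OF midD(1)[OF J(3)]]] core_closed[OF J(3)]
    lmul_closed[OF sub(4) gap_closed[OF midD(2)[OF J(3)]]]
  have "matrix_unit (\<alpha>, D, m, D', \<beta>) \<otimes> matrix_unit (\<gamma>, C, m', C', \<delta>) =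
    lmul \<alpha> (core D m D') \<otimes> ((star A (lmul \<beta> (gap D')) \<otimes> lmul \<gamma> (gap C)) \<otimes> (core C m' C' \<otimes> star A (lmul \<delta> (gap C'))))"
    unfolding matrix_unit_def prod.case lmul_core[OF J(1,3)] using c by (simp add: mult_assoc mult_closed star_closed)
  also have "star A (lmul \<beta> (gap D')) \<otimes> lmul \<gamma> (gap C) = (if \<beta> = \<gamma> \<and> D' = C then gap D' else \<zero>)"
    by (rule lmul_gap_orth) (use I J midD in auto)
  finally have eq: "matrix_unit (\<alpha>, D, m, D', \<beta>) \<otimes> matrix_unit (\<gamma>, C, m', C', \<delta>) =
    lmul \<alpha> (core D m D') \<otimes> ((if \<beta> = \<gamma> \<and> D' = C then gap D' else \<zero>) \<otimes> (core C m' C' \<otimes> star A (lmul \<delta> (gap C'))))" .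
  show ?thesis
  proof (cases "\<beta> = \<gamma> \<and> D' = C")
    case True
    then have "lmul \<alpha> (core D m D') \<otimes> (gap D' \<otimes> (core C m' C' \<otimes> star A (lmul \<delta> (gap C'))))
      = lmul \<alpha> (core D m D') \<otimes> ((gap C \<otimes> core C m' C') \<otimes> star A (lmul \<delta> (gap C')))"
      using c midD(1)[OF J(3)] by (simp add: mult_assoc star_closed)
    also have "\<dots> = (lmul \<alpha> (core D m D') \<otimes> core C m' C') \<otimes> star A (lmul \<delta> (gap C'))"
      using c core_gap(1)[OF J(3)] by (simp add: mult_assoc star_closed)
    also have "lmul \<alpha> (core D m D') \<otimes> core C m' C' = lmul \<alpha> (core D (m + m') C')"
      using lmul_mult[OF sub(1) core_closed[OF I(3)] c(4)] core_mult(2)[of D m D' m' C'] I(3) J(3) True by simp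
    finally show ?thesis
      using True eq by (simp add: matrix_unit_def)
  next
    case False
    with eq c show ?thesis by (auto simp: star_closed mult_closed)
  qed
qed

lemma matrix_unit_star:
  assumes i: "(\<alpha>, D, m, D', \<beta>) \<in> indices n"
  shows "star A (matrix_unit (\<alpha>, D, m, D', \<beta>)) = matrix_unit (\<beta>, D', - m, D, \<alpha>)"
proof -
  have I: "path_to \<alpha> D" "path_to \<beta> D'" "mid D m D'" using i unfolding indices_def by auto
  note sub = path_to_set[OF I(1)] path_to_set[OF I(2)]
  note c = lmul_closed[OF sub(1) gap_closed[OF midD(1)[OF I(3)]]] lmul_closed[OF sub(2) gap_closed[OF midD(2)[OF I(3)]]] core_closed[OF I(3)]
  have "star A (matrix_unit (\<alpha>, D, m, D', \<beta>)) = lmul \<beta> (gap D') \<otimes> (star A (core D m D') \<otimes> star A (lmul \<alpha> (gap D)))"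
    unfolding matrix_unit_def prod.case lmul_core[OF I(1,3)]
    using c by (simp add: star_mult star_star star_closed mult_closed)
  also have "\<dots> = (lmul \<beta> (gap D') \<otimes> core D' (- m) D) \<otimes> star A (lmul \<alpha> (gap D))"
    using c core_star[OF I(3)] core_closed[OF core_star(1)[OF I(3)]] by (simp add: mult_assoc star_closed)
  also have "\<dots> = matrix_unit (\<beta>, D', - m, D, \<alpha>)"
    unfolding matrix_unit_def prod.case lmul_core[OF I(2) core_star(1)[OF I(3)]] ..
  finally show ?thesis .
qed

section \<open>The filtration by degree\<close>

definition stage :: "nat \<Rightarrow> 'a set" where
  "stage n = lspan A (matrix_unit ` indices n)"

lemma stage_subset: "stage n \<subseteq> carrier A"
  unfolding stage_def using lspan_closed[OF matrix_unit_image] by blast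

lemma stage_mono: assumes "n \<le> n'" shows "stage n \<subseteq> stage n'"
proof -
  have "indices n \<subseteq> indices n'" using assms unfolding indices_def by auto
  then show ?thesis unfolding stage_def using lspan_mono[OF _ image_mono] by blast
qed

lemma matrix_unit_imageE:
  assumes "b \<in> matrix_unit ` indices n"
  obtains \<alpha> D k D' \<beta> where "b = matrix_unit (\<alpha>, D, k, D', \<beta>)" "(\<alpha>, D, k, D', \<beta>) \<in> indices n"
proof -
  obtain i where i: "i \<in> indices n" "b = matrix_unit i" using assms by (rule imageE)
  obtain \<alpha> D k D' \<beta> where "i = (\<alpha>, D, k, D', \<beta>)" by (cases i)
  then show thesis using i that by simp
qed

lemma stage_mult: assumes "x \<in> stage m" "y \<in> stage n" shows "x \<otimes> y \<in> stage (m + n)"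
  using assms unfolding stage_def
proof (rule lspan_mult[OF matrix_unit_image[of m] matrix_unit_image[of n] matrix_unit_image[of "m + n"]])
  fix b c assume bc: "b \<in> matrix_unit ` indices m" "c \<in> matrix_unit ` indices n"
  obtain \<alpha> D k D' \<beta> where b: "b = matrix_unit (\<alpha>, D, k, D', \<beta>)" "(\<alpha>, D, k, D', \<beta>) \<in> indices m"
    using bc(1) by (rule matrix_unit_imageE)
  obtain \<gamma> C k' C' \<delta> where c: "c = matrix_unit (\<gamma>, C, k', C', \<delta>)" "(\<gamma>, C, k', C', \<delta>) \<in> indices n"
    using bc(2) by (rule matrix_unit_imageE)
  show "b \<otimes> c \<in> lspan A (matrix_unit ` indices (m + n))"
  proof (cases "\<beta> = \<gamma> \<and> D' = C")
    case True
    then have "(\<alpha>, D, k + k', C', \<delta>) \<in> indices (m + n)"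
      using b(2) c(2) core_mult(1)[of D k D' k' C'] unfolding indices_def by auto
    then show ?thesis using True unfolding b(1) c(1) matrix_unit_mult[OF b(2) c(2)]
      by (simp add: lspan_base[OF matrix_unit_image])
  next
    case False
    then show ?thesis unfolding b(1) c(1) matrix_unit_mult[OF b(2) c(2)] by (auto simp: lspan.zero)
  qed
qed

lemma stage_star: assumes "x \<in> stage n" shows "star A x \<in> stage n"
  using assms unfolding stage_def
proof (rule lspan_star[OF matrix_unit_image[of n] matrix_unit_image[of n]])
  fix b assume "b \<in> matrix_unit ` indices n"
  then obtain \<alpha> D k D' \<beta> where b: "b = matrix_unit (\<alpha>, D, k, D', \<beta>)" "(\<alpha>, D, k, D', \<beta>) \<in> indices n"
    by (rule matrix_unit_imageE)
  then have "(\<beta>, D', - k, D, \<alpha>) \<in> indices n" using core_star(1)[of D k D'] unfolding indices_def by auto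
  then show "star A b \<in> lspan A (matrix_unit ` indices n)"
    using b matrix_unit_star by (simp add: lspan_base[OF matrix_unit_image])
qed

text \<open>An atom is nonempty, and every nonempty path to it has any given vertex of the atom in
  its range.\<close>

lemma finite_paths_to: assumes "D \<in> atoms" shows "finite {\<alpha>. path_to \<alpha> D}"
proof -
  obtain v where v: "v \<in> D" using atom_ne[OF assms] by blast
  have "v \<in> verts G" using v gen_verts_subset_verts[OF ultragraph Union_F] assms unfolding atoms_def parts_def by auto
  from finite_transient_paths[OF this]
  have "finite (insert [] {\<alpha>. is_path G \<alpha> \<and> set \<alpha> \<subseteq> transient \<and> v \<in> path_rng G \<alpha>})" by simp
  then show ?thesis by (rule rev_finite_subset) (use v E0(2) in \<open>auto simp: path_to_def\<close>)
qed

text \<open>Of the five coordinates only the integer varies with \<open>n\<close>, over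
  \<open>2 * n + 1\<close> values; the others range over fixed finite sets.\<close>

lemma card_indices: "\<exists>c. \<forall>n. finite (indices n) \<and> real (card (indices n)) \<le> c * (real n + 1)"
proof -
  define W where "W = (\<Union>D\<in>atoms. {\<alpha>. path_to \<alpha> D})"
  have W: "finite W" unfolding W_def using finite_atoms finite_paths_to by simp
  define c where "c = card W * card atoms * card atoms * card W"
  have "finite (indices n) \<and> real (card (indices n)) \<le> 2 * c * (real n + 1)" for n
  proof -
    let ?R = "W \<times> atoms \<times> {- int n..int n} \<times> atoms \<times> W"
    have sub: "indices n \<subseteq> ?R"
      unfolding indices_def W_def by (auto dest: midD)
    have fin: "finite ?R" using W finite_atoms by simp
    have "card (indices n) \<le> card ?R" using card_mono[OF fin sub] .
    also have "card ?R = c * (2 * n + 1)"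
    proof -
      have "card {- int n..int n} = 2 * n + 1" unfolding card_atLeastAtMost_int by linarith
      then show ?thesis unfolding c_def by (simp only: card_cartesian_product ac_simps)
    qed
    finally have "real (card (indices n)) \<le> real (c * (2 * n + 1))" by (rule of_nat_mono)
    also have "\<dots> = real c * (2 * real n + 1)" by (simp add: algebra_simps)
    also have "\<dots> \<le> real c * (2 * (real n + 1))" by (intro mult_left_mono) auto
    finally show ?thesis using finite_subset[OF sub fin] by (simp add: algebra_simps)
  qed
  then show ?thesis by blast
qed

text \<open>\<open>P D\<close> is its gap projection plus ranges of chosen edges. Each such range is
  transported from the range of the edge, which is again cut into atoms, along words longer by one.
  Words to atoms have bounded length, so the expansion stops.\<close>

lemma lmul_P_rmul_in_stage:
  assumes "D \<in> atoms" "path_to \<alpha> D" "path_to \<beta> D"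
  shows "lmul \<alpha> (rmul \<beta> (P D)) \<in> stage 0"
proof -
  \<comment> \<open>One bound \<open>N\<close> exceeds the lengths of all words to atoms; the
    induction measures how far \<open>\<alpha>\<close> still is from it.\<close>
  have "finite (\<Union>D\<in>atoms. length ` {\<alpha>. path_to \<alpha> D})" using finite_atoms finite_paths_to by simp
  then obtain N where "\<forall>l\<in>\<Union>D\<in>atoms. length ` {\<alpha>. path_to \<alpha> D}. l < N"
    using finite_nat_set_iff_bounded by auto
  then have N: "\<And>D \<alpha>. D \<in> atoms \<Longrightarrow> path_to \<alpha> D \<Longrightarrow> length \<alpha> < N" by simp
  have "lmul \<alpha> (rmul \<beta> (P D)) \<in> stage 0"
    if "D \<in> atoms" "path_to \<alpha> D" "path_to \<beta> D" "N - length \<alpha> \<le> k" for D \<alpha> \<beta> k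
    using that
  proof (induction k arbitrary: D \<alpha> \<beta>)
    case 0
    then show ?case using N[of D \<alpha>] by simp
  next
    case (Suc k)
    note D = Suc.prems(1) and sub = path_to_set[OF Suc.prems(2)] path_to_set[OF Suc.prems(3)]
    let ?I = "{e \<in> E0. src G e \<in> D}" and ?\<Sigma> = "finsum A (\<lambda>e. s e \<otimes> star A (s e)) {e \<in> E0. src G e \<in> D}"
    let ?\<Phi> = "\<lambda>x. lmul \<alpha> (rmul \<beta> x)"
    have \<Phi>c: "?\<Phi> x \<in> carrier A" if "x \<in> carrier A" for x using that sub by simp
    have \<Phi>add: "?\<Phi> (x \<oplus> y) = ?\<Phi> x \<oplus> ?\<Phi> y" if "x \<in> carrier A" "y \<in> carrier A" for x y
      using that sub by (simp add: rmul_add lmul_add)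
    have gapin: "?\<Phi> (gap D) \<in> stage 0"
    proof (cases "live D")
      case True
      have "rmul \<beta> (gap D) = gap D \<otimes> star A (lmul \<beta> (gap D))"
        using rmul_mult[OF sub(2) gap_closed[OF D] gap_closed[OF D]] D by (simp add: gap_mult rmul_def gap_star)
      then have "?\<Phi> (gap D) = matrix_unit (\<alpha>, D, 0, D, \<beta>)"
        using D sub by (simp add: matrix_unit_def lmul_mult star_closed)
      moreover have "(\<alpha>, D, 0, D, \<beta>) \<in> indices 0"
        unfolding indices_def using Suc.prems mid_refl[OF D True] by simp
      ultimately show ?thesis unfolding stage_def by (simp add: lspan_base[OF matrix_unit_image])
    next
      case False
      then show ?thesis using gap_dead[OF D] sub by (simp add: rmul_def lmul_zero stage_def lspan.zero)
    qed
    have ext: "?\<Phi> (s e \<otimes> star A (s e)) \<in> stage 0" if e: "e \<in> ?I" for e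
    proof -
      have eE: "e \<in> E0" and De: "D = {src G e}" using e atom_src[OF D] by auto
      let ?\<Psi> = "\<lambda>x. lmul (\<alpha> @ [e]) (rmul (\<beta> @ [e]) x)"
      have sub': "set (\<alpha> @ [e]) \<subseteq> E0" "set (\<beta> @ [e]) \<subseteq> E0" using sub eE by auto
      \<comment> \<open>The atom \<open>D\<close> is the single vertex \<open>src G e\<close>, so
        every word to \<open>D\<close> continues by \<open>e\<close>.\<close>
      have pt: "path_to (\<gamma> @ [e]) C" if "path_to \<gamma> D" "C \<subseteq> rng G e" for \<gamma> C
        using that eE De unfolding path_to_def
        by (cases "\<gamma> = []") (auto simp: is_path_append path_rng_def is_path_Cons)
      have "?\<Psi> (p (rng G e)) \<in> lspan A (matrix_unit ` indices 0)"
      proof (rule lspan_linear_image[OF _ matrix_unit_image p_in_span_atoms[OF F_rng[OF eE]], where k="\<lambda>a. a"])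
        show "P ` {D \<in> atoms. D \<subseteq> rng G e} \<subseteq> carrier A" using atoms_diffs by auto
        show "\<And>x. x \<in> carrier A \<Longrightarrow> ?\<Psi> x \<in> carrier A" using sub' by (simp del: set_append)
        show "\<And>x y. x \<in> carrier A \<Longrightarrow> y \<in> carrier A \<Longrightarrow> ?\<Psi> (x \<oplus> y) = ?\<Psi> x \<oplus> ?\<Psi> y"
          using sub' by (simp add: rmul_add lmul_add del: set_append)
        show "\<And>a x. x \<in> carrier A \<Longrightarrow> ?\<Psi> (a \<odot> x) = a \<odot> ?\<Psi> x"
          using sub' by (simp add: rmul_scale lmul_scale del: set_append)
        fix b assume "b \<in> P ` {D \<in> atoms. D \<subseteq> rng G e}"
        then obtain C where C: "C \<in> atoms" "C \<subseteq> rng G e" "b = P C" by blast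
        have "?\<Psi> (P C) \<in> stage 0"
          using Suc.IH[OF C(1) pt[OF Suc.prems(2) C(2)] pt[OF Suc.prems(3) C(2)]] Suc.prems(4) by simp
        then show "?\<Psi> b \<in> lspan A (matrix_unit ` indices 0)" using C(3) unfolding stage_def by simp
      qed
      \<comment> \<open>The inserted projection \<open>p (rng G e)\<close> is absorbed by
        \<open>s e\<close>, so the longer words recover the range of \<open>e\<close>.\<close>
      moreover have "?\<Psi> (p (rng G e)) = ?\<Phi> (s e \<otimes> star A (s e))"
      proof -
        have "rmul [e] (p (rng G e)) = p (rng G e) \<otimes> star A (s e)"
          using eE p_rules[OF rng_gen[of e]] by (simp add: rmul_def star_mult star_star)
        also have "\<dots> = star A (s e)"
          using arg_cong[OF s_p_rng[of e], of "star A"] eE p_rules[OF rng_gen[of e]] by (simp add: star_mult)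
        finally have "rmul (\<beta> @ [e]) (p (rng G e)) = rmul \<beta> (star A (s e))"
          using eE sub p_rules(1)[OF rng_gen[of e]] by (simp add: rmul_append)
        moreover have "s e \<otimes> rmul \<beta> (star A (s e)) = rmul \<beta> (s e \<otimes> star A (s e))"
          using eE sub by (simp add: rmul_mult)
        ultimately show ?thesis by (simp add: lmul_append)
      qed
      ultimately show ?thesis unfolding stage_def by simp
    qed
    have "?\<Phi> ?\<Sigma> = finsum A (\<lambda>e. ?\<Phi> (s e \<otimes> star A (s e))) ?I"
      by (rule finsum_additive[OF finite_E0_sub ss_image abelian_group_axioms \<Phi>add \<Phi>c])
    moreover have "finsum A (\<lambda>e. ?\<Phi> (s e \<otimes> star A (s e))) ?I \<in> stage 0"
      unfolding stage_def by (rule lspan_finsum[OF matrix_unit_image finite_E0_sub]) (use ext in \<open>simp add: stage_def\<close>)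
    moreover have "P D = gap D \<oplus> ?\<Sigma>"
      unfolding gap_def using add_minus_cancel(2)[OF ss_sum_closed P_closed[OF atoms_diffs[OF D]]] by simp
    then have "?\<Phi> (P D) = ?\<Phi> (gap D) \<oplus> ?\<Phi> ?\<Sigma>" using \<Phi>add[OF gap_closed[OF D] ss_sum_closed] by simp
    ultimately show ?case using gapin unfolding stage_def by (simp add: lspan_add[OF matrix_unit_image])
  qed
  then show ?thesis using assms by blast
qed

lemma p_in_stage: assumes Z: "Z \<in> F" shows "p Z \<in> stage 0"
  unfolding stage_def
proof (rule lspan_trans[OF _ matrix_unit_image p_in_span_atoms[OF Z]])
  show "P ` {D \<in> atoms. D \<subseteq> Z} \<subseteq> carrier A" using atoms_diffs by auto
  fix b assume "b \<in> P ` {D \<in> atoms. D \<subseteq> Z}"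
  then obtain D where D: "D \<in> atoms" "b = P D" by blast
  show "b \<in> lspan A (matrix_unit ` indices 0)"
    using lmul_P_rmul_in_stage[OF D(1), of "[]" "[]"] D atoms_diffs[OF D(1)]
    by (simp add: rmul_def P_star stage_def)
qed

lemma s_in_stage: assumes e: "e \<in> E0" shows "s e \<in> stage 0"
proof -
  have "lmul [e] (p (rng G e)) \<in> lspan A (matrix_unit ` indices 0)"
  proof (rule lspan_linear_image[OF _ matrix_unit_image p_in_span_atoms[OF F_rng[OF e]], where k="\<lambda>a. a"])
    show "P ` {D \<in> atoms. D \<subseteq> rng G e} \<subseteq> carrier A" using atoms_diffs by auto
    fix b assume "b \<in> P ` {D \<in> atoms. D \<subseteq> rng G e}"
    then obtain D where D: "D \<in> atoms" "D \<subseteq> rng G e" "b = P D" by blast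
    then show "lmul [e] b \<in> lspan A (matrix_unit ` indices 0)"
      using lmul_P_rmul_in_stage[OF D(1), of "[e]" "[]"] e atoms_diffs[OF D(1)]
      by (simp add: rmul_def P_star path_to_Cons stage_def)
  qed (use e in \<open>auto simp: distr_left scale_mult_right mult_closed\<close>)
  then show ?thesis using s_p_rng[of e] e unfolding stage_def by simp
qed

text \<open>Among the generators only cycle edges need positive degree: such an edge is the matrix
  unit of degree \<open>1\<close> with empty words.\<close>

lemma s_en_in_stage: assumes v: "v \<in> K0" shows "s (en v) \<in> stage 1"
proof -
  note oc = K0(2)[OF v]
  have m: "mid {v} 1 {nx v}" using mid_cycle[OF v K0(3)[OF v], of 1 0] by simp
  have "core {v} 1 {nx v} = s (en v)"
    using core_cycle[OF v K0(3)[OF v], of 1 0] s_en[OF oc] p_single[OF on_cycle_step(3)[OF oc]]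
    by (simp add: mult_assoc)
  then have "matrix_unit ([], {v}, 1, {nx v}, []) = s (en v)"
    using core_gap(2)[OF m] gap_star[OF midD(2)[OF m]] by (simp add: matrix_unit_def)
  moreover have "([], {v}, 1, {nx v}, []) \<in> indices 1" using m unfolding indices_def by simp
  ultimately show ?thesis unfolding stage_def using lspan_base[OF matrix_unit_image] by (metis image_eqI)
qed

end

section \<open>Dual functionals\<close>

text \<open>Orthogonality of the characters of the cyclic group of order \<open>N\<close>, by a
  geometric sum; the bound on \<open>d\<close> keeps a nonzero \<open>d\<close> from being divisible
  by \<open>N\<close>.\<close>

lemma sum_roots_of_unity_powi:
  fixes d :: int assumes N: "N > 0" and d: "\<bar>d\<bar> < int N"
  shows "(\<Sum>k<N. (cis (2 * pi / N) ^ k) powi d) = (if d = 0 then of_nat N else 0)"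
proof -
  define \<zeta> where "\<zeta> = cis (2 * pi / N) powi d"
  have \<zeta>: "\<zeta> = cis (of_int d * (2 * pi / N))" unfolding \<zeta>_def by (rule cis_power_int)
  have eq: "(cis (2 * pi / N) ^ k) powi d = \<zeta> ^ k" for k
    unfolding \<zeta>_def by (simp add: power_int_power power_int_power' mult.commute)
  show ?thesis
  proof (cases "d = 0")
    case True then show ?thesis by simp
  next
    case False
    have "\<zeta> \<noteq> 1"
    proof
      assume "\<zeta> = 1"
      then have "cos (of_int d * (2 * pi / N)) = 1" unfolding \<zeta> by (metis cis.sel(1) one_complex.sel(1))
      then obtain j :: int where "of_int d * (2 * pi / N) = of_int j * (2 * pi)" using cos_one_2pi_int by auto
      then have "real_of_int d = of_int j * real N" using N by (simp add: field_simps)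
      then have "d = j * int N" by (metis of_int_eq_iff of_int_mult of_int_of_nat_eq)
      then have "\<bar>j\<bar> * int N < int N" "j \<noteq> 0" using d False by (auto simp: abs_mult)
      then show False using N by (simp add: mult_less_cancel_right1)
    qed
    moreover have "\<zeta> ^ N = 1"
    proof -
      have "\<zeta> ^ N = cis (2 * pi * of_int d)" unfolding \<zeta> DeMoivre using N by (simp add: field_simps)
      then show ?thesis by (simp add: cis_multiple_2pi)
    qed
    ultimately show ?thesis using False eq by (simp add: geometric_sum)
  qed
qed

lemma (in cstar_algebra) fd_functional_minus:
  assumes "fd_functional A C \<phi>" "x \<in> carrier A" "y \<in> carrier A"
  shows "\<phi> (x \<ominus> y) = \<phi> x - \<phi> y"
  using assms scale_closed unfolding fd_functional_def lin_fun_def by (simp add: minus_eq_scale)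

context finite_stage
begin

text \<open>Liveness permits a start in \<open>D\<close> that avoids the chosen edges: either none
  of them begins in \<open>D\<close>, or an unchosen edge can be placed in front of a boundary path
  from its range.\<close>

lemma live_state:
  assumes D: "D \<in> atoms" and l: "live D"
  shows "\<exists>X \<Omega> \<omega> v. state_space G X \<Omega> \<and> \<omega> \<in> \<Omega> \<and> v \<in> D \<and> state_in G X \<omega> {v} \<and> (\<forall>e\<in>E0. \<omega> 0 \<noteq> Some e)"
  using l unfolding live_def
proof
  assume no: "\<forall>e\<in>E0. src G e \<notin> D"
  obtain v where v: "v \<in> D" using atom_ne[OF D] by blast
  have "v \<in> verts G" using v gen_verts_subset_verts[OF ultragraph Union_F] D unfolding atoms_def parts_def by auto
  from state_space_at_vertex[OF this] obtain X \<Omega> \<omega> where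
    w: "state_space G X \<Omega>" "\<omega> \<in> \<Omega>" "state_in G X \<omega> {v}" by blast
  have "\<omega> 0 \<noteq> Some e" if "e \<in> E0" for e
    using w(3) no that v unfolding state_in_def by auto
  then show ?thesis using w v by blast
next
  assume "\<exists>f\<in>edges G - E0. src G f \<in> D"
  then obtain f where f: "f \<in> edges G" "f \<notin> E0" "src G f \<in> D" by blast
  obtain u where u: "u \<in> rng G f" "u \<in> verts G" using edgeD(2,3)[OF f(1)] by blast
  from state_space_at_vertex[OF u(2)] obtain X \<Omega> \<omega> where
    w: "state_space G X \<Omega>" "\<omega> \<in> \<Omega>" "state_in G X \<omega> {u}" by blast
  have "state_in G X \<omega> (rng G f)" using w(3) by (rule state_in_mono) (use u in simp)
  then have "cons_state f \<omega> \<in> \<Omega>" using w f(1) unfolding state_space_def by blast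
  moreover have "state_in G X (cons_state f \<omega>) {src G f}" by simp
  moreover have "\<forall>e\<in>E0. cons_state f \<omega> 0 \<noteq> Some e" using f(2) by auto
  ultimately show ?thesis using w(1) f(3) by blast
qed

text \<open>The diagonal entry at the state from \<open>live_state\<close> sees \<open>P D\<close>
  but none of the subtracted ranges.\<close>

lemma gap_functional:
  assumes alg: "is_ultragraph_algebra G A p s" and D: "D \<in> atoms" and l: "live D"
  shows "\<exists>C \<psi>. fd_functional A C \<psi> \<and> \<psi> (gap D) = 1"
proof -
  obtain X \<Omega> \<omega> v where w: "state_space G X \<Omega>" "\<omega> \<in> \<Omega>" "v \<in> D" "state_in G X \<omega> {v}"
    and noE0: "\<And>e. e \<in> E0 \<Longrightarrow> \<omega> 0 \<noteq> Some e"
    using live_state[OF D l] by blast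
  obtain M where M: "\<And>\<omega> \<omega>'. \<omega> \<in> \<Omega> \<Longrightarrow> \<omega>' \<in> \<Omega> \<Longrightarrow> fd_functional A (sqrt (card \<Omega>)) (\<lambda>x. M x \<omega> \<omega>')"
    "\<And>x y \<omega> \<omega>'. x \<in> carrier A \<Longrightarrow> y \<in> carrier A \<Longrightarrow> \<omega> \<in> \<Omega> \<Longrightarrow> \<omega>' \<in> \<Omega> \<Longrightarrow>
       M (x \<otimes> y) \<omega> \<omega>' = (\<Sum>\<kappa>\<in>\<Omega>. M x \<omega> \<kappa> * M y \<kappa> \<omega>')"
    "\<And>x \<omega> \<omega>'. x \<in> carrier A \<Longrightarrow> \<omega> \<in> \<Omega> \<Longrightarrow> \<omega>' \<in> \<Omega> \<Longrightarrow> M (star A x) \<omega> \<omega>' = cnj (M x \<omega>' \<omega>)"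
    "\<And>B \<omega> \<omega>'. B \<in> gen_verts G \<Longrightarrow> \<omega> \<in> \<Omega> \<Longrightarrow> \<omega>' \<in> \<Omega> \<Longrightarrow>
       M (p B) \<omega> \<omega>' = (if \<omega> = \<omega>' \<and> state_in G X \<omega> B then 1 else 0)"
    "\<And>e \<omega> \<omega>'. e \<in> edges G \<Longrightarrow> \<omega> \<in> \<Omega> \<Longrightarrow> \<omega>' \<in> \<Omega> \<Longrightarrow>
       M (s e) \<omega> \<omega>' = (if \<omega> = cons_state e \<omega>' \<and> state_in G X \<omega>' (rng G e) then 1 else 0)"
    by (rule state_representation[OF ultragraph alg w(1) norm_one]) (rule that, assumption+)
  note M\<omega> = M(1)[OF w(2,2)]
  let ?\<psi> = "\<lambda>x. M x \<omega> \<omega>" and ?\<Sigma> = "finsum A (\<lambda>e. s e \<otimes> star A (s e)) {e \<in> E0. src G e \<in> D}"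
  have lin: "lin_fun A ?\<psi>" using M\<omega> unfolding fd_functional_def by simp
  have "?\<psi> (s e \<otimes> star A (s e)) = 0" if e: "e \<in> E0" for e
  proof -
    have "M (s e) \<omega> \<kappa> = 0" if "\<kappa> \<in> \<Omega>" for \<kappa>
      using M(5)[OF E0_edges[OF e] w(2) that] noE0[OF e] by auto
    then show ?thesis using e w(2) by (simp add: M(2))
  qed
  then have "?\<psi> ?\<Sigma> = 0" using lin_fun_finsum[OF lin finite_E0_sub ss_image] by simp
  moreover have "?\<psi> (P D) = 1"
  proof -
    obtain Y Z where YZ: "Y \<in> gen_verts G" "Z \<in> gen_verts G" "D = Y - Z" "P D = p Y \<ominus> p (Y \<inter> Z)"
      using atoms_diffs[OF D] by (rule diffs_cases)
    note YZ' = gen_verts.inter[OF YZ(1,2)]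
    have "state_in G X \<omega> Y" by (rule state_in_mono[OF w(4)]) (use w(3) YZ(3) in simp)
    \<comment> \<open>If \<open>\<omega>\<close> is an empty path, then \<open>X = {v}\<close>
      because \<open>X\<close> is nonempty; so in either case a set that contains the source of
      \<open>\<omega>\<close> contains \<open>v\<close>.\<close>
    moreover have "\<not> state_in G X \<omega> (Y \<inter> Z)"
      using w YZ(3) unfolding state_in_def state_space_def by (auto split: option.splits)
    ultimately show ?thesis
      unfolding YZ(4) using fd_functional_minus[OF M\<omega> p_rules(1)[OF YZ(1)] p_rules(1)[OF YZ']] w(2)
      by (simp add: M(4)[OF YZ(1)] M(4)[OF YZ'])
  qed
  ultimately have "?\<psi> (gap D) = 1"
    unfolding gap_def using fd_functional_minus[OF M\<omega> P_closed[OF atoms_diffs[OF D]] ss_sum_closed] by simp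
  then show ?thesis using M\<omega> by blast
qed

text \<open>The entry between the infinite paths from \<open>v\<close> and from \<open>w\<close>:
  going around shifts one to the other and collects one \<open>z\<close> per edge, so the degree
  appears as exponent. The bound involves \<open>cycle_states v\<close> but neither \<open>z\<close>
  nor \<open>w\<close>.\<close>

lemma cycle_functional:
  assumes alg: "is_ultragraph_algebra G A p s" and v: "v \<in> K0" and w: "w \<in> K0"
    and z: "cmod z = 1" and ab: "(nx ^^ a) v = (nx ^^ b) w"
  shows "\<exists>\<psi>. fd_functional A (sqrt (card (cycle_states v))) \<psi> \<and> (\<forall>m. mid {v} m {w} \<longrightarrow> \<psi> (core {v} m {w}) = z powi m)"
proof -
  let ?\<Omega> = "cycle_states v"
  note ocv = K0(2)[OF v] and ocw = K0(2)[OF w]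
  have orbit: "cycle_state ((nx ^^ k) v) \<in> ?\<Omega>" for k by (rule cycle_states_base)
  \<comment> \<open>\<open>w\<close> lies ahead of \<open>v\<close>: from the vertex shared by both
    walks, the remainder of \<open>b\<close> turns of length \<open>k\<close> leads back to
    \<open>w\<close>.\<close>
  obtain j where j: "(nx ^^ j) v = w"
  proof -
    obtain k where k: "k > 0" "(nx ^^ k) w = w" using on_cycle_step(4)[OF ocw] by blast
    have "(nx ^^ (b * k)) w = w" using k(2) by (metis funpow_mod_eq mod_mult_self2_is_0 funpow_0)
    moreover have "b * k = (b * k - b) + b" using k(1) by (cases k) auto
    ultimately have "(nx ^^ (b * k - b)) ((nx ^^ b) w) = w" by (metis funpow_add comp_apply)
    then have "(nx ^^ (b * k - b + a)) v = w" using ab by (simp add: funpow_add)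
    then show thesis by (rule that)
  qed
  have sv: "cycle_state v \<in> ?\<Omega>" using orbit[of 0] by simp
  have sw: "cycle_state w \<in> ?\<Omega>" using orbit[of j] j by simp
  have fin: "finite ?\<Omega>" using state_space_cycle_states[OF ocv] unfolding state_space_def by simp
  obtain M where M: "\<And>\<omega> \<omega>'. \<omega> \<in> ?\<Omega> \<Longrightarrow> \<omega>' \<in> ?\<Omega> \<Longrightarrow> fd_functional A (sqrt (card ?\<Omega>)) (\<lambda>x. M x \<omega> \<omega>')"
    "\<And>x y \<omega> \<omega>'. x \<in> carrier A \<Longrightarrow> y \<in> carrier A \<Longrightarrow> \<omega> \<in> ?\<Omega> \<Longrightarrow> \<omega>' \<in> ?\<Omega> \<Longrightarrow>
       M (x \<otimes> y) \<omega> \<omega>' = (\<Sum>\<kappa>\<in>?\<Omega>. M x \<omega> \<kappa> * M y \<kappa> \<omega>')"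
    "\<And>x \<omega> \<omega>'. x \<in> carrier A \<Longrightarrow> \<omega> \<in> ?\<Omega> \<Longrightarrow> \<omega>' \<in> ?\<Omega> \<Longrightarrow> M (star A x) \<omega> \<omega>' = cnj (M x \<omega>' \<omega>)"
    "\<And>B \<omega> \<omega>'. B \<in> gen_verts G \<Longrightarrow> \<omega> \<in> ?\<Omega> \<Longrightarrow> \<omega>' \<in> ?\<Omega> \<Longrightarrow>
       M (p B) \<omega> \<omega>' = (if \<omega> = \<omega>' \<and> state_in G {} \<omega> B then 1 else 0)"
    "\<And>e \<omega> \<omega>'. e \<in> edges G \<Longrightarrow> \<omega> \<in> ?\<Omega> \<Longrightarrow> \<omega>' \<in> ?\<Omega> \<Longrightarrow>
       M (s e) \<omega> \<omega>' = (if \<omega> = cons_state e \<omega>' \<and> state_in G {} \<omega>' (rng G e) then z else 0)"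
    by (rule state_representation[OF ultragraph alg state_space_cycle_states[OF ocv] z]) (rule that, assumption+)
  note Mvw = M(1)[OF sv sw]
  \<comment> \<open>The row of \<open>around\<close> at its own starting path has a single nonzero
    entry, at the shifted path.\<close>
  have row: "M (around ((nx ^^ i) v) k) (cycle_state ((nx ^^ i) v)) \<omega> =
      (if \<omega> = cycle_state ((nx ^^ (i + k)) v) then z ^ k else 0)" if \<omega>: "\<omega> \<in> ?\<Omega>" for i k \<omega>
  proof (induction k arbitrary: i)
    case 0
    have "on_cycle G ((nx ^^ i) v)" by (rule on_cycle_funpow[OF ocv])
    then show ?case using orbit[of i] \<omega> by (auto simp: M(4) singleton_gen state_in_cycle_state)
  next
    case (Suc k)
    define u where "u = (nx ^^ i) v"
    have u: "on_cycle G u" unfolding u_def by (rule on_cycle_funpow[OF ocv])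
    have nu: "nx u = (nx ^^ Suc i) v" by (simp add: u_def)
    have su: "cycle_state u \<in> ?\<Omega>" "cycle_state (nx u) \<in> ?\<Omega>" using orbit[of i] orbit[of "Suc i"] by (simp_all add: u_def)
    have "M (around u (Suc k)) (cycle_state u) \<omega> =
        (\<Sum>\<kappa>\<in>?\<Omega>. M (s (en u)) (cycle_state u) \<kappa> * M (around (nx u) k) \<kappa> \<omega>)"
      using u s_en(1)[OF u] on_cycle_step(3)[OF u] su \<omega> by (simp add: M(2))
    also have "\<dots> = (\<Sum>\<kappa>\<in>?\<Omega>. if \<kappa> = cycle_state (nx u) then z * M (around (nx u) k) (cycle_state (nx u)) \<omega> else 0)"
    proof (rule sum.cong)
      fix \<kappa> assume \<kappa>: "\<kappa> \<in> ?\<Omega>"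
      have "cycle_state u = cons_state (en u) \<kappa> \<longleftrightarrow> \<kappa> = cycle_state (nx u)"
        using cycle_state_cons[of u] by (metis cons_state_eq_iff)
      then show "M (s (en u)) (cycle_state u) \<kappa> * M (around (nx u) k) \<kappa> \<omega> =
        (if \<kappa> = cycle_state (nx u) then z * M (around (nx u) k) (cycle_state (nx u)) \<omega> else 0)"
        using M(5)[OF on_cycle_en(1)[OF u] su(1) \<kappa>] on_cycle_step(2,3)[OF u] state_in_cycle_state[OF on_cycle_step(3)[OF u]]
        by auto
    qed simp
    also have "\<dots> = z * M (around (nx u) k) (cycle_state (nx u)) \<omega>" using fin su(2) by simp
    finally show ?case using Suc.IH[of "Suc i"] unfolding nu u_def by simp
  qed
  have "M (core {v} m {w}) (cycle_state v) (cycle_state w) = z powi m" if m: "mid {v} m {w}" for m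
  proof -
    obtain c d where cd: "m = int c - int d" "(nx ^^ c) v = (nx ^^ d) w"
      using m by (rule mid_cases) (use v in auto)
    \<comment> \<open>Places the walk of length \<open>d\<close> from \<open>w\<close> on the orbit
      of \<open>v\<close>, so that \<open>row\<close> applies to both factors.\<close>
    have eqw: "(nx ^^ (j + d)) v = (nx ^^ c) v" using cd(2) j by (simp add: funpow_add add.commute[of j])
    have "M (core {v} m {w}) (cycle_state v) (cycle_state w) =
        (\<Sum>\<kappa>\<in>?\<Omega>. M (around v c) (cycle_state v) \<kappa> * cnj (M (around w d) (cycle_state w) \<kappa>))"
      using core_cycle[OF v w cd(2)] cd(1) ocv ocw sv sw by (simp add: M(2,3) star_closed)
    also have "\<dots> = (\<Sum>\<kappa>\<in>?\<Omega>. if \<kappa> = cycle_state ((nx ^^ c) v) then z ^ c * cnj (z ^ d) else 0)"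
    proof (rule sum.cong)
      fix \<kappa> assume \<kappa>: "\<kappa> \<in> ?\<Omega>"
      have "M (around w d) (cycle_state w) \<kappa> = (if \<kappa> = cycle_state ((nx ^^ c) v) then z ^ d else 0)"
        using row[OF \<kappa>, of j d] unfolding j eqw .
      moreover have "M (around v c) (cycle_state v) \<kappa> = (if \<kappa> = cycle_state ((nx ^^ c) v) then z ^ c else 0)"
        using row[OF \<kappa>, of 0 c] by simp
      ultimately show "M (around v c) (cycle_state v) \<kappa> * cnj (M (around w d) (cycle_state w) \<kappa>) =
        (if \<kappa> = cycle_state ((nx ^^ c) v) then z ^ c * cnj (z ^ d) else 0)" by simp
    qed simp
    also have "\<dots> = z ^ c * cnj z ^ d" using fin orbit[of c] by simp
    also have "\<dots> = z powi m"
    proof -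
      have "z * cnj z = 1" using z by (simp add: complex_norm_square[symmetric])
      then have "z ^ d * cnj z ^ d = 1" by (simp add: power_mult_distrib[symmetric])
      moreover have "z \<noteq> 0" using z by auto
      ultimately show ?thesis unfolding cd(1) by (simp add: power_int_diff field_simps)
    qed
    finally show ?thesis .
  qed
  then show ?thesis using Mvw by blast
qed

text \<open>The order of quantifiers matters: one \<open>C\<close> serves every \<open>D'\<close>,
  every degree and every \<open>z\<close> on the circle. The degree \<open>m0\<close> records that
  \<open>D\<close> and \<open>D'\<close> are connected.\<close>

lemma core_functional:
  assumes alg: "is_ultragraph_algebra G A p s" and D: "D \<in> atoms"
  shows "\<exists>C. \<forall>D' m0 z. mid D m0 D' \<longrightarrow> cmod z = 1 \<longrightarrow>
    (\<exists>\<psi>. fd_functional A C \<psi> \<and> (\<forall>m. mid D m D' \<longrightarrow> \<psi> (core D m D') = z powi m))"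
proof (cases "\<exists>v\<in>K0. D = {v}")
  case True
  then obtain v where v: "v \<in> K0" "D = {v}" by blast
  have "\<exists>\<psi>. fd_functional A (sqrt (card (cycle_states v))) \<psi> \<and> (\<forall>m. mid D m D' \<longrightarrow> \<psi> (core D m D') = z powi m)"
    if m0: "mid D m0 D'" and z: "cmod z = 1" for D' m0 z
  proof -
    obtain w a b where "w \<in> K0" "D' = {w}" "(nx ^^ a) v = (nx ^^ b) w"
      using m0 by (rule mid_cases) (use v in auto)
    then show ?thesis using cycle_functional[OF alg v(1) _ z] v(2) by blast
  qed
  then show ?thesis by blast
next
  case False
  then have triv: "m = 0 \<and> D' = D" if "mid D m D'" for m D'
    using that by (auto elim: mid_cases)
  show ?thesis
  proof (cases "live D")
    case True
    then obtain C \<psi> where "fd_functional A C \<psi>" "\<psi> (gap D) = 1" using gap_functional[OF alg D] by blast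
    then show ?thesis using triv by (intro exI[of _ C] allI impI exI[of _ \<psi>]) (metis core_0 power_int_0_right)
  next
    case False
    then show ?thesis using midD(3) by blast
  qed
qed

text \<open>Up to adjoints, each of the three factors is a partial isometry with a gap projection as
  source, computed by \<open>lmul_gap_orth\<close> and \<open>core_mult\<close>.\<close>

lemma nrm_matrix_unit: assumes "i \<in> indices n" shows "nrm A (matrix_unit i) \<le> 1"
proof -
  obtain \<alpha> D m D' \<beta> where i: "i = (\<alpha>, D, m, D', \<beta>)" by (cases i)
  have I: "path_to \<alpha> D" "path_to \<beta> D'" "mid D m D'" using assms unfolding i indices_def by auto
  have gg: "star A (gap C) \<otimes> gap C = gap C" if "C \<in> atoms" for C using that by (simp add: gap_star gap_mult)
  have lg: "nrm A (lmul \<gamma> (gap C)) \<le> 1" "lmul \<gamma> (gap C) \<in> carrier A" if "path_to \<gamma> C" "C \<in> atoms" for \<gamma> C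
    using nrm_le_one[OF _ _ gg[OF that(2)], of "lmul \<gamma> (gap C)"] lmul_gap_orth[OF that(2,2,1,1)] path_to_set[OF that(1)] that(2) by simp_all
  have "nrm A (core D m D') \<le> 1"
    using nrm_le_one[OF core_closed[OF I(3)] _ gg[OF midD(2)[OF I(3)]]] core_star[OF I(3)] core_mult(2)[OF core_star(1)[OF I(3)] I(3)] by simp
  moreover have c: "core D m D' \<in> carrier A" using I(3) by simp
  ultimately have "nrm A (lmul \<alpha> (gap D) \<otimes> core D m D') \<le> 1 * 1"
    using nrm_mult[OF lg(2)[OF I(1) midD(1)[OF I(3)]] c] lg[OF I(1) midD(1)[OF I(3)]] nrm_nonneg[OF c]
    by (meson mult_mono order_trans zero_le_one)
  then have 1: "nrm A (lmul \<alpha> (core D m D')) \<le> 1" using lmul_core[OF I(1,3)] by simp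
  have c1: "lmul \<alpha> (core D m D') \<in> carrier A" using c path_to_set[OF I(1)] by simp
  note l2 = lg[OF I(2) midD(2)[OF I(3)]]
  have "nrm A (matrix_unit i) \<le> nrm A (lmul \<alpha> (core D m D')) * nrm A (lmul \<beta> (gap D'))"
    unfolding i matrix_unit_def prod.case using nrm_mult[OF c1 star_closed[OF l2(2)]] nrm_star[OF l2(2)] by simp
  also have "\<dots> \<le> 1 * 1" using 1 l2 nrm_nonneg[OF l2(2)] by (intro mult_mono) auto
  finally show ?thesis by simp
qed

text \<open>Matrix units compress any index to empty words, then averaging over \<open>z\<close>
  extracts its degree. All these functionals share one bound, and the number of indices is linear in
  \<open>n\<close>.\<close>

lemma stage_estimate:
  assumes alg: "is_ultragraph_algebra G A p s"
  shows "\<exists>c. \<forall>n y b. y \<in> stage n \<longrightarrow> b \<in> carrier A \<longrightarrow> fd_eq A y b \<longrightarrow> nrm A y \<le> c * (real n + 1) * nrm A b"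
proof -
  obtain C where C: "\<And>D D' m0 z. D \<in> atoms \<Longrightarrow> mid D m0 D' \<Longrightarrow> cmod z = 1 \<Longrightarrow>
    \<exists>\<psi>. fd_functional A (C D) \<psi> \<and> (\<forall>m. mid D m D' \<longrightarrow> \<psi> (core D m D') = z powi m)"
    using core_functional[OF alg] by metis
  \<comment> \<open>There are finitely many atoms, so a sum dominates all constants without
    reference to \<open>n\<close>.\<close>
  define K where "K = (\<Sum>D\<in>atoms. \<bar>C D\<bar>)"
  have CK: "C D \<le> K" if "D \<in> atoms" for D
    using member_le_sum[OF that, of "\<lambda>D. \<bar>C D\<bar>"] finite_atoms unfolding K_def by simp
  have K0': "K \<ge> 0" unfolding K_def by (simp add: sum_nonneg)
  obtain c where c: "\<And>n. finite (indices n)" "\<And>n. real (card (indices n)) \<le> c * (real n + 1)" using card_indices by blast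
  have "nrm A y \<le> (c * K) * (real n + 1) * nrm A b"
    if y: "y \<in> stage n" and b: "b \<in> carrier A" and eq: "fd_eq A y b" for n y b
  proof -
    \<comment> \<open>Two degrees of absolute value at most \<open>n\<close> differ by at most
      \<open>2 * n\<close>, so \<open>2 * n + 1\<close> roots of unity tell them apart.\<close>
    define N where "N = 2 * n + 1"
    define \<zeta> where "\<zeta> = (\<lambda>k. cis (2 * pi / N) ^ k)"
    have \<zeta>1: "cmod (\<zeta> k) = 1" for k unfolding \<zeta>_def by (simp add: norm_power)
    have "\<exists>\<phi>. fd_functional A K \<phi> \<and> (\<forall>j\<in>indices n. \<phi> (matrix_unit j) = (if i = j then 1 else 0))"
      if i: "i \<in> indices n" for i
    proof -
      obtain \<alpha> D m D' \<beta> where ie: "i = (\<alpha>, D, m, D', \<beta>)" by (cases i)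
      have I: "path_to \<alpha> D" "path_to \<beta> D'" "mid D m D'" "\<bar>m\<bar> \<le> int n" using i unfolding ie indices_def by auto
      note at = midD[OF I(3)]
      have "\<exists>\<psi>. fd_functional A K \<psi> \<and> (\<forall>m. mid D m D' \<longrightarrow> \<psi> (core D m D') = \<zeta> k powi m)" for k
        using C[OF at(1) I(3) \<zeta>1] fd_functional_mono[OF _ CK[OF at(1)]] by blast
      then obtain \<psi> where \<psi>: "\<And>k. fd_functional A K (\<psi> k)" "\<And>k m. mid D m D' \<Longrightarrow> \<psi> k (core D m D') = \<zeta> k powi m" by metis
      \<comment> \<open>These strip the words of \<open>i\<close>: compression leaves
        \<open>core D m' D'\<close> for an index with the same words and atoms and annihilates all
        others.\<close>
      let ?a = "matrix_unit ([], D, 0, D, \<alpha>)" and ?b = "matrix_unit (\<beta>, D', 0, D', [])"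
      have ia: "([], D, 0, D, \<alpha>) \<in> indices n" and ib: "(\<beta>, D', 0, D', []) \<in> indices n"
        unfolding indices_def using I at mid_refl by auto
      \<comment> \<open>The discrete Fourier coefficient of degree \<open>m\<close> of the
        compressed element.\<close>
      define \<phi> where "\<phi> = (\<lambda>x. (\<Sum>k\<in>{..<N}. \<zeta> k powi (- m) * \<psi> k (?a \<otimes> x \<otimes> ?b)) / card {..<N})"
      have fdp: "fd_functional A K \<phi>"
        unfolding \<phi>_def
      proof (rule fd_functional_average)
        show "fd_functional A K (\<lambda>x. \<psi> k (?a \<otimes> x \<otimes> ?b))" for k
          by (rule fd_functional_compress[OF \<psi>(1) matrix_unit_closed[OF ia] matrix_unit_closed[OF ib]
            nrm_matrix_unit[OF ia] nrm_matrix_unit[OF ib] K0'])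
        show "cmod (\<zeta> k powi (- m)) \<le> 1" for k by (simp add: norm_power_int \<zeta>1)
      qed (auto simp: N_def)
      have "\<phi> (matrix_unit j) = (if i = j then 1 else 0)" if j: "j \<in> indices n" for j
      proof -
        obtain \<gamma> E m' E' \<delta> where je: "j = (\<gamma>, E, m', E', \<delta>)" by (cases j)
        have j': "(\<gamma>, E, m', E', \<delta>) \<in> indices n" using j je by simp
        have J: "path_to \<delta> E'" "mid E m' E'" "\<bar>m'\<bar> \<le> int n" using j' unfolding indices_def by auto
        have prod: "?a \<otimes> matrix_unit j \<otimes> ?b = (if \<alpha> = \<gamma> \<and> D = E \<and> \<delta> = \<beta> \<and> E' = D' then core D m' D' else \<zero>)"
        proof (cases "\<alpha> = \<gamma> \<and> D = E")
          case True
          have k: "([], D, m', E', \<delta>) \<in> indices n" using J True unfolding indices_def by auto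
          have "?a \<otimes> matrix_unit j = matrix_unit ([], D, m', E', \<delta>)"
            unfolding je matrix_unit_mult[OF ia j'] using True by simp
          moreover have "matrix_unit ([], D, m', D', []) = core D m' D'" if "E' = D'"
            using that J True core_gap(2)[of D m' D'] by (simp add: matrix_unit_def gap_star at)
          ultimately show ?thesis using True matrix_unit_mult[OF k ib] by auto
        next
          case False
          then show ?thesis unfolding je matrix_unit_mult[OF ia j'] using matrix_unit_closed[OF ib] by auto
        qed
        have zero: "\<psi> k \<zero> = 0" for k
          using fd_functional_minus[OF \<psi>(1)[of k] zero_closed zero_closed] by (simp add: minus_eq_scale)
        show ?thesis
        proof (cases "\<alpha> = \<gamma> \<and> D = E \<and> \<delta> = \<beta> \<and> E' = D'")
          case False
          then have "?a \<otimes> matrix_unit j \<otimes> ?b = \<zero>" unfolding prod by auto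
          then have "\<phi> (matrix_unit j) = 0" unfolding \<phi>_def by (simp add: zero)
          moreover have "i \<noteq> j" using False unfolding ie je by auto
          ultimately show ?thesis by simp
        next
          case True
          have "\<zeta> k powi (- m) * \<psi> k (core D m' D') = \<zeta> k powi (m' - m)" for k
          proof -
            have "\<zeta> k \<noteq> 0" using \<zeta>1[of k] by auto
            then show ?thesis using \<psi>(2)[of m' k] J True by (simp add: power_int_diff power_int_minus field_simps)
          qed
          then have "\<phi> (matrix_unit j) = (\<Sum>k<N. \<zeta> k powi (m' - m)) / of_nat N"
            unfolding \<phi>_def prod using True by simp
          also have "(\<Sum>k<N. \<zeta> k powi (m' - m)) = (if m' - m = 0 then of_nat N else 0)"
            unfolding \<zeta>_def by (rule sum_roots_of_unity_powi) (use I J in \<open>auto simp: N_def\<close>)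
          also have "\<dots> / of_nat N = (if m = m' then 1 else 0)" unfolding N_def by (simp del: of_nat_add of_nat_mult of_nat_Suc)
          finally show ?thesis using True unfolding ie je by simp
        qed
      qed
      then show ?thesis using fdp by blast
    qed
    then obtain \<phi> where \<phi>: "\<And>i. i \<in> indices n \<Longrightarrow> fd_functional A K (\<phi> i)"
      "\<And>i j. i \<in> indices n \<Longrightarrow> j \<in> indices n \<Longrightarrow> \<phi> i (matrix_unit j) = (if i = j then 1 else 0)" by metis
    have "nrm A y \<le> real (card (indices n)) * K * nrm A b"
      by (rule nrm_le_of_coordinates[OF c(1) matrix_unit_closed nrm_matrix_unit \<phi> y[unfolded stage_def] b eq])
    also have "\<dots> \<le> (c * (real n + 1)) * K * nrm A b"
      using c(2)[of n] K0' nrm_nonneg[OF b] by (intro mult_right_mono) auto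
    finally show ?thesis by (simp add: mult_ac)
  qed
  then show ?thesis by blast
qed

lemma stage_contractive:
  assumes alg: "is_ultragraph_algebra G A p s"
    and y: "y \<in> stage n" and b: "b \<in> carrier A" and eq: "fd_eq A y b"
  shows "nrm A y \<le> nrm A b"
proof -
  obtain c where "\<And>n y b. y \<in> stage n \<Longrightarrow> b \<in> carrier A \<Longrightarrow> fd_eq A y b \<Longrightarrow> nrm A y \<le> c * (real n + 1) * nrm A b"
    using stage_estimate[OF alg] by blast
  from nrm_le_of_filtration[where V=stage, OF stage_subset stage_star stage_mult this y b eq]
  show ?thesis .
qed

lemma star_alg_in_stage:
  assumes "T \<subseteq> (\<Union>n. stage n)" "x \<in> star_alg A T" shows "\<exists>n. x \<in> stage n"
  using assms(2)
proof induction
  case zero show ?case unfolding stage_def by (blast intro: lspan.zero)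
next
  case (gen x) then show ?case using assms(1) by blast
next
  case (add x y)
  then obtain m n where mn: "x \<in> stage m" "y \<in> stage n" by blast
  have "x \<in> stage (max m n)" "y \<in> stage (max m n)"
    using mn stage_mono[of m "max m n"] stage_mono[of n "max m n"] by auto
  then have "x \<oplus> y \<in> stage (max m n)" unfolding stage_def by (rule lspan_add[OF matrix_unit_image])
  then show ?case by blast
next
  case (mult x y) then show ?case using stage_mult by blast
next
  case (star x) then show ?case using stage_star by blast
next
  case (scale x a)
  then obtain n where "x \<in> stage n" by blast
  then have "a \<odot> x \<in> stage n" unfolding stage_def by (rule lspan_scale[OF matrix_unit_image])
  then show ?case by blast
qed

end

theorem theorem6p3:
  fixes G :: "('v, 'e) ultragraph"
    and A :: "'a cstar"
    and p :: "'v set \<Rightarrow> 'a"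
    and s :: "'e \<Rightarrow> 'a"
  assumes "is_ultragraph G"
    and "no_infinite_receivers G"
    and "no_cycle_has_exit G"
    and "no_infinite_backward_chains G"
    and "every_vertex_terminates G"
    and "is_ultragraph_algebra G A p s"
  shows "residually_finite_dimensional A"
proof -
  interpret ultragraph_cstar G A p s
    using assms unfolding is_ultragraph_algebra_def
    by (intro ultragraph_cstar.intro rfd_ultragraph.intro ultragraph_cstar_axioms.intro) auto
  let ?T = "p ` gen_verts G \<union> s ` edges G"
  have gen: "generates A ?T" using assms(6) unfolding is_ultragraph_algebra_def by simp
  show ?thesis
  proof (rule rfd_of_local_estimate[OF gen])
    fix y b assume y: "y \<in> star_alg A ?T" and b: "b \<in> carrier A" and eq: "fd_eq A y b"
    obtain T where T: "finite T" "T \<subseteq> ?T" "y \<in> star_alg A T" using star_alg_finite_support[OF y] by blast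
    \<comment> \<open>The finite set \<open>T\<close> is lifted to finitely many indices, since
      \<open>p\<close> and \<open>s\<close> need not be injective.\<close>
    obtain F1 where F1: "F1 \<subseteq> gen_verts G" "finite F1" "T \<inter> p ` gen_verts G = p ` F1"
      using finite_subset_image[of "T \<inter> p ` gen_verts G" p "gen_verts G"] T(1) by auto
    have "T - p ` gen_verts G \<subseteq> s ` edges G" using T(2) by auto
    then obtain E1 where E1: "E1 \<subseteq> edges G" "finite E1" "T - p ` gen_verts G = s ` E1"
      using finite_subset_image[of "T - p ` gen_verts G" s "edges G"] T(1) by auto
    \<comment> \<open>Chosen edges on cycles enter through the finite orbits of their sources; the
      transient ones are kept as edges.\<close>
    define E0 where "E0 = E1 \<inter> transient"
    define K0 where "K0 = (\<Union>e\<in>E1 - transient. range (\<lambda>k. (nx ^^ k) (src G e)))"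
    define F where "F = F1 \<union> (\<lambda>e. {src G e}) ` E0 \<union> rng G ` E0 \<union> (\<lambda>v. {v}) ` K0"
    have oc: "on_cycle G (src G e)" if "e \<in> E1 - transient" for e
      using that E1(1) unfolding transient_def by auto
    have K0: "on_cycle G v" "nx v \<in> K0" if v: "v \<in> K0" for v
    proof -
      obtain e k where e: "e \<in> E1 - transient" "v = (nx ^^ k) (src G e)" using v unfolding K0_def by blast
      show "on_cycle G v" unfolding e(2) by (rule on_cycle_funpow[OF oc[OF e(1)]])
      have "nx v = (nx ^^ Suc k) (src G e)" unfolding e(2) by simp
      then show "nx v \<in> K0" unfolding K0_def using e(1) by blast
    qed
    have finK0: "finite K0" unfolding K0_def using E1(2) finite_orbit[OF oc] by blast
    interpret S: finite_stage G A p s E0 K0 F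
    proof unfold_locales
      show "finite E0" "E0 \<subseteq> transient" unfolding E0_def using E1(2) by auto
      show "finite F" unfolding F_def using F1(2) finK0 E1(2) by (simp add: E0_def)
      show "F \<subseteq> gen_verts G" unfolding F_def
        using F1(1) E1(1) K0(1) src_gen rng_gen by (auto simp: E0_def gen_verts.vertex on_cycle_verts edgeD(1))
    qed (use K0 finK0 in \<open>auto simp: F_def\<close>)
    have "T \<subseteq> (\<Union>n. S.stage n)"
    proof
      fix t assume t: "t \<in> T"
      show "t \<in> (\<Union>n. S.stage n)"
      proof (cases "t \<in> p ` gen_verts G")
        case True
        then obtain Z where "Z \<in> F1" "t = p Z" using t F1(3) by blast
        then show ?thesis using S.p_in_stage[of Z] unfolding F_def by blast
      next
        case False
        then obtain e where e: "e \<in> E1" "t = s e" using t E1(3) by blast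
        show ?thesis
        proof (cases "e \<in> transient")
          case True
          then show ?thesis using S.s_in_stage[of e] e unfolding E0_def by blast
        next
          case nt: False
          then have "src G e \<in> K0" using e unfolding K0_def by (auto intro!: bexI[of _ e] image_eqI[of _ _ 0])
          moreover have "en (src G e) = e" using on_cycle_edge(1)[of e] oc[of e] e nt E1(1) by auto
          ultimately show ?thesis using S.s_en_in_stage[of "src G e"] e by auto
        qed
      qed
    qed
    then obtain n where "y \<in> S.stage n" using S.star_alg_in_stage T(3) by blast
    then show "nrm A y \<le> nrm A b" using S.stage_contractive[OF assms(6) _ b eq] by blast
  qed
qed

end
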